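(* Let $(P_t)_{t \in \mathbb{R}_+}$ be a stochastically monotone Feller semigroup on $\mathbb{R}$. Then there exists a family $\left((P^{(n)}_t)_{t \in \mathbb{R}_+}\right)_{n \geq 1}$ with $P^{(1)}_t = P_t$ for all $t$, such that for each $n \geq 2$, $(P^{(n)}_t)_{t\in\mathbb{R}_+}$ is a Feller semigroup on $\mathbb{R}^n$ all of whose kernels $P^{(n)}_t$ are order-preserving, and such that for every $t \geq 0$ the family of Markov kernels $(P^{(n)}_t)_{n \geq 1}$ is consistent.
   Context: A Markov kernel $K$ on a measurable space $S$ is a map $S\times\mathscr{S}\to\mathbb{R}$ such that $K(x,\cdot)$ is a probability measure for each $x$ and $K(\cdot,B)$ is measurable for each $B$; it acts on bounded measurable $f$ by $Kf(x)=\int f(y)\,K(x,dy)$, and composition is $(KL)(x,B)=\int L(y,B)\,K(x,dy)$. A Markov semigroup is a family $(K_t)_{t\ge0}$ of Markov kernels with $K_0(x,\cdot)=\delta_x$ and $K_{s+t}=K_sK_t$. For a locally compact separable metric space $S$, with $\mathcal{C}_0(S)$ the continuous functions vanishing at infinity, a Markov semigroup is Feller if (Fa) $K_t f\in\mathcal{C}_0(S)$ for all $t\ge0$, $f\in\mathcal{C}_0(S)$, and (Fb) $\lim_{t\to0^+}\sup_x|K_tf(x)-f(x)|=0$ for all $f\in\mathcal{C}_0(S)$. A Markov semigroup $(P_t)$ on $\mathbb{R}$ is stochastically monotone if for every $t\ge0$, $P_t f$ is non-decreasing whenever $f$ is bounded, Borel and non-decreasing. For $\mathbf{x}\in\mathbb{R}^n$,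 let $\mathbb{R}^n_{\mathbf{x}}$ be the set of $\mathbf{y}\in\mathbb{R}^n$ such that for all $i,j$, $x_i\le x_j\Rightarrow y_i\le y_j$; a Markov kernel $K$ on $\mathbb{R}^n$ is order-preserving if $K(\mathbf{x},\mathbb{R}^n_{\mathbf{x}})=1$ for all $\mathbf{x}$. For $i_1,\dots,i_k\in\{1,\dots,n\}$ (repetitions allowed) let $\pi^n_{i_1,\dots,i_k}(x_1,\dots,x_n)=(x_{i_1},\dots,x_{i_k})$. A family $(K^{(n)})_{n\ge1}$, $K^{(n)}$ a Markov kernel on $S^n$, is consistent if for all $1\le k\le n$, all $i_1,\dots,i_k\in\{1,\dots,n\}$, all $\mathbf{x}\in S^n$ and measurable $B\subset S^k$, $K^{(n)}(\mathbf{x},(\pi^n_{i_1,\dots,i_k})^{-1}(B))=K^{(k)}(\pi^n_{i_1,\dots,i_k}(\mathbf{x}),B)$. *)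

theory Defs
  imports "HOL-Probability.Probability"
begin

(* A Markov kernel on the measurable space M is represented, as in the Giry monad
library, by a map K :: 'a <Rightarrow> 'a measure which is measurable into prob_algebra M:
K x is a probability measure on M for every x, and x <mapsto> K x B is measurable.
Then K(x,B) = measure (K x) B, Kf(x) = integral (K x) f, composition KL is bind. *)

definition markov_kernel :: "'a measure \<Rightarrow> ('a \<Rightarrow> 'a measure) \<Rightarrow> bool" where
  "markov_kernel M K \<longleftrightarrow> K \<in> M \<rightarrow>\<^sub>M prob_algebra M"

definition kernel_apply :: "('a \<Rightarrow> 'a measure) \<Rightarrow> ('a \<Rightarrow> real) \<Rightarrow> 'a \<Rightarrow> real" where
  "kernel_apply K f x = (\<integral>y. f y \<partial>(K x))"

definition markov_semigroup :: "'a measure \<Rightarrow> (real \<Rightarrow> 'a \<Rightarrow> 'a measure) \<Rightarrow> bool" where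
  "markov_semigroup M P \<longleftrightarrow>
     (\<forall>t\<ge>0. markov_kernel M (P t)) \<and>
     (\<forall>x\<in>space M. P 0 x = return M x) \<and>
     (\<forall>s\<ge>0. \<forall>t\<ge>0. \<forall>x\<in>space M. P (s + t) x = P s x \<bind> P t)"

definition C0 :: "'a::topological_space set \<Rightarrow> ('a \<Rightarrow> real) \<Rightarrow> bool" where
  "C0 S f \<longleftrightarrow> continuous_on S f \<and>
     (\<forall>e>0. \<exists>K. compact K \<and> K \<subseteq> S \<and> (\<forall>x\<in>S - K. \<bar>f x\<bar> < e))"

definition feller_semigroup ::
  "'a::topological_space measure \<Rightarrow> (real \<Rightarrow> 'a \<Rightarrow> 'a measure) \<Rightarrow> bool" where
  "feller_semigroup M P \<longleftrightarrow> markov_semigroup M P \<and>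
     (\<forall>t\<ge>0. \<forall>f. C0 (space M) f \<longrightarrow> C0 (space M) (kernel_apply (P t) f)) \<and>
     (\<forall>f. C0 (space M) f \<longrightarrow>
        (\<forall>e>0. \<exists>d>0. \<forall>t. 0 < t \<and> t < d \<longrightarrow>
           (\<forall>x\<in>space M. \<bar>kernel_apply (P t) f x - f x\<bar> \<le> e)))"

definition stoch_monotone :: "(real \<Rightarrow> real \<Rightarrow> real measure) \<Rightarrow> bool" where
  "stoch_monotone P \<longleftrightarrow>
     (\<forall>t\<ge>0. \<forall>f::real \<Rightarrow> real. bounded (range f) \<and> f \<in> borel_measurable borel \<and> mono f
        \<longrightarrow> mono (kernel_apply (P t) f))"

(* R^n is represented by extensional functions {..<n} <rightarrow><^sub>E UNIV (coordinates
0..n-1), with the product sigma algebra (= Borel) and the product topology. *)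
abbreviation Rn :: "nat \<Rightarrow> (nat \<Rightarrow> real) measure" where
  "Rn n \<equiv> PiM {..<n} (\<lambda>_. borel)"

definition ord_cone :: "nat \<Rightarrow> (nat \<Rightarrow> real) \<Rightarrow> (nat \<Rightarrow> real) set" where
  "ord_cone n x = {y \<in> space (Rn n). \<forall>i<n. \<forall>j<n. x i \<le> x j \<longrightarrow> y i \<le> y j}"

definition order_preserving :: "nat \<Rightarrow> ((nat \<Rightarrow> real) \<Rightarrow> (nat \<Rightarrow> real) measure) \<Rightarrow> bool" where
  "order_preserving n K \<longleftrightarrow> (\<forall>x\<in>space (Rn n). measure (K x) (ord_cone n x) = 1)"

definition proj :: "nat list \<Rightarrow> (nat \<Rightarrow> real) \<Rightarrow> (nat \<Rightarrow> real)" where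
  "proj is x = restrict (\<lambda>j. x (is ! j)) {..<length is}"

definition consistent ::
  "(nat \<Rightarrow> (nat \<Rightarrow> real) \<Rightarrow> (nat \<Rightarrow> real) measure) \<Rightarrow> bool" where
  "consistent K \<longleftrightarrow> (\<forall>n\<ge>1. markov_kernel (Rn n) (K n)) \<and>
     (\<forall>n k. 1 \<le> k \<and> k \<le> n \<longrightarrow>
       (\<forall>is. length is = k \<and> set is \<subseteq> {..<n} \<longrightarrow>
         (\<forall>x\<in>space (Rn n). \<forall>B\<in>sets (Rn k).
            measure (K n x) (proj is -` B \<inter> space (Rn n)) = measure (K k (proj is x)) B)))"

definition embed1 :: "real \<Rightarrow> (nat \<Rightarrow> real)" where
  "embed1 r = restrict (\<lambda>_. r) {..<1}"

end

(*
For a stochastically monotone kernel p let comon p x be the comonotone coupling of the laws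
p (x i): apply all quantile functions to one uniform variable. It has the largest lower-orthant
probabilities INF i. p (x i) (D i) among all couplings. By monotonicity, the superlevel sets of
this function of x are again orthants, so comon p maps mixtures of orthant indicators to (uniform
limits of) such mixtures and respects the orthant order. Hence composing comon (P h) along the
steps h of a partition of [0, t] gives orthant probabilities that decrease under refinement. As
the marginals are always P t (x i), the limits along the directed set of partitions are the orthant
probabilities of a probability measure flow t x. The convergence is uniform in x, which yields the
semigroup property. Order preservation and consistency pass to the limit. The Feller property of
the n-point motions follows from that of P by running two starting points as one 2n-point motion.

All motions are built at once on real sequences (nat => real); the n-point motion is the projection
to the first n coordinates.
*)
theory Submission
  imports Defs
begin

subsection \<open>Lower orthants and motions on sequences\<close>

text \<open>A composition of comonotone couplings is in general not comonotone, so
  \<open>comon (P t)\<close> need not form a semigroup; refining the partition repairs this. The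
  partitions of an interval form an uncountable directed set, so limits along it are nets, for which
  dominated convergence can fail. Two devices replace sequential arguments. For the existence of the
  limit law, each coordinate is coded by its rational cuts; the limits for finitely many cuts form a
  projective family, and the fixed marginals, acting as tightness, force almost every limiting
  pattern to be the cut of a real number. For integration, uniform limits of nonnegative
  combinations of orthant indicators can be integrated against limits and orthant inequalities.
  Sequences serve as state space because a single relabelling law, for arbitrary index maps, covers
  both consistency and the joint motion of two starting points. For the Feller property
  \<open>arctan\<close> gauges distance: it is bounded and increasing, so under an order-preserving
  coupling the mean of |arctan Y - arctan Z| is the absolute difference of two one-point
  means.\<close>

abbreviation Rinf :: "(nat \<Rightarrow> real) measure" where
  "Rinf \<equiv> PiM UNIV (\<lambda>_. borel)"

definition is_down :: "real set \<Rightarrow> bool" where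
  "is_down D \<longleftrightarrow> (\<forall>r\<in>D. \<forall>s\<le>r. s \<in> D)"

text \<open>With finitely many proper sides, orthant probabilities can be compared by finite sums
  over the sides, and an orthant is a finite-dimensional event.\<close>

definition lower_family :: "(nat \<Rightarrow> real set) \<Rightarrow> bool" where
  "lower_family D \<longleftrightarrow> (\<forall>i. is_down (D i)) \<and> finite {i. D i \<noteq> UNIV}"

definition orthant :: "(nat \<Rightarrow> real set) \<Rightarrow> (nat \<Rightarrow> real) set" where
  "orthant D = {y. \<forall>i. y i \<in> D i}"

lemma is_down_borel: "is_down D \<Longrightarrow> D \<in> sets borel"
  by (rule real_interval_borel_measurable) (auto simp: is_down_def is_interval_1)

lemma is_down_atMost [simp]: "is_down {..a}"
  and is_down_UNIV [simp]: "is_down UNIV"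
  by (auto simp: is_down_def)

lemma is_down_Int: "is_down D \<Longrightarrow> is_down E \<Longrightarrow> is_down (D \<inter> E)"
  by (auto simp: is_down_def)

lemma lower_family_down: "lower_family D \<Longrightarrow> is_down (D i)"
  by (simp add: lower_family_def)

lemma lower_family_Int: "lower_family D \<Longrightarrow> lower_family E \<Longrightarrow> lower_family (\<lambda>i. D i \<inter> E i)"
  unfolding lower_family_def
  by (auto simp: is_down_Int intro: finite_subset[of _ "{i. D i \<noteq> UNIV} \<union> {i. E i \<noteq> UNIV}"])

lemma lower_family_UNIV: "lower_family (\<lambda>_. UNIV)"
  by (simp add: lower_family_def)

lemma orthant_UNIV: "orthant (\<lambda>_. UNIV) = UNIV"
  by (simp add: orthant_def)

lemma orthant_Int: "orthant (\<lambda>i. D i \<inter> E i) = orthant D \<inter> orthant E"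
  by (auto simp: orthant_def)

lemma lower_family_single: "is_down E \<Longrightarrow> lower_family ((\<lambda>_. UNIV)(i := E))"
  by (auto simp: lower_family_def intro: finite_subset[of _ "{i}"])

lemma orthant_single: "orthant ((\<lambda>_. UNIV)(i := E)) = {y. y i \<in> E}"
  by (auto simp: orthant_def)

lemma space_Rinf [simp]: "space Rinf = UNIV"
  by (simp add: space_PiM)

lemma orthant_sets: "lower_family D \<Longrightarrow> orthant D \<in> sets Rinf"
proof -
  assume D: "lower_family D"
  have [measurable]: "D i \<in> sets borel" for i
    using D by (simp add: is_down_borel lower_family_down)
  have "{y\<in>space Rinf. \<forall>i. y i \<in> D i} \<in> sets Rinf" by measurable
  then show ?thesis by (simp add: orthant_def)
qed

lemma Int_stable_orthant: "Int_stable {orthant D |D. lower_family D}"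
  unfolding Int_stable_def using lower_family_Int orthant_Int by blast

lemma sets_Rinf_orthant: "sets Rinf = sigma_sets UNIV {orthant D |D. lower_family D}"
proof
  show "sigma_sets UNIV {orthant D |D. lower_family D} \<subseteq> sets Rinf"
    using sets.sigma_sets_subset[of "{orthant D |D. lower_family D}" Rinf] orthant_sets by auto
  let ?S = "sigma UNIV {orthant D |D. lower_family D}"
  have "(\<lambda>y. y) \<in> ?S \<rightarrow>\<^sub>M Rinf"
  proof (rule measurable_PiM_single')
    show "(\<lambda>y. y i) \<in> ?S \<rightarrow>\<^sub>M borel" for i
    proof (rule borel_measurable_iff_le[THEN iffD2], rule allI)
      fix a
      have "{y. y i \<le> a} \<in> {orthant D |D. lower_family D}"
        using lower_family_single[of "{..a}" i] orthant_single[of i "{..a}"] by auto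
      then show "{w \<in> space ?S. w i \<le> a} \<in> sets ?S" by auto
    qed
  qed auto
  then have "A \<in> sets Rinf \<Longrightarrow> A \<in> sets ?S" for A
    using measurable_sets[of "\<lambda>y. y" ?S Rinf A] by simp
  then show "sets Rinf \<subseteq> sigma_sets UNIV {orthant D |D. lower_family D}" by auto
qed

text \<open>Orthants form an intersection-stable generator containing the whole space, so every
  identity between laws below reduces to orthant probabilities.\<close>

lemma Rinf_measure_eqI:
  assumes "prob_space M" "prob_space N" "sets M = sets Rinf" "sets N = sets Rinf"
    and eq: "\<And>D. lower_family D \<Longrightarrow> measure M (orthant D) = measure N (orthant D)"
  shows "M = N"
proof -
  interpret M: prob_space M by fact
  interpret N: prob_space N by fact
  show ?thesis
    by (rule measure_eqI_generator_eq[OF Int_stable_orthant, where \<Omega>=UNIV and A="\<lambda>_. UNIV"])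
       (use assms sets_Rinf_orthant lower_family_UNIV orthant_UNIV
         in \<open>auto simp: M.emeasure_eq_measure N.emeasure_eq_measure\<close>)
qed

lemma Rinf_prob_kernelI:
  assumes "\<And>x. prob_space (K x)" "\<And>x. sets (K x) = sets Rinf"
    and "\<And>D. lower_family D \<Longrightarrow> (\<lambda>x. measure (K x) (orthant D)) \<in> borel_measurable Rinf"
  shows "K \<in> Rinf \<rightarrow>\<^sub>M prob_algebra Rinf"
proof (rule measurable_prob_algebra_generated[OF sets_Rinf_orthant Int_stable_orthant])
  fix A assume "A \<in> {orthant D |D. lower_family D}"
  moreover have "emeasure (K x) A = ennreal (measure (K x) A)" for x
    using assms(1)[of x] by (simp add: prob_space.finite_measure finite_measure.emeasure_eq_measure)
  ultimately show "(\<lambda>x. emeasure (K x) A) \<in> borel_measurable Rinf"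
    using assms(3) by auto
qed (use assms in auto)

lemma kernel_prob: "K \<in> M \<rightarrow>\<^sub>M prob_algebra N \<Longrightarrow> x \<in> space M \<Longrightarrow> prob_space (K x)"
  and kernel_sets: "K \<in> M \<rightarrow>\<^sub>M prob_algebra N \<Longrightarrow> x \<in> space M \<Longrightarrow> sets (K x) = sets N"
  by (auto dest!: measurable_space simp: space_prob_algebra)

lemma comp_measurable_Rinf [measurable]: "(\<lambda>y. y \<circ> \<sigma>) \<in> Rinf \<rightarrow>\<^sub>M Rinf" for \<sigma> :: "nat \<Rightarrow> nat"
  by (rule measurable_PiM_single') (auto simp: comp_def)

lemma pred_order_Rinf [measurable]: "Measurable.pred Rinf (\<lambda>y. y i \<le> y j)"
  unfolding pred_def by (intro borel_measurable_le measurable_component_singleton) auto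

text \<open>The invariant shared by single comonotone steps, their compositions and the limit flow.
  The relabelling map is arbitrary: non-injective maps give consistency with repeated indices, and
  maps onto the even or odd indices extract two motions from one.\<close>

definition motion :: "(real \<Rightarrow> real measure) \<Rightarrow> ((nat \<Rightarrow> real) \<Rightarrow> (nat \<Rightarrow> real) measure) \<Rightarrow> bool" where
  "motion p K \<longleftrightarrow> K \<in> Rinf \<rightarrow>\<^sub>M prob_algebra Rinf \<and>
    (\<forall>x i. distr (K x) borel (\<lambda>y. y i) = p (x i)) \<and>
    (\<forall>x \<sigma>. distr (K x) Rinf (\<lambda>y. y \<circ> \<sigma>) = K (x \<circ> \<sigma>)) \<and>
    (\<forall>x i j. x i \<le> x j \<longrightarrow> (AE y in K x. y i \<le> y j))"

lemma motionD:
  assumes "motion p K"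
  shows motion_kernel: "K \<in> Rinf \<rightarrow>\<^sub>M prob_algebra Rinf"
    and motion_prob: "prob_space (K x)"
    and motion_sets: "sets (K x) = sets Rinf"
    and motion_space: "space (K x) = UNIV"
    and motion_marginal: "distr (K x) borel (\<lambda>y. y i) = p (x i)"
    and motion_relabel: "distr (K x) Rinf (\<lambda>y. y \<circ> \<sigma>) = K (x \<circ> \<sigma>)"
    and motion_order: "x i \<le> x j \<Longrightarrow> AE y in K x. y i \<le> y j"
proof -
  show *: "K \<in> Rinf \<rightarrow>\<^sub>M prob_algebra Rinf" using assms by (simp add: motion_def)
  show "prob_space (K x)" "sets (K x) = sets Rinf"
    using kernel_prob[OF *, of x] kernel_sets[OF *, of x] by auto
  then show "space (K x) = UNIV" using sets_eq_imp_space_eq by force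
qed (use assms in \<open>auto simp: motion_def\<close>)

lemma motion_measure_single:
  assumes "motion p K" "E \<in> sets borel"
  shows "measure (K x) {y. y i \<in> E} = measure (p (x i)) E"
proof -
  have "measure (distr (K x) borel (\<lambda>y. y i)) E = measure (K x) ((\<lambda>y. y i) -` E \<inter> space (K x))"
    by (rule measure_distr) (use assms(2) motion_sets[OF assms(1)] in \<open>auto cong: measurable_cong_sets\<close>)
  then show ?thesis
    by (simp add: motion_marginal[OF assms(1)] motion_space[OF assms(1)] vimage_def)
qed

lemma motion_return: "motion (return borel) (return Rinf)"
  unfolding motion_def by (auto simp: distr_return AE_return)

text \<open>Marginals and relabellings are push-forwards under fixed maps, which pass through
  \<open>bind\<close>; the order clause passes because it holds almost surely in each of the two
  stages.\<close>

lemma motion_bind: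
  assumes K: "motion p K" and L: "motion q L" and q: "q \<in> borel \<rightarrow>\<^sub>M prob_algebra borel"
  shows "motion (\<lambda>r. p r \<bind> q) (\<lambda>x. K x \<bind> L)"
proof -
  note [measurable] = motion_kernel[OF K] motion_kernel[OF L] q
  note [simp] = motion_space[OF K] motion_space[OF L]
  note [measurable_cong] = motion_sets[OF K] motion_sets[OF L]
  have Ls: "L \<in> K x \<rightarrow>\<^sub>M subprob_algebra Rinf" for x
    by (rule measurable_prob_algebraD) measurable
  have qs: "q \<in> borel \<rightarrow>\<^sub>M subprob_algebra borel"
    by (rule measurable_prob_algebraD) measurable
  have "distr (K x \<bind> L) borel (\<lambda>y. y i) = p (x i) \<bind> q" for x i
  proof -
    have "distr (K x \<bind> L) borel (\<lambda>y. y i) = K x \<bind> (\<lambda>y. distr (L y) borel (\<lambda>y. y i))"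
      by (rule distr_bind[OF Ls]) auto
    also have "\<dots> = K x \<bind> (\<lambda>y. q (y i))"
      by (simp add: motion_marginal[OF L])
    also have "\<dots> = distr (K x) borel (\<lambda>y. y i) \<bind> q"
      by (rule bind_distr[OF _ qs, symmetric]) auto
    finally show ?thesis by (simp add: motion_marginal[OF K])
  qed
  moreover have "distr (K x \<bind> L) Rinf (\<lambda>y. y \<circ> \<sigma>) = K (x \<circ> \<sigma>) \<bind> L" for x \<sigma>
  proof -
    have "distr (K x \<bind> L) Rinf (\<lambda>y. y \<circ> \<sigma>) = K x \<bind> (\<lambda>y. distr (L y) Rinf (\<lambda>y. y \<circ> \<sigma>))"
      by (rule distr_bind[OF Ls]) auto
    also have "\<dots> = K x \<bind> (\<lambda>y. L (y \<circ> \<sigma>))"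
      by (simp add: motion_relabel[OF L])
    also have "\<dots> = distr (K x) Rinf (\<lambda>y. y \<circ> \<sigma>) \<bind> L"
      by (rule bind_distr[OF _ measurable_prob_algebraD[OF motion_kernel[OF L]], symmetric]) (simp_all add: measurable_cong_sets[OF motion_sets[OF K] refl])
    finally show ?thesis by (simp add: motion_relabel[OF K])
  qed
  moreover have "AE y in K x \<bind> L. y i \<le> y j" if "x i \<le> x j" for x i j
  proof -
    have "(AE y in K x \<bind> L. y i \<le> y j) \<longleftrightarrow> (AE y in K x. AE z in L y. z i \<le> z j)"
      by (rule AE_bind[OF Ls pred_order_Rinf])
    moreover have "AE y in K x. AE z in L y. z i \<le> z j"
      using motion_order[OF K that] by eventually_elim (rule motion_order[OF L])
    ultimately show ?thesis by simp
  qed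
  ultimately show ?thesis
    unfolding motion_def by (auto intro: measurable_bind_prob_space)
qed

subsection \<open>The comonotone coupling and mixtures of orthants\<close>

abbreviation unif :: "real measure" where
  "unif \<equiv> restrict_space lborel {0<..<1}"

lemma prob_space_unif: "prob_space unif"
  by (auto simp: emeasure_restrict_space space_restrict_space intro!: prob_spaceI)

lemma measure_unif: "0 \<le> u \<Longrightarrow> u \<le> 1 \<Longrightarrow> measure unif {0<..<u} = u"
  by (subst measure_restrict_space) auto

lemma space_unif [simp]: "space unif = {0<..<1}"
  by (simp add: space_restrict_space)

text \<open>The left-continuous generalised inverse of the distribution function. It is evaluated
  only at levels strictly between 0 and 1, where the infimum is over a nonempty set that is bounded
  below.\<close>

definition quantile :: "real measure \<Rightarrow> real \<Rightarrow> real" where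
  "quantile M u = Inf {a. u \<le> cdf M a}"

lemma real_distributionI: "prob_space M \<Longrightarrow> sets M = sets borel \<Longrightarrow> real_distribution M"
  by (simp add: real_distribution_def real_distribution_axioms_def)

lemma quantile_le_iff:
  assumes "real_distribution M" "0 < u" "u < 1"
  shows "quantile M u \<le> a \<longleftrightarrow> u \<le> cdf M a"
proof -
  interpret cdf_distribution M using assms(1) by (simp add: cdf_distribution_def)
  show ?thesis unfolding quantile_def by (rule pseudoinverse[OF assms(2,3), symmetric])
qed

lemma quantile_mono:
  assumes "real_distribution M" "0 < u" "u \<le> v" "v < 1"
  shows "quantile M u \<le> quantile M v"
  using quantile_le_iff[of M v "quantile M v"] quantile_le_iff[of M u "quantile M v"] assms by auto

lemma distr_quantile: "real_distribution M \<Longrightarrow> distr unif borel (quantile M) = M"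
  using cdf_distribution.distr_I_eq_M[of M]
  by (simp add: cdf_distribution_def quantile_def[abs_def])

lemma measurable_quantile: "real_distribution M \<Longrightarrow> quantile M \<in> unif \<rightarrow>\<^sub>M borel"
  using cdf_distribution.measurable_CI[of M]
  by (simp add: cdf_distribution_def quantile_def[abs_def] measurable_lborel1 cong: measurable_cong_sets sets_restrict_space_cong)

definition comon :: "(real \<Rightarrow> real measure) \<Rightarrow> (nat \<Rightarrow> real) \<Rightarrow> (nat \<Rightarrow> real) measure" where
  "comon p x = distr unif Rinf (\<lambda>u i. quantile (p (x i)) u)"

text \<open>\<open>down_mono\<close> is stochastic monotonicity tested on indicators of complements
  of down-sets: raising the starting point takes mass away from lower sets.\<close>

locale mono_kernel =
  fixes p :: "real \<Rightarrow> real measure"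
  assumes kernel [measurable]: "p \<in> borel \<rightarrow>\<^sub>M prob_algebra borel"
    and down_mono: "is_down D \<Longrightarrow> r \<le> s \<Longrightarrow> measure (p s) D \<le> measure (p r) D"
begin

lemma prob_p: "prob_space (p r)" and sets_p: "sets (p r) = sets borel"
  using kernel_prob[OF kernel] kernel_sets[OF kernel] by auto

lemma distribution_p: "real_distribution (p r)"
  using prob_p sets_p by (rule real_distributionI)

text \<open>Joint measurability in the starting point and the uniform variable comes from the Galois
  connection \<open>quantile_le_iff\<close>, which replaces the quantile by the distribution
  function, measurable in the starting point for each fixed level.\<close>

lemma measurable_comon_map [measurable]:
  "(\<lambda>(x, u) i. quantile (p (x i)) u) \<in> Rinf \<Otimes>\<^sub>M unif \<rightarrow>\<^sub>M Rinf"
proof (rule measurable_PiM_single')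
  fix i
  have [measurable]: "(\<lambda>r. cdf (p r) a) \<in> borel_measurable borel" for a
    unfolding cdf_def by measurable
  have [measurable]: "snd \<in> Rinf \<Otimes>\<^sub>M unif \<rightarrow>\<^sub>M borel"
    by (rule measurable_compose[OF measurable_snd]) (auto intro: measurable_restrict_space1)
  have "{w \<in> space (Rinf \<Otimes>\<^sub>M unif). quantile (p (fst w i)) (snd w) \<le> a}
     = {w \<in> space (Rinf \<Otimes>\<^sub>M unif). snd w \<le> cdf (p (fst w i)) a}" for a
    by (auto simp: space_pair_measure quantile_le_iff[OF distribution_p])
  also have "\<dots> a \<in> sets (Rinf \<Otimes>\<^sub>M unif)" for a
    by measurable
  finally show "(\<lambda>x. (case x of (x, u) \<Rightarrow> \<lambda>i. quantile (p (x i)) u) i) \<in> Rinf \<Otimes>\<^sub>M unif \<rightarrow>\<^sub>M borel"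
    by (simp add: borel_measurable_iff_le split_beta)
qed auto

lemma measurable_comon_map1: "(\<lambda>u i. quantile (p (x i)) u) \<in> unif \<rightarrow>\<^sub>M Rinf"
  by (rule measurable_PiM_single') (auto intro: measurable_quantile[OF distribution_p])

lemma quantile_order:
  assumes "r \<le> s" "0 < u" "u < 1" shows "quantile (p r) u \<le> quantile (p s) u"
proof -
  have "u \<le> cdf (p s) (quantile (p s) u)"
    using quantile_le_iff[OF distribution_p] assms by auto
  also have "\<dots> \<le> cdf (p r) (quantile (p s) u)"
    unfolding cdf_def by (rule down_mono) (use assms in auto)
  finally show ?thesis using quantile_le_iff[OF distribution_p] assms by auto
qed

text \<open>Coordinate \<open>i\<close> of the sample depends on \<open>x\<close> only through
  \<open>x i\<close> and the common uniform variable. Hence relabelling is an identity of maps, and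
  order holds pointwise because quantile functions increase with the starting point.\<close>

lemma motion_comon: "motion p (comon p)"
  unfolding motion_def
proof (intro conjI allI impI)
  have "unif \<in> space (prob_algebra unif)"
    by (simp add: space_prob_algebra prob_space_unif)
  then show "comon p \<in> Rinf \<rightarrow>\<^sub>M prob_algebra Rinf"
    unfolding comon_def[abs_def]
    by (intro measurable_distr_prob_space2[OF measurable_const]) (auto intro: measurable_comon_map)
  fix x i
  show "distr (comon p x) borel (\<lambda>y. y i) = p (x i)"
    unfolding comon_def
    by (subst distr_distr[OF _ measurable_comon_map1])
       (auto simp: comp_def distr_quantile[OF distribution_p])
  show "distr (comon p x) Rinf (\<lambda>y. y \<circ> \<sigma>) = comon p (x \<circ> \<sigma>)" for \<sigma>
    unfolding comon_def
    by (subst distr_distr[OF _ measurable_comon_map1]) (auto simp: comp_def intro: comp_measurable_Rinf[unfolded comp_def])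
  show "AE y in comon p x. y i \<le> y j" if "x i \<le> x j" for j
    unfolding comon_def
    using pred_order_Rinf[of i j]
    by (subst AE_distr_iff[OF measurable_comon_map1])
       (auto simp: pred_def intro!: AE_I2 quantile_order that)
qed

text \<open>The event that coordinate \<open>i\<close> falls into \<open>D i\<close> is an initial
  segment of the unit interval of length \<open>m i\<close>. Initial segments are nested, so the
  length of their intersection is the infimum of the lengths.\<close>

lemma measure_comon_orthant:
  assumes D: "lower_family D"
  shows "measure (comon p x) (orthant D) = (INF i. measure (p (x i)) (D i))"
proof -
  interpret U: prob_space unif by (rule prob_space_unif)
  define S where "S i = {u\<in>{0<..<1}. quantile (p (x i)) u \<in> D i}" for i
  define m where "m i = measure (p (x i)) (D i)" for i
  have down: "is_down (D i)" and [measurable]: "D i \<in> sets borel" for i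
    using D by (auto simp: lower_family_down is_down_borel)
  have S_eq: "S i = quantile (p (x i)) -` D i \<inter> space unif" for i
    by (auto simp: S_def)
  have S_sets: "S i \<in> sets unif" for i
    unfolding S_eq by (rule measurable_sets[OF measurable_quantile[OF distribution_p]]) auto
  have mS: "measure unif (S i) = m i" for i
    unfolding S_eq m_def
    by (subst distr_quantile[OF distribution_p, of "x i", symmetric],
        subst measure_distr[OF measurable_quantile[OF distribution_p]]) auto
  have bdd: "bdd_below (range m)" by (auto simp: m_def bdd_below_def intro: exI[of _ 0])
  have m1: "m i \<le> 1" for i using mS[of i] U.prob_le_1 by metis
  have IS: "(\<Inter>i. S i) \<in> sets unif" using S_sets by auto
  have "measure (comon p x) (orthant D) = measure unif ((\<lambda>u i. quantile (p (x i)) u) -` orthant D \<inter> space unif)"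
    unfolding comon_def by (rule measure_distr[OF measurable_comon_map1 orthant_sets[OF D]])
  also have "(\<lambda>u i. quantile (p (x i)) u) -` orthant D \<inter> space unif = (\<Inter>i. S i)"
    by (auto simp: S_def orthant_def)
  also have "measure unif (\<Inter>i. S i) = (INF i. m i)"
  proof (rule antisym)
    show "measure unif (\<Inter>i. S i) \<le> (INF i. m i)"
      using IS S_sets by (intro cINF_greatest) (auto simp: mS[symmetric] intro!: U.finite_measure_mono)
    \<comment> \<open>A level outside the initial segment \<open>S i\<close> bounds its length. Read
      contrapositively, every level strictly below \<open>m i\<close> belongs to
      \<open>S i\<close>.\<close>
    have *: "m i \<le> u" if "u \<in> {0<..<1}" "u \<notin> S i" for u i
    proof -
      have "S i \<subseteq> {0<..<u}"
      proof
        fix v assume v: "v \<in> S i"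
        show "v \<in> {0<..<u}"
        proof (rule ccontr)
          assume "v \<notin> {0<..<u}"
          then have "u \<le> v" "v < 1" using v by (auto simp: S_def)
          then have "quantile (p (x i)) u \<le> quantile (p (x i)) v"
            using that by (intro quantile_mono distribution_p) auto
          then show False
            using down[of i] v that by (auto simp: S_def is_down_def)
        qed
      qed
      then have "measure unif (S i) \<le> measure unif {0<..<u}"
        using that by (intro U.finite_measure_mono) (auto simp: sets_restrict_space_iff)
      then show ?thesis using that by (simp add: mS measure_unif)
    qed
    have sub: "{0<..<(INF i. m i)} \<subseteq> (\<Inter>i. S i)"
    proof (intro subsetI INT_I)
      fix u i assume u: "u \<in> {0<..<(INF i. m i)}"
      then have "u < m i" using cINF_lower[OF bdd, of i] by auto
      moreover from this have "u < 1" using m1[of i] by linarith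
      ultimately show "u \<in> S i" using * [of u i] u by force
    qed
    have le1: "(INF i. m i) \<le> 1" using cINF_lower[OF bdd, of 0] m1[of 0] by simp
    have ge0: "0 \<le> (INF i. m i)" by (rule cINF_greatest) (auto simp: m_def)
    have "(INF i. m i) = measure unif {0<..<(INF i. m i)}"
      using le1 ge0 by (simp add: measure_unif)
    also have "\<dots> \<le> measure unif (\<Inter>i. S i)"
      using sub IS by (intro U.finite_measure_mono) auto
    finally show "(INF i. m i) \<le> measure unif (\<Inter>i. S i)" .
  qed
  finally show ?thesis by (simp add: m_def)
qed

text \<open>The Frechet-Hoeffding upper bound: an orthant is contained in each single-coordinate
  event that defines it, and the probability of that event is fixed by the marginal.\<close>

lemma motion_le_comon:
  assumes K: "motion p K" and D: "lower_family D"
  shows "measure (K x) (orthant D) \<le> measure (comon p x) (orthant D)"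
  unfolding measure_comon_orthant[OF D]
proof (rule cINF_greatest)
  fix i
  interpret prob_space "K x" by (rule motion_prob[OF K])
  have Di: "D i \<in> sets borel" using D by (simp add: is_down_borel lower_family_down)
  have "measure (K x) (orthant D) \<le> measure (K x) {y. y i \<in> D i}"
  proof (rule finite_measure_mono)
    have "{y\<in>space Rinf. y i \<in> D i} \<in> sets Rinf" using Di by measurable
    then show "{y. y i \<in> D i} \<in> sets (K x)" by (simp add: motion_sets[OF K])
  qed (auto simp: orthant_def)
  also have "\<dots> = measure (p (x i)) (D i)" by (rule motion_measure_single[OF K Di])
  finally show "measure (K x) (orthant D) \<le> measure (p (x i)) (D i)" .
qed simp

end

section \<open>The uniformly closed cone generated by orthant indicators\<close>

text \<open>Coefficients are nonnegative so that orthant inequalities between laws can be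
  integrated. Uniform limits are included because the layer-cake formula yields members only up to a
  uniform error. Each later property is proved on indicators and carried through the three closure
  rules.\<close>

inductive mixture_cone :: "((nat \<Rightarrow> real) \<Rightarrow> real) \<Rightarrow> bool" where
  orthant: "lower_family D \<Longrightarrow> mixture_cone (indicator (orthant D))"
| add: "mixture_cone f \<Longrightarrow> mixture_cone g \<Longrightarrow> mixture_cone (\<lambda>y. f y + g y)"
| scale: "0 \<le> c \<Longrightarrow> mixture_cone f \<Longrightarrow> mixture_cone (\<lambda>y. c * f y)"
| limit: "(\<And>e. 0 < e \<Longrightarrow> \<exists>g. mixture_cone g \<and> (\<forall>y. \<bar>f y - g y\<bar> \<le> e)) \<Longrightarrow> mixture_cone f"

lemma mixture_cone_measurable: "mixture_cone f \<Longrightarrow> f \<in> borel_measurable Rinf"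
proof (induction rule: mixture_cone.induct)
  case (limit f)
  then have "\<forall>n. \<exists>g. g \<in> borel_measurable Rinf \<and> (\<forall>y. \<bar>f y - g y\<bar> \<le> 1 / real (Suc n))"
    by (metis of_nat_0_less_iff zero_less_Suc divide_pos_pos zero_less_one)
  then obtain g where g: "\<And>n. g n \<in> borel_measurable Rinf" "\<And>n y. \<bar>f y - g n y\<bar> \<le> 1 / real (Suc n)"
    by metis
  have "(\<lambda>n. g n y) \<longlonglongrightarrow> f y" for y
    by (rule metric_tendsto_imp_tendsto[OF LIMSEQ_inverse_real_of_nat])
       (use g(2) in \<open>auto simp: dist_real_def abs_minus_commute inverse_eq_divide\<close>)
  then show ?case
    by (rule borel_measurable_LIMSEQ_real[OF _ g(1)])
qed (auto intro!: borel_measurable_indicator orthant_sets)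

lemma mixture_cone_bounded: "mixture_cone f \<Longrightarrow> \<exists>B. \<forall>y. \<bar>f y\<bar> \<le> B"
proof (induction rule: mixture_cone.induct)
  case (orthant D) show ?case by (rule exI[of _ 1]) (auto simp: indicator_def)
next
  case (add f g)
  then obtain A B where "\<forall>y. \<bar>f y\<bar> \<le> A" "\<forall>y. \<bar>g y\<bar> \<le> B" by auto
  then have "\<forall>y. \<bar>f y + g y\<bar> \<le> A + B" by (meson abs_triangle_ineq add_mono order_trans)
  then show ?case by blast
next
  case (scale c f)
  then obtain A where "\<forall>y. \<bar>f y\<bar> \<le> A" by auto
  then have "\<forall>y. \<bar>c * f y\<bar> \<le> c * A" using scale by (auto simp: abs_mult intro: mult_left_mono)
  then show ?case by blast
next
  case (limit f)
  obtain g where g: "\<forall>y. \<bar>f y - g y\<bar> \<le> 1" "\<exists>A. \<forall>y. \<bar>g y\<bar> \<le> A"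
    using limit[of 1] by auto
  then obtain A where A: "\<forall>y. \<bar>g y\<bar> \<le> A" by auto
  have "\<bar>f y\<bar> \<le> A + 1" for y
    using A[THEN spec, of y] g(1)[THEN spec, of y] by linarith
  then show ?case by blast
qed

lemma integrable_bounded:
  fixes f :: "'a \<Rightarrow> real"
  assumes "prob_space M" "sets M = sets N" "f \<in> borel_measurable N" "\<exists>B. \<forall>y. \<bar>f y\<bar> \<le> B"
  shows "integrable M f"
proof -
  interpret prob_space M by fact
  obtain B where "\<forall>y. \<bar>f y\<bar> \<le> B" using assms(4) by blast
  then show ?thesis
    using assms(2,3) by (intro integrable_const_bound[of _ B]) (auto cong: measurable_cong_sets)
qed

lemma mixture_cone_integrable: "mixture_cone f \<Longrightarrow> prob_space M \<Longrightarrow> sets M = sets Rinf \<Longrightarrow> integrable M f"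
  by (rule integrable_bounded[OF _ _ mixture_cone_measurable mixture_cone_bounded])

lemma integral_uniform_close:
  fixes f g :: "'a \<Rightarrow> real"
  assumes "prob_space M" "integrable M f" "integrable M g" "\<forall>y. \<bar>f y - g y\<bar> \<le> e"
  shows "\<bar>(\<integral>y. f y \<partial>M) - (\<integral>y. g y \<partial>M)\<bar> \<le> e"
proof -
  interpret prob_space M by fact
  have "\<bar>\<integral>y. f y - g y \<partial>M\<bar> \<le> (\<integral>y. \<bar>f y - g y\<bar> \<partial>M)" by simp
  also have "\<dots> \<le> (\<integral>y. e \<partial>M)"
    using assms by (intro integral_mono) auto
  also have "\<dots> = e" by (simp add: prob_space)
  finally show ?thesis using assms by simp
qed

lemma mixture_cone_zero: "mixture_cone (\<lambda>_. 0)"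
  using mixture_cone.scale[OF order_refl mixture_cone.orthant[OF lower_family_UNIV]] by simp

lemma mixture_cone_sum: "finite A \<Longrightarrow> (\<And>k. k \<in> A \<Longrightarrow> mixture_cone (f k)) \<Longrightarrow> mixture_cone (\<lambda>y. \<Sum>k\<in>A. f k y)"
  by (induction rule: finite_induct) (auto intro: mixture_cone_zero mixture_cone.add)

lemma card_le_real:
  fixes z :: real assumes "0 \<le> z" "z \<le> real N"
  shows "card {k\<in>{1..N}. real k \<le> z} = nat \<lfloor>z\<rfloor>"
proof -
  have "{k\<in>{1..N}. real k \<le> z} = {1..nat \<lfloor>z\<rfloor>}"
    using assms by (auto simp: le_nat_floor) linarith+
  then show ?thesis by simp
qed

text \<open>Layer-cake decomposition of \<open>f\<close> over its superlevel sets.\<close>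
lemma mixture_cone_superlevel:
  assumes f: "\<And>y. 0 \<le> f y" "\<And>y. f y \<le> 1"
    and lev: "\<And>v. 0 < v \<Longrightarrow> v \<le> 1 \<Longrightarrow> \<exists>D. lower_family D \<and> {y. v \<le> f y} = orthant D"
  shows "mixture_cone f"
proof (rule mixture_cone.limit)
  fix e :: real assume "0 < e"
  then obtain N :: nat where N: "1 / real N < e" "0 < N"
    by (metis nat_approx_posE of_nat_0_less_iff zero_less_Suc)
  \<comment> \<open>At each point \<open>g\<close> is \<open>f\<close> rounded down to a multiple of
    \<open>1 / real N\<close>: the sum counts the levels \<open>k / N\<close> not exceeding
    \<open>f y\<close>.\<close>
  define g where "g y = (\<Sum>k\<in>{1..N}. (1 / real N) * indicator {y. real k / real N \<le> f y} y)" for y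
  have "mixture_cone g" unfolding g_def[abs_def]
  proof (intro mixture_cone_sum mixture_cone.scale)
    fix k assume "k \<in> {1..N}"
    then obtain D where "lower_family D" "{y. real k / real N \<le> f y} = orthant D"
      using lev[of "real k / real N"] by auto
    then show "mixture_cone (\<lambda>y. indicator {y. real k / real N \<le> f y} y)" using mixture_cone.orthant by simp
  qed auto
  moreover have "\<bar>f y - g y\<bar> \<le> e" for y
  proof -
    have "g y = (1 / real N) * (\<Sum>k\<in>{1..N}. if real k \<le> real N * f y then 1 else 0)"
      unfolding g_def sum_distrib_left using N
      by (intro sum.cong) (auto simp: indicator_def field_simps)
    also have "(\<Sum>k\<in>{1..N}. if real k \<le> real N * f y then 1 else 0) = real (card {k\<in>{1..N}. real k \<le> real N * f y})"
      by (simp add: sum.If_cases Int_def)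
    also have "\<dots> = of_int \<lfloor>real N * f y\<rfloor>"
      using f[of y] by (subst card_le_real) (auto simp: mult_left_le)
    finally have g: "real N * g y = of_int \<lfloor>real N * f y\<rfloor>" using N by simp
    then have "\<bar>real N * f y - real N * g y\<bar> \<le> 1" by linarith
    then have "real N * \<bar>f y - g y\<bar> \<le> 1"
      by (simp add: abs_mult flip: right_diff_distrib)
    then have "\<bar>f y - g y\<bar> \<le> 1 / real N" using N by (simp add: field_simps)
    then show ?thesis using N by simp
  qed
  ultimately show "\<exists>g. mixture_cone g \<and> (\<forall>y. \<bar>f y - g y\<bar> \<le> e)" by blast
qed

lemma (in mono_kernel) mixture_cone_comon:
  assumes D: "lower_family D"
  shows "mixture_cone (\<lambda>x. measure (comon p x) (orthant D))"
proof (rule mixture_cone_superlevel)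
  have pr: "prob_space (comon p x)" for x by (rule motion_prob[OF motion_comon])
  show "0 \<le> measure (comon p x) (orthant D)" "measure (comon p x) (orthant D) \<le> 1" for x
    by (rule measure_nonneg, rule prob_space.prob_le_1[OF pr])
  fix v :: real assume v: "0 < v" "v \<le> 1"
  define E where "E i = {r. v \<le> measure (p r) (D i)}" for i
  have "is_down (E i)" for i
    unfolding E_def is_down_def
    using down_mono[OF lower_family_down[OF D]] by (blast intro: order_trans)
  \<comment> \<open>Trivial sides stay trivial because \<open>v \<le> 1\<close>; this keeps the
    number of proper sides finite.\<close>
  moreover have "E i = UNIV" if "D i = UNIV" for i
  proof -
    have "measure (p r) UNIV = 1" for r
      using prob_space.prob_space[OF prob_p[of r]] sets_eq_imp_space_eq[OF sets_p[of r]] by simp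
    then show ?thesis using that v by (simp add: E_def)
  qed
  then have "finite {i. E i \<noteq> UNIV}"
    using D by (auto simp: lower_family_def intro: finite_subset[of _ "{i. D i \<noteq> UNIV}"])
  moreover have "{x. v \<le> measure (comon p x) (orthant D)} = orthant E"
    unfolding measure_comon_orthant[OF D]
    by (subst le_cINF_iff) (auto simp: E_def orthant_def bdd_below_def intro: exI[of _ 0])
  ultimately show "\<exists>E. lower_family E \<and> {x. v \<le> measure (comon p x) (orthant D)} = orthant E"
    by (auto simp: lower_family_def)
qed

text \<open>Integration against a probability kernel is linear, positive and a contraction in the
  uniform norm, so it respects all closure rules of the cone and only orthant indicators need
  checking.\<close>

lemma mixture_cone_kernel:
  assumes K: "K \<in> Rinf \<rightarrow>\<^sub>M prob_algebra Rinf"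
    and base: "\<And>D. lower_family D \<Longrightarrow> mixture_cone (\<lambda>x. measure (K x) (orthant D))"
  shows "mixture_cone f \<Longrightarrow> mixture_cone (\<lambda>x. \<integral>y. f y \<partial>K x)"
proof (induction rule: mixture_cone.induct)
  case (orthant D)
  then show ?case using base[of D] kernel_sets[OF K] orthant_sets[of D] by simp
next
  case (add f g)
  have "(\<lambda>x. \<integral>y. f y + g y \<partial>K x) = (\<lambda>x. (\<integral>y. f y \<partial>K x) + (\<integral>y. g y \<partial>K x))"
    using add mixture_cone_integrable kernel_prob[OF K] kernel_sets[OF K] by auto
  then show ?case using add mixture_cone.add by simp
next
  case (scale c f)
  then show ?case using mixture_cone.scale by simp
next
  case (limit f)
  have f: "mixture_cone f" using limit by (intro mixture_cone.limit) blast
  show ?case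
  proof (rule mixture_cone.limit)
    fix e :: real assume "0 < e"
    then obtain g where g: "mixture_cone g" "mixture_cone (\<lambda>x. \<integral>y. g y \<partial>K x)" "\<forall>y. \<bar>f y - g y\<bar> \<le> e"
      using limit by blast
    have "\<bar>(\<integral>y. f y \<partial>K x) - (\<integral>y. g y \<partial>K x)\<bar> \<le> e" for x
      using kernel_prob[OF K] kernel_sets[OF K] f g
      by (intro integral_uniform_close mixture_cone_integrable) auto
    then show "\<exists>g. mixture_cone g \<and> (\<forall>x. \<bar>(\<integral>y. f y \<partial>K x) - g x\<bar> \<le> e)" using g by blast
  qed
qed

text \<open>The filter is arbitrary, so dominated convergence is replaced by uniform approximation:
  replacing \<open>f\<close> by \<open>g\<close> costs at most \<open>e/4\<close> under every law at
  once.\<close>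

lemma mixture_cone_integral_tendsto:
  assumes M: "\<And>h. prob_space (M h)" "\<And>h. sets (M h) = sets Rinf"
    and N: "prob_space N" "sets N = sets Rinf"
    and conv: "\<And>D. lower_family D \<Longrightarrow> ((\<lambda>h. measure (M h) (orthant D)) \<longlongrightarrow> measure N (orthant D)) F"
  shows "mixture_cone f \<Longrightarrow> ((\<lambda>h. \<integral>y. f y \<partial>M h) \<longlongrightarrow> (\<integral>y. f y \<partial>N)) F"
proof (induction rule: mixture_cone.induct)
  case (orthant D)
  then show ?case using conv[of D] M N orthant_sets[of D] by simp
next
  case (add f g)
  then show ?case using M N tendsto_add[of _ _ F] by (simp add: mixture_cone_integrable)
next
  case (scale c f)
  then show ?case by (auto intro: tendsto_mult_left)
next
  case (limit f)
  have f: "mixture_cone f" using limit by (intro mixture_cone.limit) blast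
  show ?case
  proof (rule tendstoI)
    fix e :: real assume e: "0 < e"
    then obtain g where g: "mixture_cone g" "((\<lambda>h. \<integral>y. g y \<partial>M h) \<longlongrightarrow> (\<integral>y. g y \<partial>N)) F" "\<forall>y. \<bar>f y - g y\<bar> \<le> e/4"
      using limit(1)[of "e/4"] by auto
    have 1: "\<bar>(\<integral>y. f y \<partial>M h) - (\<integral>y. g y \<partial>M h)\<bar> \<le> e/4" for h
      using M f g by (intro integral_uniform_close mixture_cone_integrable) auto
    have 2: "\<bar>(\<integral>y. f y \<partial>N) - (\<integral>y. g y \<partial>N)\<bar> \<le> e/4"
      using N f g by (intro integral_uniform_close mixture_cone_integrable) auto
    have "\<forall>\<^sub>F h in F. dist (\<integral>y. g y \<partial>M h) (\<integral>y. g y \<partial>N) < e/4"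
      using g(2) e by (intro tendstoD) auto
    then show "\<forall>\<^sub>F h in F. dist (\<integral>y. f y \<partial>M h) (\<integral>y. f y \<partial>N) < e"
    proof eventually_elim
      case (elim h)
      then show ?case unfolding dist_real_def using 1[of h] 2 e by linarith
    qed
  qed
qed

definition orthant_le :: "(nat \<Rightarrow> real) measure \<Rightarrow> (nat \<Rightarrow> real) measure \<Rightarrow> bool" where
  "orthant_le M N \<longleftrightarrow> (\<forall>D. lower_family D \<longrightarrow> measure M (orthant D) \<le> measure N (orthant D))"

text \<open>This is what nonnegative coefficients buy: the lower orthant order, which compares sets
  only, becomes an inequality between integrals over the whole cone.\<close>

lemma mixture_cone_integral_mono:
  assumes M: "prob_space M" "sets M = sets Rinf"
    and N: "prob_space N" "sets N = sets Rinf"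
    and le: "orthant_le M N"
  shows "mixture_cone f \<Longrightarrow> (\<integral>y. f y \<partial>M) \<le> (\<integral>y. f y \<partial>N)"
proof (induction rule: mixture_cone.induct)
  case (orthant D)
  then show ?case using le M N orthant_sets[of D] by (simp add: orthant_le_def)
next
  case (add f g)
  then show ?case using M N by (simp add: mixture_cone_integrable)
next
  case (scale c f)
  then show ?case by (auto intro: mult_left_mono)
next
  case (limit f)
  have f: "mixture_cone f" using limit by (intro mixture_cone.limit) blast
  show ?case
  proof (rule field_le_epsilon)
    fix e :: real assume e: "0 < e"
    then obtain g where g: "mixture_cone g" "(\<integral>y. g y \<partial>M) \<le> (\<integral>y. g y \<partial>N)" "\<forall>y. \<bar>f y - g y\<bar> \<le> e/2"
      using limit(1)[of "e/2"] by auto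
    have "\<bar>(\<integral>y. f y \<partial>M) - (\<integral>y. g y \<partial>M)\<bar> \<le> e/2"
      using M f g by (intro integral_uniform_close mixture_cone_integrable) auto
    moreover have "\<bar>(\<integral>y. f y \<partial>N) - (\<integral>y. g y \<partial>N)\<bar> \<le> e/2"
      using N f g by (intro integral_uniform_close mixture_cone_integrable) auto
    ultimately show "(\<integral>y. f y \<partial>M) \<le> (\<integral>y. f y \<partial>N) + e" using g(2) by linarith
  qed
qed

lemma measure_bind_kernel:
  assumes "prob_space M" "sets M = sets Rinf" "K \<in> Rinf \<rightarrow>\<^sub>M prob_algebra Rinf" "A \<in> sets Rinf"
  shows "measure (M \<bind> K) A = (\<integral>y. measure (K y) A \<partial>M)"
proof -
  interpret prob_space M by fact
  show ?thesis
    by (rule measure_bind[OF _ assms(4)])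
       (use assms in \<open>auto intro!: measurable_prob_algebraD cong: measurable_cong_sets\<close>)
qed

subsection \<open>Limits of measures with fixed marginals\<close>

text \<open>The limit law is controlled directly only on closed half-lines with rational endpoints.
  The three shapes of \<open>D\<close> use three facts on the distribution function: it vanishes at
  minus infinity (empty set), is right-continuous (closed half-line), and its left limit is the mass
  of the open half-line.\<close>

lemma down_set_approx:
  assumes M: "real_distribution M" and D: "is_down D" "D \<noteq> UNIV" and e: "0 < e"
  shows "\<exists>q. measure M (sym_diff D {..of_rat q}) < e"
proof -
  interpret real_distribution M by fact
  show ?thesis
  proof (cases "D = {}")
    case True
    have "\<forall>\<^sub>F x in at_bot. cdf M x < e"
      using cdf_lim_at_bot e by (rule order_tendstoD)
    then obtain b where b: "\<And>x. x \<le> b \<Longrightarrow> cdf M x < e"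
      by (auto simp: eventually_at_bot_linorder)
    obtain q where "b - 1 < real_of_rat q" "real_of_rat q < b"
      using of_rat_dense[of "b - 1" b] by auto
    then show ?thesis using b[of "real_of_rat q"] True by (auto simp: cdf_def)
  next
    case False
    define c where "c = Sup D"
    obtain b where b: "b \<notin> D" using D(2) by auto
    then have bdd: "bdd_above D" using D(1) unfolding is_down_def bdd_above_def
      by (meson linear)
    have lt: "x \<in> D" if "x < c" for x
      using that D(1) False less_cSup_iff[OF False bdd] unfolding c_def is_down_def by fastforce
    have le: "x \<le> c" if "x \<in> D" for x
      using that bdd unfolding c_def by (rule cSup_upper)
    show ?thesis
    proof (cases "c \<in> D")
      case True
      then have D': "D = {..c}" using lt le by (force simp: order_le_less)
      have "(cdf M \<longlongrightarrow> cdf M c) (at_right c)"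
        using cdf_is_right_cont[of c] by (simp add: continuous_within)
      then have "\<forall>\<^sub>F x in at_right c. cdf M x < cdf M c + e"
        using e by (intro order_tendstoD) auto
      then obtain b where b: "c < b" "\<And>x. c < x \<Longrightarrow> x < b \<Longrightarrow> cdf M x < cdf M c + e"
        unfolding eventually_at_right_field by auto
      obtain q where q: "c < real_of_rat q" "real_of_rat q < b"
        using of_rat_dense[OF b(1)] by auto
      then have "sym_diff D {..real_of_rat q} = {c<..real_of_rat q}" unfolding D' by auto
      then show ?thesis using b(2)[OF q] cdf_diff_eq[OF q(1)] by (intro exI[of _ q]) simp
    next
      case False
      then have D': "D = {..<c}" using lt le by (force simp: order_le_less)
      have "\<forall>\<^sub>F x in at_left c. cdf M x > measure M {..<c} - e"
        using e by (intro order_tendstoD[OF cdf_at_left]) auto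
      then obtain b where b: "b < c" "\<And>x. b < x \<Longrightarrow> x < c \<Longrightarrow> cdf M x > measure M {..<c} - e"
        unfolding eventually_at_left_field by auto
      obtain q where q: "b < real_of_rat q" "real_of_rat q < c"
        using of_rat_dense[OF b(1)] by auto
      then have *: "sym_diff D {..real_of_rat q} = {..<c} - {..real_of_rat q}" unfolding D' by auto
      have "measure M ({..<c} - {..real_of_rat q}) = measure M {..<c} - cdf M (real_of_rat q)"
        unfolding cdf_def using q by (intro finite_measure_Diff) auto
      then show ?thesis using b(2)[OF q] unfolding * [symmetric] by (intro exI[of _ q]) linarith
    qed
  qed
qed

lemma measure_marginal:
  assumes "sets N = sets Rinf" "E \<in> sets borel"
  shows "measure N {y. y i \<in> E} = measure (distr N borel (\<lambda>y. y i)) E"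
proof -
  have sp: "space N = UNIV" using sets_eq_imp_space_eq[OF assms(1)] by simp
  have "(\<lambda>y. y i) \<in> N \<rightarrow>\<^sub>M borel"
    by (simp add: measurable_cong_sets[OF assms(1) refl])
  from measure_distr[OF this assms(2)] show ?thesis by (simp add: sp vimage_def)
qed

lemma coordinate_sets: "E \<in> sets borel \<Longrightarrow> {y. y i \<in> E} \<in> sets Rinf"
proof -
  assume [measurable]: "E \<in> sets borel"
  have "{y\<in>space Rinf. y i \<in> E} \<in> sets Rinf" by measurable
  then show ?thesis by simp
qed

text \<open>A point in exactly one of two orthants violates one side only. The resulting bound sees
  the law through its one-dimensional marginals alone, so it is uniform over all couplings with the
  same marginals.\<close>

lemma orthant_measure_diff:
  assumes N: "prob_space N" "sets N = sets Rinf"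
    and D: "lower_family D" "lower_family E"
    and T: "finite T" "\<And>i. i \<notin> T \<Longrightarrow> D i = E i"
  shows "\<bar>measure N (orthant D) - measure N (orthant E)\<bar>
     \<le> (\<Sum>i\<in>T. measure (distr N borel (\<lambda>y. y i)) (sym_diff (D i) (E i)))"
proof -
  interpret prob_space N by fact
  have [measurable]: "orthant D \<in> sets N" "orthant E \<in> sets N"
    using D N(2) orthant_sets by auto
  have b: "sym_diff (D i) (E i) \<in> sets borel" for i
    using is_down_borel lower_family_down D by (meson sets.Diff sets.Un)
  have s: "{y. y i \<in> sym_diff (D i) (E i)} \<in> sets N" for i
    using coordinate_sets[OF b] N(2) by simp
  have "\<bar>prob (orthant D) - prob (orthant E)\<bar> \<le> prob (sym_diff (orthant D) (orthant E))"
  proof -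
    have "prob A \<le> prob B + prob (sym_diff A B)" if [measurable]: "A \<in> sets N" "B \<in> sets N" for A B
    proof -
      have "prob A \<le> prob (B \<union> sym_diff A B)" by (rule finite_measure_mono) auto
      also have "\<dots> \<le> prob B + prob (sym_diff A B)" by (rule measure_Un_le) auto
      finally show ?thesis .
    qed
    from this[of "orthant D" "orthant E"] this[of "orthant E" "orthant D"] show ?thesis
      by (auto simp: Un_commute)
  qed
  also have "\<dots> \<le> prob (\<Union>i\<in>T. {y. y i \<in> sym_diff (D i) (E i)})"
  proof (rule finite_measure_mono)
    show "sym_diff (orthant D) (orthant E) \<subseteq> (\<Union>i\<in>T. {y. y i \<in> sym_diff (D i) (E i)})"
    proof
      fix y assume "y \<in> sym_diff (orthant D) (orthant E)"
      then obtain i where "y i \<in> sym_diff (D i) (E i)" by (auto simp: orthant_def)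
      moreover from this have "i \<in> T" using T(2) by blast
      ultimately show "y \<in> (\<Union>i\<in>T. {y. y i \<in> sym_diff (D i) (E i)})" by blast
    qed
  qed (use s T in auto)
  also have "\<dots> \<le> (\<Sum>i\<in>T. prob {y. y i \<in> sym_diff (D i) (E i)})"
    by (rule finite_measure_subadditive_finite) (use s T in auto)
  also have "\<dots> = (\<Sum>i\<in>T. measure (distr N borel (\<lambda>y. y i)) (sym_diff (D i) (E i)))"
    by (intro sum.cong refl measure_marginal[OF N(2) b])
  finally show ?thesis .
qed

section \<open>Rational cuts and their projective limit\<close>

text \<open>Coding coordinates by 0/1 answers to "is \<open>y i\<close> at most \<open>q\<close>"
  leaves finitely many patterns on a finite index set, so limits of probabilities there are finitely
  additive and again a law.\<close>

definition rat_cuts :: "(nat \<times> rat) set \<Rightarrow> (nat \<Rightarrow> real) \<Rightarrow> nat \<times> rat \<Rightarrow> real" where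
  "rat_cuts J y = restrict (\<lambda>(i, q). if y i \<le> of_rat q then 1 else 0) J"

text \<open>The clauses say that the rationals with value 1 are those in a half-line
  \<open>{r..}\<close> with real endpoint: upward closed, closed from the right, nonempty, not
  everything. The projective limit lives on arbitrary real values, and all values other than 1 count
  as the answer no.\<close>

definition is_cut :: "(rat \<Rightarrow> real) \<Rightarrow> bool" where
  "is_cut g \<longleftrightarrow> (\<forall>q r. q \<le> r \<and> g q = 1 \<longrightarrow> g r = 1) \<and>
     (\<forall>q. (\<forall>r>q. g r = 1) \<longrightarrow> g q = 1) \<and> (\<exists>q. g q = 1) \<and> (\<exists>q. g q \<noteq> 1)"

text \<open>Decodes a pattern into a real number. The default 0 makes the map total and measurable;
  it is taken only on a null set, by \<open>AE_is_cut\<close>.\<close>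

definition cut_point :: "(rat \<Rightarrow> real) \<Rightarrow> real" where
  "cut_point g = (if is_cut g then Inf {of_rat q |q. g q = 1} else 0)"

lemma cut_point_le_iff:
  assumes g: "is_cut g"
  shows "cut_point g \<le> a \<longleftrightarrow> (\<forall>q. a < of_rat q \<longrightarrow> g q = 1)"
proof -
  let ?S = "{real_of_rat q |q. g q = 1}"
  have ne: "?S \<noteq> {}" using g unfolding is_cut_def by blast
  obtain q0 where q0: "g q0 \<noteq> 1" using g unfolding is_cut_def by blast
  have up: "g r = 1" if "g q = 1" "q \<le> r" for q r using g that unfolding is_cut_def by blast
  have bdd: "bdd_below ?S"
  proof (rule bdd_belowI[of _ "real_of_rat q0"])
    fix x assume "x \<in> ?S"
    then obtain q where "x = real_of_rat q" "g q = 1" by blast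
    then show "real_of_rat q0 \<le> x"
      using up[of q q0] q0 linear[of q q0] by (auto simp: of_rat_less_eq)
  qed
  have "Inf ?S \<le> a \<longleftrightarrow> (\<forall>q. a < of_rat q \<longrightarrow> g q = 1)"
  proof
    assume le: "Inf ?S \<le> a"
    show "\<forall>q. a < of_rat q \<longrightarrow> g q = 1"
    proof (intro allI impI)
      fix q assume "a < real_of_rat q"
      then have "Inf ?S < real_of_rat q" using le by simp
      then obtain r where "g r = 1" "real_of_rat r < real_of_rat q"
        using cInf_less_iff[OF ne bdd] by blast
      then show "g q = 1" using up[of r q] by (simp add: of_rat_less)
    qed
  next
    assume *: "\<forall>q. a < of_rat q \<longrightarrow> g q = 1"
    show "Inf ?S \<le> a"
    proof (rule dense_ge)
      fix b assume "a < b"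
      then obtain q where "a < real_of_rat q" "real_of_rat q < b" using of_rat_dense by blast
      moreover from this have "real_of_rat q \<in> ?S" using * by blast
      ultimately show "Inf ?S \<le> b" using cInf_lower[OF _ bdd, of "real_of_rat q"] by linarith
    qed
  qed
  then show ?thesis using g by (simp add: cut_point_def)
qed

text \<open>Right-closedness transfers the answers at all rationals above \<open>q\<close> to
  \<open>q\<close> itself, and upward closure gives the converse.\<close>

lemma cut_point_le_rat_iff: "is_cut g \<Longrightarrow> cut_point g \<le> of_rat q \<longleftrightarrow> g q = 1"
  by (simp only: cut_point_le_iff of_rat_less, unfold is_cut_def, meson less_imp_le)

lemma is_cut_rat: "is_cut (\<lambda>q. if r \<le> of_rat q then 1 else 0)" for r :: real
proof -
  have "\<exists>q. r \<le> real_of_rat q" "\<exists>q. real_of_rat q < r"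
    using of_rat_dense[of r "r+1"] of_rat_dense[of "r-1" r] by (auto intro: less_imp_le)
  moreover have "r \<le> real_of_rat q" if "\<forall>s>q. r \<le> real_of_rat s" for q
  proof (rule ccontr)
    assume "\<not> ?thesis"
    then obtain s where "real_of_rat q < real_of_rat s" "real_of_rat s < r"
      using of_rat_dense[of "of_rat q" r] by auto
    then show False using that by (auto simp: of_rat_less)
  qed
  moreover have "r \<le> real_of_rat s" if "q \<le> s" "r \<le> real_of_rat q" for q s
    using that of_rat_less_eq[of q s, where 'a=real] by linarith
  moreover have "((if c then 1 else 0) = (1::real)) = c" for c by simp
  ultimately show ?thesis
    unfolding is_cut_def by (simp only:, meson not_le)
qed

lemma cut_point_rat: "cut_point (\<lambda>q. if r \<le> of_rat q then 1 else 0) = r" (is "cut_point ?g = _")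
proof (rule antisym)
  show "cut_point ?g \<le> r" by (simp add: cut_point_le_iff[OF is_cut_rat])
  show "r \<le> cut_point ?g"
  proof (rule ccontr)
    assume "\<not> ?thesis"
    then obtain q where "cut_point ?g < real_of_rat q" "real_of_rat q < r"
      using of_rat_dense[of "cut_point ?g" r] by auto
    then show False using cut_point_le_rat_iff[OF is_cut_rat[of r], of q] by auto
  qed
qed

lemma measurable_is_cut [measurable]: "Measurable.pred (PiM UNIV (\<lambda>_. borel)) is_cut"
  unfolding is_cut_def by measurable

lemma measurable_cut_point [measurable]: "cut_point \<in> PiM UNIV (\<lambda>_. borel) \<rightarrow>\<^sub>M borel"
proof (rule borel_measurable_iff_le[THEN iffD2], rule allI)
  fix a
  have "{g \<in> space (PiM UNIV (\<lambda>_. borel)). cut_point g \<le> a} =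
    {g \<in> space (PiM UNIV (\<lambda>_. borel)). is_cut g \<and> (\<forall>q. a < of_rat q \<longrightarrow> g q = 1) \<or> \<not> is_cut g \<and> 0 \<le> a}"
  proof -
    have "cut_point g \<le> a \<longleftrightarrow>
      is_cut g \<and> (\<forall>q. a < of_rat q \<longrightarrow> g q = 1) \<or> \<not> is_cut g \<and> 0 \<le> a" for g
    proof (cases "is_cut g")
      case True then show ?thesis by (simp only: cut_point_le_iff) simp
    next
      case False then show ?thesis by (simp add: cut_point_def)
    qed
    then show ?thesis by (intro Collect_cong conj_cong refl)
  qed
  also have "\<dots> \<in> sets (PiM UNIV (\<lambda>_. borel))" by measurable
  finally show "{g \<in> space (PiM UNIV (\<lambda>_. borel)). cut_point g \<le> a} \<in> sets (PiM UNIV (\<lambda>_. borel))" .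
qed

lemma rat_cuts_insert:
  "rat_cuts (insert (i, q) J) y = (rat_cuts J y)((i, q) := if y i \<le> of_rat q then 1 else 0)"
  by (auto simp: rat_cuts_def)

lemma rat_cuts_restrict: "J \<subseteq> H \<Longrightarrow> restrict (rat_cuts H y) J = rat_cuts J y"
  by (simp add: rat_cuts_def Int_absorb1)

text \<open>An abstract convergence theorem along any proper filter. Each marginal is eventually
  equal to \<open>\<nu> i\<close>, which prevents mass from escaping and controls approximation of
  half-lines uniformly along the filter.\<close>

locale orthant_limit =
  fixes M :: "'h \<Rightarrow> (nat \<Rightarrow> real) measure" and F :: "'h filter" and \<nu> :: "nat \<Rightarrow> real measure"
  assumes F: "F \<noteq> bot"
    and prob_M: "\<And>h. prob_space (M h)" and sets_M: "\<And>h. sets (M h) = sets Rinf"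
    and conv: "\<And>D. lower_family D \<Longrightarrow> \<exists>l. ((\<lambda>h. measure (M h) (orthant D)) \<longlongrightarrow> l) F"
    and marginal: "\<And>i. \<forall>\<^sub>F h in F. distr (M h) borel (\<lambda>y. y i) = \<nu> i"
    and distribution_\<nu>: "\<And>i. real_distribution (\<nu> i)"
begin

text \<open>Induction on the number of bits, with the orthant \<open>D\<close> left general: answer
  1 to a new bit adds a side to \<open>D\<close>, and answer 0 is a difference of two events without
  that bit. Every event of finitely many bits thus reduces to orthants.\<close>

lemma cuts_convergent:
  assumes "finite J" "lower_family D"
  shows "{y. rat_cuts J y \<in> B} \<in> sets Rinf \<and>
    (\<exists>l. ((\<lambda>h. measure (M h) (orthant D \<inter> {y. rat_cuts J y \<in> B})) \<longlongrightarrow> l) F)"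
  using assms
proof (induction J arbitrary: D B rule: finite_induct)
  case empty
  have "{y. rat_cuts {} y \<in> B} = (if (\<lambda>_. undefined) \<in> B then UNIV else {})"
    by (auto simp: rat_cuts_def restrict_def)
  then show ?case
    using conv[OF empty] sets.top[of Rinf] by (auto intro: exI[of _ 0])
next
  case (insert k J)
  obtain i q where k: "k = (i, q)" by fastforce
  \<comment> \<open>\<open>B\<close> is split according to the value of the new bit;
    \<open>D'\<close> adds the side that this bit tests.\<close>
  define B1 where "B1 = {w. w(k := 1) \<in> B}"
  define B0 where "B0 = {w. w(k := 0) \<in> B}"
  define D' where "D' = (\<lambda>j. D j \<inter> ((\<lambda>_. UNIV)(i := {..real_of_rat q})) j)"
  define C1 where "C1 = {y. rat_cuts J y \<in> B1}"
  define C0 where "C0 = {y. rat_cuts J y \<in> B0}"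
  have D': "lower_family D'" unfolding D'_def
    by (intro lower_family_Int insert.prems lower_family_single) simp
  have D'_eq: "orthant D' = orthant D \<inter> {y. y i \<in> {..real_of_rat q}}"
    unfolding D'_def orthant_Int orthant_single ..
  have eq: "{y. rat_cuts (insert k J) y \<in> B} =
      C1 \<inter> {y. y i \<in> {..real_of_rat q}} \<union> (C0 - {y. y i \<in> {..real_of_rat q}})"
    unfolding k rat_cuts_insert by (auto simp: B1_def B0_def C1_def C0_def k)
  have [measurable]: "C1 \<in> sets Rinf" "C0 \<in> sets Rinf"
    using insert.IH[OF D', of B1] insert.IH[OF D', of B0] by (auto simp: C1_def C0_def)
  have cs[measurable]: "{y. y i \<in> {..real_of_rat q}} \<in> sets Rinf"
    by (rule coordinate_sets) simp
  note [measurable] = orthant_sets[OF D'] orthant_sets[OF insert.prems]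
  obtain l1 where l1: "((\<lambda>h. measure (M h) (orthant D' \<inter> C1)) \<longlongrightarrow> l1) F"
    using insert.IH[OF D', of B1] by (auto simp: C1_def)
  obtain l2 where l2: "((\<lambda>h. measure (M h) (orthant D \<inter> C0)) \<longlongrightarrow> l2) F"
    using insert.IH[OF insert.prems, of B0] by (auto simp: C0_def)
  obtain l3 where l3: "((\<lambda>h. measure (M h) (orthant D' \<inter> C0)) \<longlongrightarrow> l3) F"
    using insert.IH[OF D', of B0] by (auto simp: C0_def)
  have "measure (M h) (orthant D \<inter> {y. rat_cuts (insert k J) y \<in> B}) =
     measure (M h) (orthant D' \<inter> C1) + (measure (M h) (orthant D \<inter> C0) - measure (M h) (orthant D' \<inter> C0))" for h
  proof -
    interpret prob_space "M h" by (rule prob_M)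
    have "orthant D \<inter> {y. rat_cuts (insert k J) y \<in> B} =
       (orthant D' \<inter> C1) \<union> ((orthant D \<inter> C0) - (orthant D' \<inter> C0))"
      unfolding eq D'_eq by auto
    moreover have "prob \<dots> = prob (orthant D' \<inter> C1) + prob ((orthant D \<inter> C0) - (orthant D' \<inter> C0))"
      by (rule finite_measure_Union) (auto simp: sets_M D'_eq)
    moreover have "prob ((orthant D \<inter> C0) - (orthant D' \<inter> C0)) = prob (orthant D \<inter> C0) - prob (orthant D' \<inter> C0)"
      by (rule finite_measure_Diff) (auto simp: sets_M D'_eq)
    ultimately show ?thesis by simp
  qed
  then have "((\<lambda>h. measure (M h) (orthant D \<inter> {y. rat_cuts (insert k J) y \<in> B})) \<longlongrightarrow> l1 + (l2 - l3)) F"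
    using l1 l2 l3 by (simp add: tendsto_intros)
  moreover have "{y. rat_cuts (insert k J) y \<in> B} \<in> sets Rinf"
    unfolding eq by measurable
  ultimately show ?case by blast
qed

text \<open>The set \<open>B\<close> is arbitrary: on a finite \<open>J\<close> only finitely many
  patterns occur, so the event is measurable whatever \<open>B\<close> is.\<close>

definition cut_lim :: "(nat \<times> rat) set \<Rightarrow> (nat \<times> rat \<Rightarrow> real) set \<Rightarrow> real" where
  "cut_lim J B = Lim F (\<lambda>h. measure (M h) {y. rat_cuts J y \<in> B})"

lemma cuts_sets: "finite J \<Longrightarrow> {y. rat_cuts J y \<in> B} \<in> sets Rinf"
  using cuts_convergent[OF _ lower_family_UNIV] by blast

lemma tendsto_cut_lim:
  assumes "finite J"
  shows "((\<lambda>h. measure (M h) {y. rat_cuts J y \<in> B}) \<longlongrightarrow> cut_lim J B) F"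
proof -
  obtain l where l: "((\<lambda>h. measure (M h) {y. rat_cuts J y \<in> B}) \<longlongrightarrow> l) F"
    using cuts_convergent[OF assms lower_family_UNIV, of B] by (auto simp: orthant_UNIV)
  then show ?thesis using tendsto_Lim[OF F l] by (simp add: cut_lim_def)
qed

lemma cut_lim_eqI:
  "finite J \<Longrightarrow> ((\<lambda>h. measure (M h) {y. rat_cuts J y \<in> B}) \<longlongrightarrow> l) F \<Longrightarrow> cut_lim J B = l"
  using tendsto_unique[OF F tendsto_cut_lim] by blast

abbreviation patterns :: "(nat \<times> rat) set \<Rightarrow> (nat \<times> rat \<Rightarrow> real) set" where
  "patterns J \<equiv> PiE J (\<lambda>_. {0, 1})"

definition cut_law :: "(nat \<times> rat) set \<Rightarrow> (nat \<times> rat \<Rightarrow> real) measure" where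
  "cut_law J = distr (point_measure (patterns J) (\<lambda>w. ennreal (cut_lim J {w}))) (PiM J (\<lambda>_. borel)) (\<lambda>w. w)"

text \<open>Since there are finitely many patterns, finite additivity, which survives limits, is all
  that the passage from single patterns to sets requires.\<close>

lemma emeasure_cut_law:
  assumes J: "finite J" and B: "B \<in> sets (PiM J (\<lambda>_. borel))"
  shows "emeasure (cut_law J) B = ennreal (cut_lim J B)"
proof -
  have fin: "finite (patterns J)" using J by (intro finite_PiE) auto
  have pat: "rat_cuts J y \<in> patterns J" for y by (auto simp: rat_cuts_def split: if_splits)
  have "measure (M h) {y. rat_cuts J y \<in> B} = (\<Sum>w\<in>B \<inter> patterns J. measure (M h) {y. rat_cuts J y \<in> {w}})" for h
  proof -
    interpret prob_space "M h" by (rule prob_M)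
    have "{y. rat_cuts J y \<in> B} = (\<Union>w\<in>B \<inter> patterns J. {y. rat_cuts J y \<in> {w}})"
      using pat by auto
    also have "prob \<dots> = (\<Sum>w\<in>B \<inter> patterns J. prob {y. rat_cuts J y \<in> {w}})"
      using fin cuts_sets[OF J, of "{_}"]
      by (intro finite_measure_finite_Union) (auto simp: sets_M disjoint_family_on_def)
    finally show ?thesis .
  qed
  then have "cut_lim J B = (\<Sum>w\<in>B \<inter> patterns J. cut_lim J {w})"
    by (intro cut_lim_eqI J) (simp only:, intro tendsto_sum tendsto_cut_lim J)
  moreover have nonneg: "0 \<le> cut_lim J C" for C
    by (rule tendsto_lowerbound[OF tendsto_cut_lim[OF J] _ F]) simp
  moreover have "(\<lambda>w. w) \<in> point_measure (patterns J) (\<lambda>w. ennreal (cut_lim J {w})) \<rightarrow>\<^sub>M PiM J (\<lambda>_. borel)"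
    by (auto simp: space_PiM)
  then have "emeasure (cut_law J) B = emeasure (point_measure (patterns J) (\<lambda>w. ennreal (cut_lim J {w}))) (B \<inter> patterns J)"
    unfolding cut_law_def using B by (subst emeasure_distr) (auto simp: space_point_measure)
  then have "emeasure (cut_law J) B = (\<Sum>w\<in>B \<inter> patterns J. ennreal (cut_lim J {w}))"
    using fin by (simp add: emeasure_point_measure_finite)
  ultimately show ?thesis by (simp add: sum_ennreal)
qed

lemma sets_cut_law [simp]: "sets (cut_law J) = sets (PiM J (\<lambda>_. borel))"
  by (simp add: cut_law_def)

text \<open>For each \<open>M h\<close> the two events are the same set of sequences, since
  forgetting bits of \<open>H\<close> leaves the bits of \<open>J\<close>; hence the limits
  agree.\<close>

lemma cut_law_restrict:
  assumes JH: "J \<subseteq> H" "finite H"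
  shows "cut_law J = distr (cut_law H) (PiM J (\<lambda>_. borel)) (\<lambda>f. restrict f J)"
proof -
  from JH have J: "finite J" by (auto intro: finite_subset)
  have r: "(\<lambda>f. restrict f J) \<in> cut_law H \<rightarrow>\<^sub>M PiM J (\<lambda>_. borel)"
    using measurable_restrict_subset[OF JH(1)] by (simp cong: measurable_cong_sets)
  show "cut_law J = distr (cut_law H) (PiM J (\<lambda>_. borel)) (\<lambda>f. restrict f J)"
  proof (rule measure_eqI)
    fix B assume "B \<in> sets (cut_law J)"
    then have B: "B \<in> sets (PiM J (\<lambda>_. borel))" by simp
    define B' where "B' = (\<lambda>f. restrict f J) -` B \<inter> space (PiM H (\<lambda>_. borel :: real measure))"
    have B': "B' \<in> sets (PiM H (\<lambda>_. borel))"
      unfolding B'_def using measurable_restrict_subset[OF JH(1)] B by (rule measurable_sets)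
    have "rat_cuts H y \<in> B' \<longleftrightarrow> rat_cuts J y \<in> B" for y
      using rat_cuts_restrict[OF JH(1), of y] by (auto simp: B'_def space_PiM rat_cuts_def)
    then have "cut_lim H B' = cut_lim J B"
      by (simp add: cut_lim_def)
    moreover have "emeasure (distr (cut_law H) (PiM J (\<lambda>_. borel)) (\<lambda>f. restrict f J)) B = emeasure (cut_law H) B'"
      unfolding emeasure_distr[OF r B] B'_def using sets_eq_imp_space_eq[OF sets_cut_law, of H] by simp
    ultimately show "emeasure (cut_law J) B = emeasure (distr (cut_law H) (PiM J (\<lambda>_. borel)) (\<lambda>f. restrict f J)) B"
      by (simp add: emeasure_cut_law[OF J B] emeasure_cut_law[OF JH(2) B'])
  qed simp
qed

lemma prob_cut_law:
  assumes J: "finite J" shows "prob_space (cut_law J)"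
proof -
  have "{y. rat_cuts J y \<in> space (PiM J (\<lambda>_. borel :: real measure))} = UNIV"
    by (auto simp: space_PiM rat_cuts_def)
  moreover have "measure (M h) UNIV = 1" for h
    using prob_space.prob_space[OF prob_M] sets_eq_imp_space_eq[OF sets_M] by simp
  ultimately have "cut_lim J (space (PiM J (\<lambda>_. borel))) = 1"
    by (intro cut_lim_eqI J) simp
  then show "prob_space (cut_law J)"
    using emeasure_cut_law[OF J sets.top] sets_eq_imp_space_eq[OF sets_cut_law, of J]
    by (intro prob_spaceI) simp
qed

text \<open>Kolmogorov's extension theorem supplies one law for the bits of all coordinates and all
  rationals jointly.\<close>

sublocale polish_projective UNIV cut_law
proof -
  have "projective_family UNIV cut_law (\<lambda>_. borel)"
    by (rule projective_family.intro) (rule cut_law_restrict prob_cut_law; assumption)+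
  then show "polish_projective UNIV cut_law" by (rule polish_projective.intro)
qed

abbreviation "\<Omega> \<equiv> lim"

lemma tendsto_cuts:
  assumes J: "finite J" and B: "B \<in> sets (PiM J (\<lambda>_. borel))"
  shows "((\<lambda>h. measure (M h) {y. rat_cuts J y \<in> B}) \<longlongrightarrow> measure \<Omega> {\<omega>. restrict \<omega> J \<in> B}) F"
proof -
  have "measure \<Omega> {\<omega>. restrict \<omega> J \<in> B} = measure (cut_law J) B"
    using measure_lim_emb[OF subset_UNIV J B] by (simp add: prod_emb_def vimage_def space_PiM)
  also have "\<dots> = cut_lim J B"
    using emeasure_cut_law[OF J B] cut_lim_eqI[OF J]
      tendsto_lowerbound[OF tendsto_cut_lim[OF J, of B] _ F, of 0] by (simp add: measure_def)
  finally show ?thesis using tendsto_cut_lim[OF J, of B] by simp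
qed

lemma measurable_cuts: "(\<lambda>\<omega> q. \<omega> (i, q)) \<in> \<Omega> \<rightarrow>\<^sub>M PiM UNIV (\<lambda>_. borel)"
  by (rule measurable_PiM_single') (auto cong: measurable_cong_sets)

lemma measurable_half_lines: "(\<lambda>r q. if r \<le> of_rat q then 1 else 0) \<in> \<nu> i \<rightarrow>\<^sub>M PiM UNIV (\<lambda>_. borel)"
proof -
  interpret \<nu>: real_distribution "\<nu> i" by (rule distribution_\<nu>)
  show ?thesis by (rule measurable_PiM_single') auto
qed

text \<open>Finitely many bits of a single coordinate eventually have the law they have under
  \<open>\<nu> i\<close>, so the limit has it too; finite sets of bits determine the law of the
  whole pattern.\<close>

lemma law_of_cuts: "distr \<Omega> (PiM UNIV (\<lambda>_. borel)) (\<lambda>\<omega> q. \<omega> (i, q)) =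
   distr (\<nu> i) (PiM UNIV (\<lambda>_. borel)) (\<lambda>r q. if r \<le> of_rat q then 1 else 0)" (is "?L = ?R")
proof (rule measure_eqI_PiM_infinite)
  interpret \<nu>: real_distribution "\<nu> i" by (rule distribution_\<nu>)
  note m1 = measurable_cuts and m2 = measurable_half_lines
  show "finite_measure ?L" using P.prob_space_distr[OF m1] by (simp add: prob_space.finite_measure)
  fix A :: "rat \<Rightarrow> real set" and J assume J: "finite J" and A: "\<And>q. q \<in> J \<Longrightarrow> A q \<in> sets borel"
  let ?X = "prod_emb UNIV (\<lambda>_. borel) J (Pi\<^sub>E J A)"
  have X: "?X \<in> sets (PiM UNIV (\<lambda>_. borel))" using J A by (intro sets_PiM_I) auto
  define J' where "J' = Pair i ` J"
  define B where "B = PiE J' (\<lambda>k. A (snd k))"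
  have J': "finite J'" using J by (simp add: J'_def)
  have B: "B \<in> sets (PiM J' (\<lambda>_. borel))"
    unfolding B_def using J' A by (intro sets_PiM_I_finite) (auto simp: J'_def)
  define E where "E = {r. \<forall>q\<in>J. (if r \<le> real_of_rat q then 1 else 0) \<in> A q}"
  have E: "E \<in> sets borel"
  proof -
    have "{r\<in>space borel. \<forall>q\<in>J. (if r \<le> real_of_rat q then 1 else 0) \<in> A q} \<in> sets borel"
      using J A by measurable
    then show ?thesis by (simp add: E_def)
  qed
  have cuts: "{y. rat_cuts J' y \<in> B} = {y. y i \<in> E}"
    by (auto simp: rat_cuts_def B_def J'_def E_def PiE_iff)
  have "\<forall>\<^sub>F h in F. measure (M h) {y. rat_cuts J' y \<in> B} = measure (\<nu> i) E"
    using marginal[of i] by eventually_elim (simp only: cuts measure_marginal[OF sets_M E])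
  then have "((\<lambda>h. measure (M h) {y. rat_cuts J' y \<in> B}) \<longlongrightarrow> measure (\<nu> i) E) F"
    by (rule tendsto_eventually)
  then have "measure \<Omega> {\<omega>. restrict \<omega> J' \<in> B} = measure (\<nu> i) E"
    by (rule tendsto_unique[OF F tendsto_cuts[OF J' B]])
  moreover have "{\<omega>. restrict \<omega> J' \<in> B} = (\<lambda>\<omega> q. \<omega> (i, q)) -` ?X \<inter> space \<Omega>"
    by (auto simp: B_def J'_def prod_emb_def PiE_iff space_PiM)
  moreover have "E = (\<lambda>r q. if r \<le> of_rat q then 1 else 0) -` ?X \<inter> space (\<nu> i)"
    by (simp add: E_def prod_emb_def restrict_PiE_iff space_PiM vimage_def Pi_iff)
  ultimately show "emeasure ?L ?X = emeasure ?R ?X"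
    unfolding emeasure_distr[OF m1 X] emeasure_distr[OF m2 X]
    by (simp add: P.emeasure_eq_measure \<nu>.emeasure_eq_measure)
qed auto

definition limit_law :: "(nat \<Rightarrow> real) measure" where
  "limit_law = distr \<Omega> Rinf (\<lambda>\<omega> i. cut_point (\<lambda>q. \<omega> (i, q)))"

lemma measurable_limit_map: "(\<lambda>\<omega> i. cut_point (\<lambda>q. \<omega> (i, q))) \<in> \<Omega> \<rightarrow>\<^sub>M Rinf"
  by (rule measurable_PiM_single')
     (auto intro: measurable_compose[OF measurable_cuts measurable_cut_point])

lemma prob_limit_law: "prob_space limit_law"
  unfolding limit_law_def by (rule P.prob_space_distr[OF measurable_limit_map])

lemma sets_limit_law: "sets limit_law = sets Rinf"
  by (simp add: limit_law_def)

lemma limit_law_marginal: "distr limit_law borel (\<lambda>y. y i) = \<nu> i"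
proof -
  interpret \<nu>: real_distribution "\<nu> i" by (rule distribution_\<nu>)
  have "distr limit_law borel (\<lambda>y. y i) = distr \<Omega> borel (\<lambda>\<omega>. cut_point (\<lambda>q. \<omega> (i, q)))"
    unfolding limit_law_def by (subst distr_distr[OF _ measurable_limit_map]) (auto simp: comp_def)
  also have "\<dots> = distr (distr \<Omega> (PiM UNIV (\<lambda>_. borel)) (\<lambda>\<omega> q. \<omega> (i, q))) borel cut_point"
    by (subst distr_distr[OF measurable_cut_point measurable_cuts]) (simp add: comp_def)
  also have "\<dots> = distr (\<nu> i) borel (\<lambda>r. r)"
    unfolding law_of_cuts
    by (subst distr_distr[OF measurable_cut_point measurable_half_lines]) (simp add: comp_def cut_point_rat)
  also have "\<dots> = \<nu> i"
    by (rule distr_id2) simp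
  finally show ?thesis .
qed

text \<open>Being a cut is not preserved by limits as such: escaping mass gives constant patterns,
  and points converging from above destroy right-closedness. It is a property of the pattern of one
  coordinate, however, so it carries over from \<open>\<nu> i\<close> by
  \<open>law_of_cuts\<close>.\<close>

lemma AE_is_cut: "AE \<omega> in \<Omega>. \<forall>i. is_cut (\<lambda>q. \<omega> (i, q))"
  unfolding AE_all_countable
proof
  fix i
  have [measurable]: "{g \<in> space (PiM UNIV (\<lambda>_. borel)). is_cut g} \<in> sets (PiM UNIV (\<lambda>_. borel))"
    using measurable_is_cut by (simp add: pred_def)
  have "AE g in distr (\<nu> i) (PiM UNIV (\<lambda>_. borel)) (\<lambda>r q. if r \<le> of_rat q then 1 else 0). is_cut g"
    by (subst AE_distr_iff[OF measurable_half_lines]) (auto simp: is_cut_rat)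
  then show "AE \<omega> in \<Omega>. is_cut (\<lambda>q. \<omega> (i, q))"
    unfolding law_of_cuts[symmetric] by (subst (asm) AE_distr_iff[OF measurable_cuts]) auto
qed

text \<open>A closed rational orthant is, up to a null set, the event that finitely many bits equal
  1, so convergence on finite bit sets applies without approximation.\<close>

lemma limit_law_rat:
  fixes q :: "nat \<Rightarrow> rat"
  assumes T: "finite T"
  defines "D \<equiv> \<lambda>i. if i \<in> T then {..real_of_rat (q i)} else UNIV"
  shows "((\<lambda>h. measure (M h) (orthant D)) \<longlongrightarrow> measure limit_law (orthant D)) F"
proof -
  have D: "lower_family D"
    using T by (auto simp: D_def lower_family_def)
  define J where "J = (\<lambda>i. (i, q i)) ` T"
  define B where "B = PiE J (\<lambda>_. {1::real})"
  have J: "finite J" using T by (simp add: J_def)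
  have B: "B \<in> sets (PiM J (\<lambda>_. borel))" unfolding B_def using J by (intro sets_PiM_I_finite) auto
  have "measure limit_law (orthant D) = measure \<Omega> ((\<lambda>\<omega> i. cut_point (\<lambda>q. \<omega> (i, q))) -` orthant D \<inter> space \<Omega>)"
    unfolding limit_law_def by (rule measure_distr[OF measurable_limit_map orthant_sets[OF D]])
  also have "\<dots> = measure \<Omega> {\<omega>. restrict \<omega> J \<in> B}"
  proof (rule P.finite_measure_eq_AE)
    show "AE \<omega> in \<Omega>. (\<omega> \<in> (\<lambda>\<omega> i. cut_point (\<lambda>q. \<omega> (i, q))) -` orthant D \<inter> space \<Omega>) = (\<omega> \<in> {\<omega>. restrict \<omega> J \<in> B})"
      using AE_is_cut
    proof eventually_elim
      case (elim \<omega>)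
      have "cut_point (\<lambda>q. \<omega> (i, q)) \<in> D i \<longleftrightarrow> (i \<in> T \<longrightarrow> \<omega> (i, q i) = 1)" for i
        using cut_point_le_rat_iff[of "\<lambda>q. \<omega> (i, q)" "q i"] elim by (simp add: D_def)
      then show ?case
        by (auto simp: orthant_def space_PiM B_def J_def restrict_def fun_eq_iff)
    qed
    show "(\<lambda>\<omega> i. cut_point (\<lambda>q. \<omega> (i, q))) -` orthant D \<inter> space \<Omega> \<in> sets \<Omega>"
      by (rule measurable_sets[OF measurable_limit_map orthant_sets[OF D]])
    have "(\<lambda>\<omega>. restrict \<omega> J) \<in> \<Omega> \<rightarrow>\<^sub>M PiM J (\<lambda>_. borel)"
      using measurable_restrict_subset[of J UNIV "\<lambda>_. borel"] by (simp cong: measurable_cong_sets)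
    from measurable_sets[OF this B] show "{\<omega>. restrict \<omega> J \<in> B} \<in> sets \<Omega>"
      by (simp add: vimage_def space_PiM)
  qed
  also have "((\<lambda>h. measure (M h) {y. rat_cuts J y \<in> B}) \<longlongrightarrow> \<dots>) F"
    by (rule tendsto_cuts[OF J B])
  also have "(\<lambda>h. measure (M h) {y. rat_cuts J y \<in> B}) = (\<lambda>h. measure (M h) (orthant D))"
  proof -
    have "rat_cuts J y \<in> B \<longleftrightarrow> y \<in> orthant D" for y
    proof -
      have "rat_cuts J y \<in> B \<longleftrightarrow> (\<forall>i\<in>T. (if y i \<le> real_of_rat (q i) then 1 else 0) = (1::real))"
        unfolding rat_cuts_def B_def J_def restrict_PiE_iff by simp
      also have "\<dots> \<longleftrightarrow> (\<forall>i\<in>T. y i \<le> real_of_rat (q i))" by (auto split: if_splits)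
      finally show ?thesis by (auto simp: orthant_def D_def)
    qed
    then show ?thesis by simp
  qed
  finally show ?thesis .
qed

text \<open>General sides are replaced by closed rational ones. The error depends on the marginals
  only, so it is the same for the limit law and, eventually, for all \<open>M h\<close>.\<close>

theorem limit_law_orthant:
  assumes D: "lower_family D"
  shows "((\<lambda>h. measure (M h) (orthant D)) \<longlongrightarrow> measure limit_law (orthant D)) F"
proof (rule tendstoI)
  fix e :: real assume e: "0 < e"
  define T where "T = {i. D i \<noteq> UNIV}"
  have T: "finite T" using D by (simp add: T_def lower_family_def)
  \<comment> \<open>The errors of the \<open>card T\<close> sides add up to at most
    \<open>e / 4\<close>; \<open>Suc\<close> keeps the quotient meaningful when \<open>T\<close> is
    empty.\<close>
  define d where "d = e / 4 / real (Suc (card T))"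
  have d: "0 < d" using e by (simp add: d_def)
  have "\<forall>i\<in>T. \<exists>q. measure (\<nu> i) (sym_diff (D i) {..of_rat q}) < d"
    using D d by (auto simp: T_def lower_family_def intro!: down_set_approx distribution_\<nu>)
  then obtain q where q: "\<And>i. i \<in> T \<Longrightarrow> measure (\<nu> i) (sym_diff (D i) {..of_rat (q i)}) < d"
    by metis
  define E where "E = (\<lambda>i. if i \<in> T then {..real_of_rat (q i)} else UNIV)"
  have E: "lower_family E" using T by (auto simp: E_def lower_family_def)
  have close: "\<bar>measure N (orthant D) - measure N (orthant E)\<bar> \<le> e / 4"
    if "prob_space N" "sets N = sets Rinf" "\<forall>i\<in>T. distr N borel (\<lambda>y. y i) = \<nu> i" for N
  proof -
    have "\<bar>measure N (orthant D) - measure N (orthant E)\<bar>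
       \<le> (\<Sum>i\<in>T. measure (distr N borel (\<lambda>y. y i)) (sym_diff (D i) (E i)))"
      by (rule orthant_measure_diff[OF that(1,2) D E T]) (auto simp: T_def E_def)
    also have "\<dots> \<le> (\<Sum>i\<in>T. d)"
      using that(3) q by (intro sum_mono) (auto simp: E_def intro: less_imp_le)
    also have "\<dots> \<le> e / 4" using e by (simp add: d_def field_simps)
    finally show ?thesis .
  qed
  have 1: "\<bar>measure limit_law (orthant D) - measure limit_law (orthant E)\<bar> \<le> e / 4"
    by (rule close) (auto simp: prob_limit_law sets_limit_law limit_law_marginal)
  have "\<forall>\<^sub>F h in F. dist (measure (M h) (orthant E)) (measure limit_law (orthant E)) < e / 4"
    using limit_law_rat[OF T, of q] e unfolding E_def by (intro tendstoD) auto
  moreover have "\<forall>\<^sub>F h in F. \<forall>i\<in>T. distr (M h) borel (\<lambda>y. y i) = \<nu> i"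
    using marginal T by (intro eventually_ball_finite) auto
  ultimately show "\<forall>\<^sub>F h in F. dist (measure (M h) (orthant D)) (measure limit_law (orthant D)) < e"
  proof eventually_elim
    case (elim h)
    then show ?case
      using 1 close[OF prob_M sets_M, of h] e unfolding dist_real_def by linarith
  qed
qed

end

subsection \<open>The flow as a limit over partitions\<close>

text \<open>Deterministic marginals leave no freedom in the coupling, as countably many coordinates
  are then almost surely constant together. This settles time 0.\<close>

lemma motion_return_unique:
  assumes K: "motion (return borel) K"
  shows "K x = return Rinf x"
proof -
  interpret prob_space "K x" by (rule motion_prob[OF K])
  note s = motion_sets[OF K, of x]
  have m: "(\<lambda>y. y i) \<in> K x \<rightarrow>\<^sub>M borel" for i
    by (simp add: measurable_cong_sets[OF s refl])
  have "AE y in K x. y i = x i" for i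
  proof -
    have "AE r in distr (K x) borel (\<lambda>y. y i). r = x i"
      unfolding motion_marginal[OF K] by (simp add: AE_return)
    then show ?thesis by (subst (asm) AE_distr_iff[OF m]) auto
  qed
  then have "AE y in K x. \<forall>i. y i = x i" by (simp add: AE_all_countable)
  then have "AE y in K x. y = x" by (simp add: fun_eq_iff)
  then have "K x = return (K x) x" by (rule AE_eq_constD)
  then show ?thesis using return_cong[OF s] by simp
qed

lemma orthant_le_refl: "orthant_le M M"
  and orthant_le_trans: "orthant_le M N \<Longrightarrow> orthant_le N L \<Longrightarrow> orthant_le M L"
  by (auto simp: orthant_le_def intro: order_trans)

lemma orthant_le_bind_right:
  assumes M: "prob_space M" "sets M = sets Rinf"
    and K: "K \<in> Rinf \<rightarrow>\<^sub>M prob_algebra Rinf" and L: "L \<in> Rinf \<rightarrow>\<^sub>M prob_algebra Rinf"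
    and le: "\<And>y. orthant_le (K y) (L y)"
  shows "orthant_le (M \<bind> K) (M \<bind> L)"
  unfolding orthant_le_def
proof (intro allI impI)
  fix D assume D: "lower_family D"
  have int: "integrable M (\<lambda>y. measure (N y) (orthant D))" if N: "N \<in> Rinf \<rightarrow>\<^sub>M prob_algebra Rinf" for N
  proof (rule integrable_bounded[OF M])
    show "(\<lambda>y. measure (N y) (orthant D)) \<in> borel_measurable Rinf"
      using measurable_compose[OF N measurable_measure_prob_algebra[OF orthant_sets[OF D]]] .
    show "\<exists>B. \<forall>y. \<bar>measure (N y) (orthant D)\<bar> \<le> B"
      using prob_space.prob_le_1[OF kernel_prob[OF N]] by (intro exI[of _ 1]) simp
  qed
  show "measure (M \<bind> K) (orthant D) \<le> measure (M \<bind> L) (orthant D)"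
    unfolding measure_bind_kernel[OF M K orthant_sets[OF D]] measure_bind_kernel[OF M L orthant_sets[OF D]]
    using le D by (intro integral_mono int K L) (auto simp: orthant_le_def)
qed

text \<open>Changing the first factor changes the integrating law, so the integrand itself must
  belong to the cone; changing the second factor is plain monotonicity of the integral.\<close>

lemma orthant_le_bind_left:
  assumes M: "prob_space M" "sets M = sets Rinf" and N: "prob_space N" "sets N = sets Rinf"
    and K: "K \<in> Rinf \<rightarrow>\<^sub>M prob_algebra Rinf"
    and cone: "\<And>D. lower_family D \<Longrightarrow> mixture_cone (\<lambda>y. measure (K y) (orthant D))"
    and le: "orthant_le M N"
  shows "orthant_le (M \<bind> K) (N \<bind> K)"
  unfolding orthant_le_def
proof (intro allI impI)
  fix D assume D: "lower_family D"
  show "measure (M \<bind> K) (orthant D) \<le> measure (N \<bind> K) (orthant D)"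
    unfolding measure_bind_kernel[OF M K orthant_sets[OF D]] measure_bind_kernel[OF N K orthant_sets[OF D]]
    by (rule mixture_cone_integral_mono[OF M N le cone[OF D]])
qed

text \<open>Side \<open>i\<close> of the new orthant is the intersection of the sides over the fibre
  of \<open>i\<close>. An empty fibre gives the whole line, and proper sides occur only at images of
  proper sides.\<close>

lemma orthant_relabel:
  assumes "lower_family D"
  shows "\<exists>E. lower_family E \<and> {y. y \<circ> \<sigma> \<in> orthant D} = orthant E"
proof -
  define E where "E i = {r. \<forall>j. \<sigma> j = i \<longrightarrow> r \<in> D j}" for i
  have "{i. E i \<noteq> UNIV} \<subseteq> \<sigma> ` {j. D j \<noteq> UNIV}" by (auto simp: E_def)
  moreover have "finite (\<sigma> ` {j. D j \<noteq> UNIV})" using assms by (simp add: lower_family_def)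
  ultimately have "finite {i. E i \<noteq> UNIV}" by (rule finite_subset)
  moreover have "is_down (E i)" for i
    using assms by (auto simp: lower_family_def E_def is_down_def)
  ultimately show ?thesis
    unfolding lower_family_def by (intro exI[of _ E]) (simp add: E_def orthant_def)
qed

lemma measure_relabel:
  assumes "sets M = sets Rinf" "A \<in> sets Rinf"
  shows "measure (distr M Rinf (\<lambda>y. y \<circ> \<sigma>)) A = measure M {y. y \<circ> \<sigma> \<in> A}"
proof -
  have "(\<lambda>y. y \<circ> \<sigma>) \<in> M \<rightarrow>\<^sub>M Rinf" by (simp add: measurable_cong_sets[OF assms(1) refl])
  then show ?thesis
    using assms(2) sets_eq_imp_space_eq[OF assms(1)] by (simp add: measure_distr vimage_def)
qed

text \<open>Run the motion from the interleaved starting point: the two copies of coordinate \<open>i\<close> stay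
  ordered, so the probability that exactly one of them lies in \<open>D i\<close> is a difference of
  one-point probabilities.\<close>
lemma motion_lipschitz:
  assumes K: "motion p K" and D: "lower_family D" and T: "finite T" "\<And>i. i \<notin> T \<Longrightarrow> D i = UNIV"
  shows "measure (K x) (orthant D) \<le> measure (K y) (orthant D) +
    (\<Sum>i\<in>T. \<bar>measure (p (x i)) (D i) - measure (p (y i)) (D i)\<bar>)"
proof -
  define v where "v k = (if even k then x (k div 2) else y (k div 2))" for k
  define \<sigma> \<tau> :: "nat \<Rightarrow> nat" where "\<sigma> i = 2 * i" and "\<tau> i = 2 * i + 1" for i
  have v: "v \<circ> \<sigma> = x" "v \<circ> \<tau> = y" by (auto simp: v_def \<sigma>_def \<tau>_def)
  have v': "v (\<sigma> i) = x i" "v (\<tau> i) = y i" for i by (auto simp: v_def \<sigma>_def \<tau>_def)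
  interpret prob_space "K v" by (rule motion_prob[OF K])
  define A where "A i = {w::nat\<Rightarrow>real. w (\<sigma> i) \<in> D i}" for i
  define B where "B i = {w::nat\<Rightarrow>real. w (\<tau> i) \<in> D i}" for i
  have Dm: "D i \<in> sets borel" for i using D by (simp add: is_down_borel lower_family_down)
  have [measurable]: "A i \<in> sets (K v)" "B i \<in> sets (K v)" for i
    unfolding A_def B_def motion_sets[OF K] by (rule coordinate_sets[OF Dm])+
  have pA: "prob (A i) = measure (p (x i)) (D i)" and pB: "prob (B i) = measure (p (y i)) (D i)" for i
    unfolding A_def B_def motion_measure_single[OF K Dm] v' by auto
  have Kx: "measure (K x) (orthant D) = prob {w. w \<circ> \<sigma> \<in> orthant D}"
    using measure_relabel[OF motion_sets[OF K, of v] orthant_sets[OF D], of \<sigma>] motion_relabel[OF K, of v \<sigma>] v by simp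
  have Ky: "measure (K y) (orthant D) = prob {w. w \<circ> \<tau> \<in> orthant D}"
    using measure_relabel[OF motion_sets[OF K, of v] orthant_sets[OF D], of \<tau>] motion_relabel[OF K, of v \<tau>] v by simp
  have s: "{w. w \<circ> \<rho> \<in> orthant D} \<in> sets (K v)" for \<rho>
    using orthant_relabel[OF D, of \<rho>] orthant_sets motion_sets[OF K] by auto
  have each: "prob (A i - B i) \<le> \<bar>prob (A i) - prob (B i)\<bar>" for i
  proof (cases "x i \<le> y i")
    case True
    have "AE w in K v. w (\<sigma> i) \<le> w (\<tau> i)" using True by (intro motion_order[OF K]) (simp add: v')
    then have "AE w in K v. w \<in> A i \<inter> B i \<longleftrightarrow> w \<in> B i"
      using lower_family_down[OF D, of i] by (auto simp: A_def B_def is_down_def elim!: eventually_mono)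
    then have "prob (A i \<inter> B i) = prob (B i)" by (intro finite_measure_eq_AE) auto
    moreover have "prob (A i - B i) = prob (A i) - prob (A i \<inter> B i)"
      using finite_measure_Diff[of "A i" "A i \<inter> B i"] by (simp add: Diff_Int_distrib2 Diff_Int)
    ultimately show ?thesis by simp
  next
    case False
    have "AE w in K v. w (\<tau> i) \<le> w (\<sigma> i)" using False by (intro motion_order[OF K]) (simp add: v')
    then have "AE w in K v. w \<in> A i - B i \<longleftrightarrow> w \<in> {}"
      using lower_family_down[OF D, of i] by (auto simp: A_def B_def is_down_def elim!: eventually_mono)
    then have "prob (A i - B i) = prob {}" by (intro finite_measure_eq_AE) auto
    then show ?thesis by simp
  qed
  have "prob {w. w \<circ> \<sigma> \<in> orthant D} \<le> prob ({w. w \<circ> \<tau> \<in> orthant D} \<union> (\<Union>i\<in>T. A i - B i))"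
  proof (rule finite_measure_mono)
    show "{w. w \<circ> \<sigma> \<in> orthant D} \<subseteq> {w. w \<circ> \<tau> \<in> orthant D} \<union> (\<Union>i\<in>T. A i - B i)"
      using T(2) by (fastforce simp: orthant_def A_def B_def)
  qed (use s T(1) in auto)
  also have "\<dots> \<le> prob {w. w \<circ> \<tau> \<in> orthant D} + prob (\<Union>i\<in>T. A i - B i)"
    using s T(1) by (intro measure_Un_le) auto
  also have "prob (\<Union>i\<in>T. A i - B i) \<le> (\<Sum>i\<in>T. prob (A i - B i))"
    using T(1) by (intro finite_measure_subadditive_finite) auto
  also have "\<dots> \<le> (\<Sum>i\<in>T. \<bar>prob (A i) - prob (B i)\<bar>)" by (intro sum_mono each)
  finally show ?thesis unfolding Kx Ky pA pB by (simp only: add_left_mono)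
qed

section \<open>Compositions along partitions\<close>

locale mono_semigroup =
  fixes P :: "real \<Rightarrow> real \<Rightarrow> real measure"
  assumes mono_kernel: "mono_kernel (P t)"
    and zero: "P 0 = return borel"
    and add: "0 \<le> s \<Longrightarrow> 0 \<le> t \<Longrightarrow> P (s + t) = (\<lambda>r. P s r \<bind> P t)"
begin

lemmas P_kernel [measurable] = mono_kernel.kernel[OF mono_kernel]

fun steps :: "real list \<Rightarrow> (nat \<Rightarrow> real) \<Rightarrow> (nat \<Rightarrow> real) measure" where
  "steps [] = return Rinf"
| "steps (h # hs) = (\<lambda>x. comon (P h) x \<bind> steps hs)"

text \<open>Partitions are lists of step lengths, so concatenation and subdivision are list
  operations. Zero lengths are allowed, which lets subdivision leave an empty remainder; the empty
  list partitions only an interval of length 0.\<close>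

definition partitions :: "real \<Rightarrow> real list set" where
  "partitions t = {hs. (\<forall>h\<in>set hs. 0 \<le> h) \<and> sum_list hs = t}"

lemma motion_comon': "motion (P h) (comon (P h))"
  by (rule mono_kernel.motion_comon[OF mono_kernel])

lemma steps_kernel [measurable]: "steps hs \<in> Rinf \<rightarrow>\<^sub>M prob_algebra Rinf"
proof (induction hs)
  case (Cons h hs)
  then show ?case using motion_kernel[OF motion_comon'[of h]] by (simp add: measurable_bind_prob_space)
qed simp

lemma steps_prob: "prob_space (steps hs x)" and steps_sets: "sets (steps hs x) = sets Rinf"
  using kernel_prob[OF steps_kernel] kernel_sets[OF steps_kernel] by auto

lemma partitions_nonneg: "hs \<in> partitions t \<Longrightarrow> 0 \<le> t"
  by (auto simp: partitions_def intro: sum_list_nonneg)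

lemma partitions_Cons: "h # hs \<in> partitions t \<longleftrightarrow> 0 \<le> h \<and> hs \<in> partitions (t - h)"
  by (auto simp: partitions_def)

lemma partitions_append: "hs \<in> partitions s \<Longrightarrow> ks \<in> partitions t \<Longrightarrow> hs @ ks \<in> partitions (s + t)"
  by (auto simp: partitions_def)

lemma motion_steps: "hs \<in> partitions t \<Longrightarrow> motion (P t) (steps hs)"
proof (induction hs arbitrary: t)
  case Nil
  then show ?case using motion_return by (simp add: partitions_def zero)
next
  case (Cons h hs)
  then have h: "0 \<le> h" and hs: "hs \<in> partitions (t - h)" by (auto simp: partitions_Cons)
  have "motion (\<lambda>r. P h r \<bind> P (t - h)) (\<lambda>x. comon (P h) x \<bind> steps hs)"
    by (rule motion_bind[OF motion_comon' Cons.IH[OF hs] P_kernel])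
  then show ?case using add[OF h partitions_nonneg[OF hs]] by simp
qed

lemma steps_append: "steps (hs @ ks) x = steps hs x \<bind> steps ks"
proof (induction hs arbitrary: x)
  case Nil
  show ?case using bind_return[OF measurable_prob_algebraD[OF steps_kernel], of x] by simp
next
  case (Cons h hs)
  have "steps hs \<in> comon (P h) x \<rightarrow>\<^sub>M subprob_algebra Rinf"
    using measurable_prob_algebraD[OF steps_kernel]
    by (simp add: measurable_cong_sets[OF motion_sets[OF motion_comon'] refl])
  from bind_assoc[OF this measurable_prob_algebraD[OF steps_kernel[of ks]]]
  have "(comon (P h) x \<bind> steps hs) \<bind> steps ks = comon (P h) x \<bind> (\<lambda>x. steps hs x \<bind> steps ks)" .
  moreover have "steps (hs @ ks) = (\<lambda>x. steps hs x \<bind> steps ks)" by (rule ext) (rule Cons.IH)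
  ultimately show ?case by simp
qed

lemma mixture_cone_steps: "lower_family D \<Longrightarrow> mixture_cone (\<lambda>x. measure (steps hs x) (orthant D))"
proof (induction hs)
  case Nil
  have "(\<lambda>x. measure (steps [] x) (orthant D)) = indicator (orthant D)"
    using orthant_sets[OF Nil] by (auto simp: measure_return)
  then show ?case using mixture_cone.orthant[OF Nil] by simp
next
  case (Cons h hs)
  have "(\<lambda>x. measure (steps (h # hs) x) (orthant D)) = (\<lambda>x. \<integral>y. measure (steps hs y) (orthant D) \<partial>comon (P h) x)"
    using measure_bind_kernel[OF motion_prob[OF motion_comon'] motion_sets[OF motion_comon'] steps_kernel orthant_sets[OF Cons.prems]]
    by simp
  moreover have "mixture_cone \<dots>"
    by (rule mixture_cone_kernel[OF motion_kernel[OF motion_comon'] mono_kernel.mixture_cone_comon[OF mono_kernel] Cons.IH[OF Cons.prems]])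
  ultimately show ?case by simp
qed

text \<open>Refinement is recorded by its effect on orthant probabilities instead of by inclusion of
  division points. It is a preorder, and its directedness is what \<open>common_refinement\<close>
  establishes.\<close>

definition finer :: "real list \<Rightarrow> real list \<Rightarrow> bool" where
  "finer ks hs \<longleftrightarrow> (\<forall>x. orthant_le (steps ks x) (steps hs x))"

lemma finer_refl: "finer hs hs"
  and finer_trans: "finer ks hs \<Longrightarrow> finer hs ls \<Longrightarrow> finer ks ls"
  by (auto simp: finer_def intro: orthant_le_refl orthant_le_trans)

lemma finer_Cons: "finer ks hs \<Longrightarrow> finer (h # ks) (h # hs)"
  unfolding finer_def
  by (auto intro!: orthant_le_bind_right motion_prob[OF motion_comon'] motion_sets[OF motion_comon'] steps_kernel)

text \<open>The two steps together are a motion for \<open>P (h + k)\<close> and therefore lie below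
  the single comonotone step. The remaining steps preserve this inequality because their orthant
  probabilities lie in the cone.\<close>

lemma finer_split:
  assumes "0 \<le> h" "0 \<le> k"
  shows "finer (h # k # hs) ((h + k) # hs)"
  unfolding finer_def
proof
  fix x
  have m: "motion (P (h + k)) (\<lambda>x. comon (P h) x \<bind> comon (P k))"
    unfolding add[OF assms] by (rule motion_bind[OF motion_comon' motion_comon' P_kernel])
  have "comon (P k) \<in> comon (P h) x \<rightarrow>\<^sub>M subprob_algebra Rinf"
    using measurable_prob_algebraD[OF motion_kernel[OF motion_comon']]
    by (simp add: measurable_cong_sets[OF motion_sets[OF motion_comon'] refl])
  from bind_assoc[OF this measurable_prob_algebraD[OF steps_kernel]]
  have eq: "steps (h # k # hs) x = (comon (P h) x \<bind> comon (P k)) \<bind> steps hs" by simp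
  have "orthant_le (comon (P h) x \<bind> comon (P k)) (comon (P (h + k)) x)"
    using mono_kernel.motion_le_comon[OF mono_kernel m] by (auto simp: orthant_le_def)
  then show "orthant_le (steps (h # k # hs) x) (steps ((h + k) # hs) x)"
    unfolding eq
    by (auto intro!: orthant_le_bind_left mixture_cone_steps steps_kernel
        motion_prob[OF m] motion_sets[OF m] motion_prob[OF motion_comon'] motion_sets[OF motion_comon'])
qed

lemma finer_Nil: "ks \<in> partitions 0 \<Longrightarrow> finer ks []"
  using motion_return_unique motion_steps[of ks 0] by (auto simp: finer_def zero orthant_le_refl)

text \<open>As in merging, the shorter of the two first steps is taken off both lists and the rest
  of the longer step is put back. One list loses an element and the other keeps its length, so the
  total length decreases.\<close>

lemma common_refinement:
  "hs \<in> partitions t \<Longrightarrow> ks \<in> partitions t \<Longrightarrow> \<exists>ls\<in>partitions t. finer ls hs \<and> finer ls ks"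
proof (induction "length hs + length ks" arbitrary: hs ks t rule: less_induct)
  case less
  have step: "\<exists>ls\<in>partitions t. finer ls (h # hs') \<and> finer ls (k # ks')"
    if eq: "length (h # hs') + length (k # ks') = length hs + length ks"
      and hs: "h # hs' \<in> partitions t" and ks: "k # ks' \<in> partitions t" and le: "h \<le> k" for h k hs' ks'
  proof -
    have "\<exists>ls\<in>partitions (t - h). finer ls hs' \<and> finer ls ((k - h) # ks')"
      using hs ks le eq by (intro less.hyps) (auto simp: partitions_Cons)
    then obtain ls where ls: "ls \<in> partitions (t - h)" "finer ls hs'" "finer ls ((k - h) # ks')" by blast
    have "finer (h # (k - h) # ks') (k # ks')"
      using finer_split[of h "k - h" ks'] hs le by (simp add: partitions_Cons)
    then have "finer (h # ls) (k # ks')"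
      using finer_Cons[OF ls(3)] finer_trans by blast
    then show ?thesis using ls hs by (intro bexI[of _ "h # ls"]) (auto simp: finer_Cons partitions_Cons)
  qed
  show ?case
  proof (cases "hs = [] \<or> ks = []")
    case True
    then have "t = 0" using less.prems by (auto simp: partitions_def)
    then show ?thesis using True less.prems finer_Nil finer_refl by auto
  next
    case False
    then obtain h hs' k ks' where "hs = h # hs'" "ks = k # ks'" by (meson neq_Nil_conv)
    then show ?thesis
      using step[of h hs' k ks'] step[of k ks' h hs'] less.prems by (cases "h \<le> k") auto
  qed
qed

text \<open>Inserting the time \<open>s\<close> as a division point refines the partition and makes
  it a concatenation; only the step that straddles \<open>s\<close> is subdivided.\<close>

lemma split_refinement:
  "ls \<in> partitions (s + t) \<Longrightarrow> 0 \<le> s \<Longrightarrow> 0 \<le> t \<Longrightarrow>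
    \<exists>hs\<in>partitions s. \<exists>ks\<in>partitions t. finer (hs @ ks) ls"
proof (induction ls arbitrary: s)
  case Nil
  then have "s = 0" "t = 0" by (auto simp: partitions_def)
  then show ?case by (auto simp: partitions_def intro!: exI[of _ "[]"] finer_refl)
next
  case (Cons l ls)
  then have l: "0 \<le> l" "ls \<in> partitions (s + t - l)" by (auto simp: partitions_Cons)
  show ?case
  proof (cases "s \<le> l")
    case True
    have "finer ([s] @ (l - s) # ls) (l # ls)"
      using finer_split[of s "l - s" ls] True Cons.prems by simp
    moreover have "[s] \<in> partitions s" "(l - s) # ls \<in> partitions t"
      using True Cons.prems l by (auto simp: partitions_def)
    ultimately show ?thesis by blast
  next
    case False
    then obtain hs ks where h: "hs \<in> partitions (s - l)" "ks \<in> partitions t" "finer (hs @ ks) ls"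
      using Cons.IH[of "s - l"] l Cons.prems by (auto simp: algebra_simps)
    then have "finer ((l # hs) @ ks) (l # ls)" by (simp add: finer_Cons)
    moreover have "l # hs \<in> partitions s" using h l by (simp add: partitions_Cons)
    ultimately show ?thesis using h by blast
  qed
qed

text \<open>The filter of tails of the directed preorder \<open>finer\<close> on the partitions of
  \<open>t\<close>.\<close>

definition refine :: "real \<Rightarrow> real list filter" where
  "refine t = (INF hs\<in>partitions t. principal {ks \<in> partitions t. finer ks hs})"

lemma eventually_refine:
  assumes "0 \<le> t"
  shows "eventually \<Phi> (refine t) \<longleftrightarrow> (\<exists>hs\<in>partitions t. \<forall>ks\<in>partitions t. finer ks hs \<longrightarrow> \<Phi> ks)"
proof -
  have "[t] \<in> partitions t" using assms by (simp add: partitions_def)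
  then have "partitions t \<noteq> {}" by blast
  moreover have "\<exists>ls\<in>partitions t. principal {ks \<in> partitions t. finer ks ls} \<le>
      inf (principal {ks \<in> partitions t. finer ks a}) (principal {ks \<in> partitions t. finer ks b})"
    if "a \<in> partitions t" "b \<in> partitions t" for a b
    using common_refinement[OF that] by (auto dest: finer_trans)
  ultimately have "eventually \<Phi> (refine t) \<longleftrightarrow>
      (\<exists>hs\<in>partitions t. eventually \<Phi> (principal {ks \<in> partitions t. finer ks hs}))"
    unfolding refine_def by (rule eventually_INF_base)
  then show ?thesis by (auto simp: eventually_principal)
qed

lemma refine_neq_bot: "0 \<le> t \<Longrightarrow> refine t \<noteq> bot"
  using finer_refl by (auto simp: trivial_limit_def eventually_refine)

lemma eventually_partition: "0 \<le> t \<Longrightarrow> \<forall>\<^sub>F hs in refine t. hs \<in> partitions t"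
  by (auto simp: eventually_refine partitions_def intro!: exI[of _ "[t]"])

lemma eventually_finer: "hs \<in> partitions t \<Longrightarrow> \<forall>\<^sub>F ks in refine t. finer ks hs"
  using eventually_refine[OF partitions_nonneg] by blast

text \<open>A decreasing net that is bounded below converges to its infimum.\<close>

lemma steps_converge:
  assumes t: "0 \<le> t" and D: "lower_family D"
  shows "((\<lambda>hs. measure (steps hs x) (orthant D)) \<longlongrightarrow> (INF hs\<in>partitions t. measure (steps hs x) (orthant D))) (refine t)"
proof (rule order_tendstoI)
  let ?f = "\<lambda>hs. measure (steps hs x) (orthant D)"
  have bdd: "bdd_below (?f ` partitions t)" by (auto simp: bdd_below_def intro: exI[of _ 0])
  fix a
  show "\<forall>\<^sub>F hs in refine t. a < ?f hs" if "a < (INF hs\<in>partitions t. ?f hs)"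
    using eventually_partition[OF t] by eventually_elim (use cINF_lower[OF bdd] that in fastforce)
  assume a: "(INF hs\<in>partitions t. ?f hs) < a"
  have "[t] \<in> partitions t" using t by (simp add: partitions_def)
  then have "partitions t \<noteq> {}" by blast
  then obtain hs where hs: "hs \<in> partitions t" "?f hs < a"
    using a bdd by (auto simp: cINF_less_iff)
  show "\<forall>\<^sub>F hs in refine t. ?f hs < a"
    using eventually_finer[OF hs(1)]
  proof eventually_elim
    case (elim ks)
    then have "?f ks \<le> ?f hs" using D by (simp add: finer_def orthant_le_def)
    then show ?case using hs(2) by simp
  qed
qed

lemma orthant_limit_steps:
  assumes t: "0 \<le> t"
  shows "orthant_limit (\<lambda>hs. steps hs x) (refine t) (\<lambda>i. P t (x i))"
proof (rule orthant_limit.intro)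
  show "\<forall>\<^sub>F hs in refine t. distr (steps hs x) borel (\<lambda>y. y i) = P t (x i)" for i
    using eventually_partition[OF t] by eventually_elim (rule motion_marginal[OF motion_steps])
  show "\<exists>l. ((\<lambda>hs. measure (steps hs x) (orthant D)) \<longlongrightarrow> l) (refine t)" if "lower_family D" for D
    using steps_converge[OF t that] by blast
  show "real_distribution (P t (x i))" for i
    by (rule mono_kernel.distribution_p[OF mono_kernel])
qed (rule refine_neq_bot[OF t] steps_prob steps_sets)+

section \<open>The limit kernels\<close>

definition flow :: "real \<Rightarrow> (nat \<Rightarrow> real) \<Rightarrow> (nat \<Rightarrow> real) measure" where
  "flow t x = orthant_limit.limit_law (\<lambda>hs. steps hs x) (refine t)"

lemma
  assumes t: "0 \<le> t"
  shows prob_flow: "prob_space (flow t x)"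
    and sets_flow: "sets (flow t x) = sets Rinf"
    and flow_marginal: "distr (flow t x) borel (\<lambda>y. y i) = P t (x i)"
    and flow_tendsto: "lower_family D \<Longrightarrow>
      ((\<lambda>hs. measure (steps hs x) (orthant D)) \<longlongrightarrow> measure (flow t x) (orthant D)) (refine t)"
proof -
  interpret orthant_limit "\<lambda>hs. steps hs x" "refine t" "\<lambda>i. P t (x i)"
    by (rule orthant_limit_steps[OF t])
  show "prob_space (flow t x)" "sets (flow t x) = sets Rinf" "distr (flow t x) borel (\<lambda>y. y i) = P t (x i)"
    unfolding flow_def by (rule prob_limit_law sets_limit_law limit_law_marginal)+
  show "lower_family D \<Longrightarrow>
      ((\<lambda>hs. measure (steps hs x) (orthant D)) \<longlongrightarrow> measure (flow t x) (orthant D)) (refine t)"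
    unfolding flow_def by (rule limit_law_orthant)
qed

lemma flow_le_steps:
  assumes "hs \<in> partitions t"
  shows "orthant_le (flow t x) (steps hs x)"
  unfolding orthant_le_def
proof (intro allI impI)
  fix D assume D: "lower_family D"
  have t: "0 \<le> t" using assms by (rule partitions_nonneg)
  have "\<forall>\<^sub>F ks in refine t. measure (steps ks x) (orthant D) \<le> measure (steps hs x) (orthant D)"
    using eventually_finer[OF assms] by eventually_elim (use D in \<open>auto simp: finer_def orthant_le_def\<close>)
  then show "measure (flow t x) (orthant D) \<le> measure (steps hs x) (orthant D)"
    by (rule tendsto_upperbound[OF flow_tendsto[OF t D] _ refine_neq_bot[OF t]])
qed

lemma flow_relabel:
  assumes t: "0 \<le> t"
  shows "distr (flow t x) Rinf (\<lambda>y. y \<circ> \<sigma>) = flow t (x \<circ> \<sigma>)"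
proof (rule Rinf_measure_eqI)
  have "(\<lambda>y. y \<circ> \<sigma>) \<in> flow t x \<rightarrow>\<^sub>M Rinf"
    by (simp add: measurable_cong_sets[OF sets_flow[OF t] refl])
  then show "prob_space (distr (flow t x) Rinf (\<lambda>y. y \<circ> \<sigma>))"
    by (rule prob_space.prob_space_distr[OF prob_flow[OF t]])
  fix D assume D: "lower_family D"
  obtain E where E: "lower_family E" "{y. y \<circ> \<sigma> \<in> orthant D} = orthant E"
    using orthant_relabel[OF D] by blast
  have "\<forall>\<^sub>F hs in refine t. measure (steps hs (x \<circ> \<sigma>)) (orthant D) = measure (steps hs x) (orthant E)"
    using eventually_partition[OF t]
  proof eventually_elim
    case (elim hs)
    show ?case
      unfolding motion_relabel[OF motion_steps[OF elim], symmetric]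
      by (simp add: measure_relabel[OF steps_sets orthant_sets[OF D]] E)
  qed
  then have "((\<lambda>hs. measure (steps hs (x \<circ> \<sigma>)) (orthant D)) \<longlongrightarrow> measure (flow t x) (orthant E)) (refine t)"
    using flow_tendsto[OF t E(1)] by (simp add: tendsto_cong)
  then have "measure (flow t (x \<circ> \<sigma>)) (orthant D) = measure (flow t x) (orthant E)"
    using tendsto_unique[OF refine_neq_bot[OF t] flow_tendsto[OF t D]] by blast
  then show "measure (distr (flow t x) Rinf (\<lambda>y. y \<circ> \<sigma>)) (orthant D) = measure (flow t (x \<circ> \<sigma>)) (orthant D)"
    by (simp add: measure_relabel[OF sets_flow[OF t] orthant_sets[OF D]] E)
qed (auto simp: prob_flow sets_flow t)

text \<open>The order event is not an orthant, so its probability does not pass to the limit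
  directly. Its complement is a countable union, over the rationals between \<open>y j\<close> and
  \<open>y i\<close>, of differences of two orthants; these differences are null for every partition
  and hence in the limit.\<close>

lemma flow_order:
  assumes t: "0 \<le> t" and le: "x i \<le> x j"
  shows "AE y in flow t x. y i \<le> y j"
proof -
  interpret prob_space "flow t x" by (rule prob_flow[OF t])
  have "AE y in flow t x. \<not> (y j \<le> of_rat q \<and> of_rat q < y i)" for q
  proof -
    define D where "D = (\<lambda>_. UNIV :: real set)(j := {..real_of_rat q})"
    define E where "E k = D k \<inter> ((\<lambda>_. UNIV)(i := {..real_of_rat q})) k" for k
    have D: "lower_family D" unfolding D_def by (rule lower_family_single) simp
    have E: "lower_family E" unfolding E_def[abs_def] by (intro lower_family_Int D lower_family_single) simp
    have oD: "orthant D = {y. y j \<in> {..real_of_rat q}}" unfolding D_def by (rule orthant_single)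
    have oE: "orthant E = orthant D \<inter> {y. y i \<in> {..real_of_rat q}}"
      unfolding E_def orthant_Int orthant_single ..
    have "\<forall>\<^sub>F hs in refine t. measure (steps hs x) (orthant D) = measure (steps hs x) (orthant E)"
      using eventually_partition[OF t]
    proof eventually_elim
      case (elim hs)
      interpret S: prob_space "steps hs x" by (rule steps_prob)
      have "AE y in steps hs x. y i \<le> y j" by (rule motion_order[OF motion_steps[OF elim] le])
      then have "AE y in steps hs x. y \<in> orthant D \<longleftrightarrow> y \<in> orthant E"
        by eventually_elim (auto simp: oD oE)
      then show ?case
        by (rule S.finite_measure_eq_AE) (auto simp: steps_sets orthant_sets D E)
    qed
    from tendsto_cong[OF this] flow_tendsto[OF t D, of x] flow_tendsto[OF t E, of x]
    have "prob (orthant D) = prob (orthant E)"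
      using tendsto_unique[OF refine_neq_bot[OF t]] by blast
    moreover have "prob (orthant D - orthant E) = prob (orthant D) - prob (orthant E)"
    proof (rule finite_measure_Diff)
      show "orthant E \<subseteq> orthant D" unfolding oE by simp
    qed (simp_all add: sets_flow t orthant_sets D E)
    ultimately have "prob (orthant D - orthant E) = 0" by simp
    then have "AE y in flow t x. y \<notin> orthant D - orthant E"
      by (subst (asm) prob_eq_0) (auto simp: sets_flow t orthant_sets D E)
    then show ?thesis by eventually_elim (auto simp: oD oE)
  qed
  then have "AE y in flow t x. \<forall>q. \<not> (y j \<le> of_rat q \<and> of_rat q < y i)"
    by (simp add: AE_all_countable)
  then show ?thesis
  proof eventually_elim
    case (elim y)
    show ?case
    proof (rule ccontr)
      assume "\<not> y i \<le> y j"
      then obtain q where "y j < real_of_rat q" "real_of_rat q < y i" using of_rat_dense[of "y j" "y i"] by auto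
      then show False using elim by (auto intro: less_imp_le)
    qed
  qed
qed

end

section \<open>Uniform convergence and the semigroup property\<close>

text \<open>Total boundedness of a cube, on an index set without topology: the values are rounded
  down to a grid, finitely many grid patterns occur, and one representative is kept for
  each.\<close>

lemma finite_net:
  fixes f :: "'i \<Rightarrow> 'x \<Rightarrow> real"
  assumes T: "finite T" and f: "\<And>i x. 0 \<le> f i x" "\<And>i x. f i x \<le> 1" and e: "0 < e"
  shows "\<exists>R. finite R \<and> (\<forall>x. \<exists>r\<in>R. (\<Sum>i\<in>T. \<bar>f i x - f i r\<bar>) \<le> e)"
proof -
  \<comment> \<open>Each coordinate contributes a rounding error of at most
    \<open>1 / real N\<close>, and there are \<open>card T\<close> of them.\<close>
  obtain N :: nat where N: "real (card T) / e < real N" using reals_Archimedean2 by blast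
  have N0: "0 < N" using N e by (cases N) (auto simp: field_simps)
  define c where "c x = restrict (\<lambda>i. nat \<lfloor>real N * f i x\<rfloor>) T" for x
  have "nat \<lfloor>real N * f i x\<rfloor> \<le> N" for i x
    using f[of i x] by (simp add: nat_le_iff floor_le_iff) (smt (verit) mult_left_le of_nat_0_le_iff)
  then have "range c \<subseteq> PiE T (\<lambda>_. {0..N})" by (auto simp: c_def)
  then have fin: "finite (range c)" using T by (rule finite_subset[OF _ finite_PiE]) auto
  define R where "R = (\<lambda>w. SOME x. c x = w) ` range c"
  have "\<exists>r\<in>R. (\<Sum>i\<in>T. \<bar>f i x - f i r\<bar>) \<le> e" for x
  proof
    define r where "r = (SOME y. c y = c x)"
    show "r \<in> R" by (auto simp: R_def r_def)
    have cr: "c r = c x" unfolding r_def by (rule someI) simp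
    have "\<bar>f i x - f i r\<bar> \<le> 1 / real N" if "i \<in> T" for i
    proof -
      have "nat \<lfloor>real N * f i r\<rfloor> = nat \<lfloor>real N * f i x\<rfloor>" using fun_cong[OF cr, of i] that by (simp add: c_def)
      then have "\<lfloor>real N * f i r\<rfloor> = \<lfloor>real N * f i x\<rfloor>" using f by (simp add: eq_nat_nat_iff)
      then have "\<bar>real N * f i x - real N * f i r\<bar> \<le> 1" by linarith
      then have "real N * \<bar>f i x - f i r\<bar> \<le> 1" by (simp add: abs_mult flip: right_diff_distrib)
      then show ?thesis using N0 by (simp add: field_simps)
    qed
    then have "(\<Sum>i\<in>T. \<bar>f i x - f i r\<bar>) \<le> (\<Sum>i\<in>T. 1 / real N)" by (rule sum_mono)
    also have "\<dots> \<le> e" using N N0 e by (simp add: field_simps)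
    finally show "(\<Sum>i\<in>T. \<bar>f i x - f i r\<bar>) \<le> e" .
  qed
  moreover have "finite R" using fin by (simp add: R_def)
  ultimately show ?thesis by blast
qed

context mono_semigroup
begin

lemma flow_lipschitz:
  assumes t: "0 \<le> t" and D: "lower_family D" and T: "finite T" "\<And>i. i \<notin> T \<Longrightarrow> D i = UNIV"
  shows "measure (flow t x) (orthant D) \<le> measure (flow t y) (orthant D) +
    (\<Sum>i\<in>T. \<bar>measure (P t (x i)) (D i) - measure (P t (y i)) (D i)\<bar>)"
proof (rule tendsto_le[OF refine_neq_bot[OF t] _ flow_tendsto[OF t D, of x]])
  show "((\<lambda>hs. measure (steps hs y) (orthant D) + (\<Sum>i\<in>T. \<bar>measure (P t (x i)) (D i) - measure (P t (y i)) (D i)\<bar>)) \<longlongrightarrow>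
    measure (flow t y) (orthant D) + (\<Sum>i\<in>T. \<bar>measure (P t (x i)) (D i) - measure (P t (y i)) (D i)\<bar>)) (refine t)"
    by (intro tendsto_add flow_tendsto[OF t D] tendsto_const)
  show "\<forall>\<^sub>F hs in refine t. measure (steps hs x) (orthant D) \<le> measure (steps hs y) (orthant D) +
    (\<Sum>i\<in>T. \<bar>measure (P t (x i)) (D i) - measure (P t (y i)) (D i)\<bar>)"
    using eventually_partition[OF t] by eventually_elim (rule motion_lipschitz[OF motion_steps D T])
qed

text \<open>The functions are equi-Lipschitz in the finitely many numbers \<open>P t (x i) (D i) \<in> [0, 1]\<close>,
  so pointwise convergence on a finite net of starting points gives uniform convergence.\<close>
lemma steps_converge_uniformly:
  assumes t: "0 \<le> t" and D: "lower_family D" and e: "0 < e"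
  shows "\<forall>\<^sub>F hs in refine t. \<forall>x. \<bar>measure (flow t x) (orthant D) - measure (steps hs x) (orthant D)\<bar> \<le> e"
proof -
  define T where "T = {i. D i \<noteq> UNIV}"
  have T: "finite T" "\<And>i. i \<notin> T \<Longrightarrow> D i = UNIV" using D by (auto simp: T_def lower_family_def)
  have pr: "prob_space (P t r)" for r by (rule mono_kernel.prob_p[OF mono_kernel])
  define w where "w i x = measure (P t (x i)) (D i)" for i and x :: "nat \<Rightarrow> real"
  obtain R where R: "finite R" "\<And>x. \<exists>r\<in>R. (\<Sum>i\<in>T. \<bar>w i x - w i r\<bar>) \<le> e / 3"
    using finite_net[of T w "e / 3"] T e prob_space.prob_le_1[OF pr] by (auto simp: w_def)
  have "\<forall>\<^sub>F hs in refine t. dist (measure (steps hs r) (orthant D)) (measure (flow t r) (orthant D)) < e / 3" for r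
    using flow_tendsto[OF t D] e by (intro tendstoD) auto
  then have "\<forall>\<^sub>F hs in refine t. \<forall>r\<in>R. dist (measure (steps hs r) (orthant D)) (measure (flow t r) (orthant D)) < e / 3"
    using R(1) by (simp add: eventually_ball_finite)
  then show ?thesis using eventually_partition[OF t]
  proof eventually_elim
    case (elim hs)
    show ?case
    proof
      fix x
      obtain r where r: "r \<in> R" "(\<Sum>i\<in>T. \<bar>w i x - w i r\<bar>) \<le> e / 3" using R(2) by blast
      have "(\<Sum>i\<in>T. \<bar>w i r - w i x\<bar>) \<le> e / 3" using r(2) by (simp add: abs_minus_commute)
      then have "measure (flow t r) (orthant D) \<le> measure (flow t x) (orthant D) + e / 3"
        using flow_lipschitz[OF t D T, of r x] by (simp add: w_def)
      moreover have "measure (steps hs x) (orthant D) \<le> measure (steps hs r) (orthant D) + e / 3"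
        using motion_lipschitz[OF motion_steps[OF elim(2)] D T, of x r] r(2) by (simp add: w_def)
      moreover have "measure (steps hs r) (orthant D) < measure (flow t r) (orthant D) + e / 3"
        using bspec[OF elim(1) r(1)] unfolding dist_real_def by linarith
      \<comment> \<open>The flow never exceeds the compositions, so the absolute value is one-sided
        and the three errors of \<open>e / 3\<close> bound it.\<close>
      moreover have "measure (flow t x) (orthant D) \<le> measure (steps hs x) (orthant D)"
        using flow_le_steps[OF elim(2)] D by (simp add: orthant_le_def)
      ultimately show "\<bar>measure (flow t x) (orthant D) - measure (steps hs x) (orthant D)\<bar> \<le> e"
        by linarith
    qed
  qed
qed

text \<open>Uniformity in the starting point is essential here: it puts the limit in the cone, which
  gives both measurability of the kernel and integration against limits in
  \<open>flow_add\<close>.\<close>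

lemma mixture_cone_flow:
  assumes t: "0 \<le> t" and D: "lower_family D"
  shows "mixture_cone (\<lambda>x. measure (flow t x) (orthant D))"
proof (rule mixture_cone.limit)
  fix e :: real assume "0 < e"
  from eventually_happens'[OF refine_neq_bot[OF t] steps_converge_uniformly[OF t D this]]
  show "\<exists>g. mixture_cone g \<and> (\<forall>x. \<bar>measure (flow t x) (orthant D) - g x\<bar> \<le> e)"
    using mixture_cone_steps[OF D] by blast
qed

lemma flow_kernel: "0 \<le> t \<Longrightarrow> flow t \<in> Rinf \<rightarrow>\<^sub>M prob_algebra Rinf"
  using mixture_cone_measurable[OF mixture_cone_flow]
  by (intro Rinf_prob_kernelI prob_flow sets_flow)

lemma motion_flow: "0 \<le> t \<Longrightarrow> motion (P t) (flow t)"
  unfolding motion_def using flow_kernel flow_marginal flow_relabel flow_order by blast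

lemma flow_zero: "flow 0 x = return Rinf x"
  using motion_flow[of 0] by (intro motion_return_unique) (simp add: zero)

text \<open>Concatenated partitions bound the flow over \<open>s + t\<close> from above by nearly
  the composition of flows; conversely every partition of \<open>s + t\<close> can be refined
  through the time \<open>s\<close>.\<close>

lemma flow_add:
  assumes s: "0 \<le> s" and t: "0 \<le> t"
  shows "flow (s + t) x = flow s x \<bind> flow t"
proof (rule Rinf_measure_eqI)
  have st: "0 \<le> s + t" using s t by simp
  have "flow s x \<in> space (prob_algebra Rinf)" by (simp add: space_prob_algebra prob_flow sets_flow s)
  then show "prob_space (flow s x \<bind> flow t)" "sets (flow s x \<bind> flow t) = sets Rinf"
    using flow_kernel[OF t] by (rule prob_space_bind', rule sets_bind')
  show "prob_space (flow (s + t) x)" "sets (flow (s + t) x) = sets Rinf"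
    using st by (auto simp: prob_flow sets_flow)
  fix D assume D: "lower_family D"
  define r where "r = (\<integral>y. measure (flow t y) (orthant D) \<partial>flow s x)"
  have bind: "measure (flow s x \<bind> flow t) (orthant D) = r"
    unfolding r_def by (rule measure_bind_kernel[OF prob_flow[OF s] sets_flow[OF s] flow_kernel[OF t] orthant_sets[OF D]])
  have steps_bind: "measure (steps (hs @ ks) x) (orthant D) = (\<integral>y. measure (steps ks y) (orthant D) \<partial>steps hs x)" for hs ks
    unfolding steps_append by (rule measure_bind_kernel[OF steps_prob steps_sets steps_kernel orthant_sets[OF D]])
  have lim: "((\<lambda>hs. \<integral>y. measure (flow t y) (orthant D) \<partial>steps hs x) \<longlongrightarrow> r) (refine s)"
    unfolding r_def
    by (rule mixture_cone_integral_tendsto[OF steps_prob steps_sets prob_flow[OF s] sets_flow[OF s] flow_tendsto[OF s] mixture_cone_flow[OF t D]])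
  have int_f: "integrable (steps hs x) (\<lambda>y. measure (flow t y) (orthant D))" for hs
    by (rule mixture_cone_integrable[OF mixture_cone_flow[OF t D] steps_prob steps_sets])
  have int_s: "integrable (steps hs x) (\<lambda>y. measure (steps ks y) (orthant D))" for hs ks
    by (rule mixture_cone_integrable[OF mixture_cone_steps[OF D] steps_prob steps_sets])
  \<comment> \<open>The order of choices matters: \<open>ks\<close> first, with an error uniform in
    the intermediate point, so that the bound is unaffected by the later choice of
    \<open>hs\<close>.\<close>
  have "measure (flow (s + t) x) (orthant D) \<le> r"
  proof (rule field_le_epsilon)
    fix e :: real assume e: "0 < e"
    obtain ks where ks: "ks \<in> partitions t"
        "\<forall>y. \<bar>measure (flow t y) (orthant D) - measure (steps ks y) (orthant D)\<bar> \<le> e / 2"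
      using eventually_happens'[OF refine_neq_bot[OF t] eventually_conj[OF eventually_partition[OF t] steps_converge_uniformly[OF t D, of "e / 2"]]] e
      by auto
    have "\<forall>\<^sub>F hs in refine s. (\<integral>y. measure (flow t y) (orthant D) \<partial>steps hs x) < r + e / 2"
      using lim e by (intro order_tendstoD) auto
    then obtain hs where hs: "hs \<in> partitions s" "(\<integral>y. measure (flow t y) (orthant D) \<partial>steps hs x) < r + e / 2"
      using eventually_happens'[OF refine_neq_bot[OF s] eventually_conj[OF eventually_partition[OF s]]] by blast
    have "\<bar>(\<integral>y. measure (flow t y) (orthant D) \<partial>steps hs x) - (\<integral>y. measure (steps ks y) (orthant D) \<partial>steps hs x)\<bar> \<le> e / 2"
      by (rule integral_uniform_close[OF steps_prob int_f int_s ks(2)])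
    moreover have "measure (flow (s + t) x) (orthant D) \<le> measure (steps (hs @ ks) x) (orthant D)"
      using flow_le_steps[OF partitions_append[OF hs(1) ks(1)]] D by (simp add: orthant_le_def)
    ultimately show "measure (flow (s + t) x) (orthant D) \<le> r + e"
      unfolding steps_bind using hs(2) by linarith
  qed
  \<comment> \<open>The flow lies below the compositions in both factors; in the first factor this
    is integrated over \<open>flow t\<close>, whose orthant probabilities lie in the cone.\<close>
  moreover have "r \<le> measure (flow (s + t) x) (orthant D)"
  proof (rule tendsto_lowerbound[OF flow_tendsto[OF st D] _ refine_neq_bot[OF st]])
    show "\<forall>\<^sub>F ls in refine (s + t). r \<le> measure (steps ls x) (orthant D)"
      using eventually_partition[OF st]
    proof eventually_elim
      case (elim ls)
      obtain hs ks where h: "hs \<in> partitions s" "ks \<in> partitions t" "finer (hs @ ks) ls"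
        using split_refinement[OF elim s t] by blast
      have "r \<le> (\<integral>y. measure (flow t y) (orthant D) \<partial>steps hs x)"
        unfolding r_def
        by (rule mixture_cone_integral_mono[OF prob_flow[OF s] sets_flow[OF s] steps_prob steps_sets flow_le_steps[OF h(1)] mixture_cone_flow[OF t D]])
      also have "\<dots> \<le> (\<integral>y. measure (steps ks y) (orthant D) \<partial>steps hs x)"
        using flow_le_steps[OF h(2)] D by (intro integral_mono int_f int_s) (simp add: orthant_le_def)
      also have "\<dots> \<le> measure (steps ls x) (orthant D)"
        unfolding steps_bind[symmetric] using h(3) D by (simp add: finer_def orthant_le_def)
      finally show ?case .
    qed
  qed
  ultimately show "measure (flow (s + t) x) (orthant D) = measure (flow s x \<bind> flow t) (orthant D)"
    unfolding bind by simp
qed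

end

subsection \<open>The Feller property\<close>

text \<open>Real and imaginary part of 1/(1 - i*r), which maps the line onto a circle without the
  origin, the image of infinity. Both parts vanish at infinity, so the Feller property of
  \<open>P\<close> applies to them.\<close>

definition psi1 :: "real \<Rightarrow> real" where "psi1 r = 1 / (1 + r\<^sup>2)"
definition psi2 :: "real \<Rightarrow> real" where "psi2 r = r / (1 + r\<^sup>2)"

lemma one_plus_square_pos: "0 < 1 + (r::real)\<^sup>2"
  by (smt (verit) zero_le_power2)

lemma psi_continuous: "continuous_on UNIV psi1" "continuous_on UNIV psi2"
  unfolding psi1_def[abs_def] psi2_def[abs_def]
  using one_plus_square_pos by (auto intro!: continuous_intros simp: less_imp_neq[symmetric] order_less_imp_not_eq2)

lemma psi_borel [measurable]: "psi1 \<in> borel_measurable borel" "psi2 \<in> borel_measurable borel"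
  using psi_continuous by (auto intro: borel_measurable_continuous_onI)

lemma abs_psi: "\<bar>psi1 r\<bar> = 1 / (1 + r\<^sup>2)" "\<bar>psi2 r\<bar> = \<bar>r\<bar> / (1 + r\<^sup>2)"
  by (simp_all add: psi1_def psi2_def abs_of_pos[OF one_plus_square_pos])

lemma psi_le_1: "\<bar>psi1 r\<bar> \<le> 1" "\<bar>psi2 r\<bar> \<le> 1"
proof -
  have "\<bar>r\<bar> \<le> 1 + r\<^sup>2"
    using sum_squares_bound[of "\<bar>r\<bar>" 1] by (simp add: abs_if split: if_splits)
  then show "\<bar>psi2 r\<bar> \<le> 1"
    unfolding abs_psi using one_plus_square_pos[of r] by (simp add: divide_le_eq)
  show "\<bar>psi1 r\<bar> \<le> 1"
    unfolding abs_psi using one_plus_square_pos[of r] by (simp add: divide_le_eq)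
qed

lemma psi_decay: "\<bar>psi1 r\<bar> * \<bar>r\<bar> \<le> 1" "\<bar>psi2 r\<bar> * \<bar>r\<bar> \<le> 1"
proof -
  show "\<bar>psi1 r\<bar> * \<bar>r\<bar> \<le> 1"
    using psi_le_1(2)[of r] unfolding abs_psi by simp
  show "\<bar>psi2 r\<bar> * \<bar>r\<bar> \<le> 1"
    unfolding abs_psi using one_plus_square_pos[of r]
    by (simp add: divide_le_eq power2_eq_square)
qed

text \<open>Both derivatives are bounded by \<open>1 / (1 + x\<^sup>2)\<close>, the derivative of
  \<open>arctan\<close>, so adding or subtracting either function leaves \<open>arctan\<close>
  nondecreasing. The monotone gauge \<open>arctan\<close> thus dominates distances in circle
  coordinates.\<close>

lemma psi_arctan:
  "\<bar>psi1 r - psi1 s\<bar> \<le> \<bar>arctan r - arctan s\<bar>" "\<bar>psi2 r - psi2 s\<bar> \<le> \<bar>arctan r - arctan s\<bar>"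
proof -
  have key: "\<bar>f r - f s\<bar> \<le> \<bar>arctan r - arctan s\<bar>"
    if f': "\<And>x. (f has_real_derivative f' x) (at x)" and le: "\<And>x. \<bar>f' x\<bar> \<le> 1 / (1 + x\<^sup>2)" for f f' r s
  proof -
    have mono: "arctan a + f a \<le> arctan b + f b" "arctan a - f a \<le> arctan b - f b" if "a \<le> b" for a b
    proof -
      show "arctan a + f a \<le> arctan b + f b"
      proof (rule DERIV_nonneg_imp_nondecreasing[OF that, where f="\<lambda>x. arctan x + f x"])
        fix x
        have "((\<lambda>x. arctan x + f x) has_real_derivative 1 / (1 + x\<^sup>2) + f' x) (at x)"
          by (auto intro!: derivative_eq_intros f' simp: divide_inverse)
        then show "\<exists>y. ((\<lambda>x. arctan x + f x) has_real_derivative y) (at x) \<and> 0 \<le> y"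
          using le[of x] by (intro exI[of _ "1 / (1 + x\<^sup>2) + f' x"]) linarith
      qed
      show "arctan a - f a \<le> arctan b - f b"
      proof (rule DERIV_nonneg_imp_nondecreasing[OF that, where f="\<lambda>x. arctan x - f x"])
        fix x
        have "((\<lambda>x. arctan x - f x) has_real_derivative 1 / (1 + x\<^sup>2) - f' x) (at x)"
          by (auto intro!: derivative_eq_intros f' simp: divide_inverse)
        then show "\<exists>y. ((\<lambda>x. arctan x - f x) has_real_derivative y) (at x) \<and> 0 \<le> y"
          using le[of x] by (intro exI[of _ "1 / (1 + x\<^sup>2) - f' x"]) linarith
      qed
    qed
    show ?thesis using mono[of r s] mono[of s r] by (cases "r \<le> s") linarith+
  qed
  have ne: "1 + x\<^sup>2 \<noteq> (0::real)" for x :: real using one_plus_square_pos[of x] by simp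
  have "(psi1 has_real_derivative (- 2 * x / (1 + x\<^sup>2)\<^sup>2)) (at x)" for x
    unfolding psi1_def[abs_def] using ne[of x]
    by (auto intro!: derivative_eq_intros simp: field_simps power2_eq_square)
  moreover have "\<bar>- 2 * x / (1 + x\<^sup>2)\<^sup>2\<bar> \<le> 1 / (1 + x\<^sup>2)" for x :: real
  proof -
    have "2 * \<bar>x\<bar> \<le> 1 + x\<^sup>2" using sum_squares_bound[of "\<bar>x\<bar>" 1] by (simp add: power2_eq_square)
    then have "\<bar>- 2 * x\<bar> / (1 + x\<^sup>2)\<^sup>2 \<le> (1 + x\<^sup>2) / (1 + x\<^sup>2)\<^sup>2"
      by (intro divide_right_mono) (auto simp: abs_mult)
    then show ?thesis using ne[of x] by (simp add: power2_eq_square[of "1 + x\<^sup>2"])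
  qed
  ultimately show "\<bar>psi1 r - psi1 s\<bar> \<le> \<bar>arctan r - arctan s\<bar>" by (rule key)
  have "(psi2 has_real_derivative ((1 - x\<^sup>2) / (1 + x\<^sup>2)\<^sup>2)) (at x)" for x
    unfolding psi2_def[abs_def] using ne[of x]
    by (auto intro!: derivative_eq_intros simp: field_simps power2_eq_square)
  moreover have "\<bar>(1 - x\<^sup>2) / (1 + x\<^sup>2)\<^sup>2\<bar> \<le> 1 / (1 + x\<^sup>2)" for x :: real
  proof -
    have "\<bar>1 - x\<^sup>2\<bar> \<le> 1 + x\<^sup>2" by (smt (verit) zero_le_power2)
    then have "\<bar>1 - x\<^sup>2\<bar> / (1 + x\<^sup>2)\<^sup>2 \<le> (1 + x\<^sup>2) / (1 + x\<^sup>2)\<^sup>2"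
      by (intro divide_right_mono) (auto simp: abs_mult)
    then show ?thesis using ne[of x] by (simp add: power2_eq_square[of "1 + x\<^sup>2"])
  qed
  ultimately show "\<bar>psi2 r - psi2 s\<bar> \<le> \<bar>arctan r - arctan s\<bar>" by (rule key)
qed

text \<open>The map \<open>(psi1, psi2)\<close> embeds the line into a circle and has the continuous inverse
  \<open>psi2 / psi1\<close>.\<close>
lemma psi_separate:
  assumes M: "0 \<le> M" and e: "0 < e"
  shows "\<exists>d>0. \<forall>r s. \<bar>r\<bar> \<le> M \<and> \<bar>psi1 r - psi1 s\<bar> < d \<and> \<bar>psi2 r - psi2 s\<bar> < d \<longrightarrow> \<bar>r - s\<bar> < e"
proof -
  define c where "c = 1 / (1 + M\<^sup>2)"
  have c: "0 < c" using one_plus_square_pos[of M] by (simp add: c_def)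
  \<comment> \<open>\<open>c\<close> is the least value of \<open>psi1\<close> on
    \<open>{-M..M}\<close>. The first entry keeps \<open>psi1 s\<close> above \<open>c / 2\<close>;
    the second makes \<open>(M + 1) * d\<close> at most \<open>(c / 2) * e\<close>, which bounds
    \<open>\<bar>r - s\<bar> * psi1 s\<close> through the relation
    \<open>psi2 u = u * psi1 u\<close>.\<close>
  define d where "d = min (c / 2) (c * e / 2 / (M + 1))"
  have d: "0 < d" using c e M by (simp add: d_def)
  have "\<bar>r - s\<bar> < e" if r: "\<bar>r\<bar> \<le> M" and d1: "\<bar>psi1 r - psi1 s\<bar> < d" and d2: "\<bar>psi2 r - psi2 s\<bar> < d" for r s
  proof -
    have "r\<^sup>2 \<le> M\<^sup>2" using r by (metis abs_le_square_iff abs_of_nonneg M)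
    then have "c \<le> psi1 r" unfolding c_def psi1_def using one_plus_square_pos by (intro divide_left_mono) auto
    moreover have "\<bar>psi1 r - psi1 s\<bar> < c / 2" using d1 unfolding d_def by linarith
    ultimately have s: "c / 2 < psi1 s" by linarith
    have p2: "psi2 u = u * psi1 u" for u by (simp add: psi1_def psi2_def)
    have "(r - s) * psi1 s = r * (psi1 s - psi1 r) + (psi2 r - psi2 s)" by (simp add: p2 algebra_simps)
    then have "\<bar>r - s\<bar> * psi1 s = \<bar>r * (psi1 s - psi1 r) + (psi2 r - psi2 s)\<bar>"
      using s c by (metis abs_mult abs_of_pos less_trans half_gt_zero)
    also have "\<dots> \<le> \<bar>r\<bar> * \<bar>psi1 s - psi1 r\<bar> + \<bar>psi2 r - psi2 s\<bar>"
      by (metis abs_mult abs_triangle_ineq)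
    also have "\<dots> < M * d + d"
      using r d1 d2 M by (intro add_le_less_mono mult_mono) (auto simp: abs_minus_commute)
    also have "\<dots> = (M + 1) * d" by (simp add: algebra_simps)
    also have "\<dots> \<le> (M + 1) * (c * e / 2 / (M + 1))" using M by (intro mult_left_mono) (auto simp: d_def)
    also have "\<dots> = (c / 2) * e"
    proof -
      have "M + 1 \<noteq> 0" using M by simp
      then have "(M + 1) * (a / (M + 1)) = a" for a by simp
      then show ?thesis by (simp only: times_divide_eq_left)
    qed
    finally have "\<bar>r - s\<bar> * psi1 s < e * psi1 s" using mult_strict_left_mono[OF s e] by (simp add: mult.commute)
    then show ?thesis using s c by (simp add: mult_less_cancel_right)
  qed
  then show ?thesis using d by blast
qed

lemma C0_realI:
  fixes f :: "real \<Rightarrow> real"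
  assumes "continuous_on UNIV f" "\<And>r. \<bar>f r\<bar> * \<bar>r\<bar> \<le> c"
  shows "C0 UNIV f"
  unfolding C0_def
proof (intro conjI allI impI)
  fix e :: real assume e: "0 < e"
  have "\<bar>f r\<bar> < e" if "r \<notin> {- c / e - 1 .. c / e + 1}" for r
  proof -
    have "c / e < \<bar>r\<bar>" using that by auto
    then have "c < e * \<bar>r\<bar>" using e by (simp add: field_simps)
    then have "\<bar>f r\<bar> * \<bar>r\<bar> < e * \<bar>r\<bar>" using assms(2)[of r] by linarith
    then show ?thesis by (simp add: mult_less_cancel_right)
  qed
  then show "\<exists>K. compact K \<and> K \<subseteq> UNIV \<and> (\<forall>r\<in>UNIV - K. \<bar>f r\<bar> < e)"
    by (intro exI[of _ "{- c / e - 1 .. c / e + 1}"]) auto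
qed (fact assms(1))

lemma C0_psi: "C0 UNIV psi1" "C0 UNIV psi2" "C0 UNIV (\<lambda>r. (psi1 r)\<^sup>2)" "C0 UNIV (\<lambda>r. (psi2 r)\<^sup>2)"
proof -
  have sq: "\<bar>a\<^sup>2\<bar> * b \<le> 1" if "\<bar>a\<bar> * b \<le> 1" "\<bar>a\<bar> \<le> 1" "0 \<le> b" for a b :: real
  proof -
    have "\<bar>a\<^sup>2\<bar> \<le> \<bar>a\<bar>" unfolding power2_eq_square abs_mult using that(2) by (intro mult_left_le) auto
    then have "\<bar>a\<^sup>2\<bar> * b \<le> \<bar>a\<bar> * b" using that(3) by (rule mult_right_mono)
    then show ?thesis using that(1) by linarith
  qed
  show "C0 UNIV psi1" "C0 UNIV psi2" "C0 UNIV (\<lambda>r. (psi1 r)\<^sup>2)" "C0 UNIV (\<lambda>r. (psi2 r)\<^sup>2)"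
    by (auto intro!: C0_realI[where c=1] continuous_intros psi_continuous sq psi_le_1 psi_decay)
qed

definition tent :: "real \<Rightarrow> real \<Rightarrow> real" where
  "tent M r = max 0 (min 1 (M + 1 - \<bar>r\<bar>))"

lemma tent_continuous: "continuous_on UNIV (tent M)"
  unfolding tent_def[abs_def] by (intro continuous_intros)

lemma tent_bounds: "0 \<le> tent M r" "tent M r \<le> 1" "\<bar>r\<bar> \<le> M \<Longrightarrow> tent M r = 1"
  by (auto simp: tent_def)

lemma C0_mult_tent:
  assumes "continuous_on UNIV f"
  shows "C0 UNIV (\<lambda>r. f r * tent M r)"
  unfolding C0_def
proof (intro conjI allI impI)
  show "continuous_on UNIV (\<lambda>r. f r * tent M r)" by (intro continuous_intros assms tent_continuous)
  fix e :: real assume "0 < e"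
  then show "\<exists>K. compact K \<and> K \<subseteq> UNIV \<and> (\<forall>r\<in>UNIV - K. \<bar>f r * tent M r\<bar> < e)"
    by (intro exI[of _ "{- M - 1 .. M + 1}"]) (auto simp: tent_def max_def min_def)
qed

section \<open>One-point consequences of the Feller property\<close>

locale feller_mono_semigroup = mono_semigroup P for P +
  assumes feller: "feller_semigroup borel P"
begin

lemma P_prob: "prob_space (P t r)" and P_sets: "sets (P t r) = sets borel"
  by (rule mono_kernel.prob_p[OF mono_kernel] mono_kernel.sets_p[OF mono_kernel])+

lemma P_integrable:
  fixes f :: "real \<Rightarrow> real"
  assumes "f \<in> borel_measurable borel" "\<And>r. \<bar>f r\<bar> \<le> B"
  shows "integrable (P t r) f"
  using assms by (intro integrable_bounded[OF P_prob P_sets]) auto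

lemma P_C0: "0 \<le> t \<Longrightarrow> C0 UNIV f \<Longrightarrow> C0 UNIV (\<lambda>r. \<integral>u. f u \<partial>P t r)"
  using feller unfolding feller_semigroup_def kernel_apply_def[abs_def] by (simp add: space_borel)

text \<open>The Feller property speaks only of functions vanishing at infinity, while
  \<open>arctan\<close> does not vanish there. Cutting off by a tent costs at most the mass outside
  the tent, and this mass is itself continuous in the starting point, so smallness at
  \<open>r0\<close> extends to a neighbourhood.\<close>

lemma P_continuous:
  fixes f :: "real \<Rightarrow> real"
  assumes t: "0 \<le> t" and f: "continuous_on UNIV f" "\<And>r. \<bar>f r\<bar> \<le> B"
  shows "continuous_on UNIV (\<lambda>r. \<integral>u. f u \<partial>P t r)"
proof (rule continuous_at_imp_continuous_on, rule ballI)
  fix r0 :: real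
  have [measurable]: "f \<in> borel_measurable borel" "tent M \<in> borel_measurable borel" for M
    using f(1) tent_continuous by (auto intro: borel_measurable_continuous_onI)
  have B: "0 \<le> B" by (rule order_trans[OF abs_ge_zero f(2)])
  define F where "F g r = (\<integral>u. g u \<partial>P t r)" for g :: "real \<Rightarrow> real" and r
  have F_cont: "(F (\<lambda>r. g r * tent M r) \<longlongrightarrow> F (\<lambda>r. g r * tent M r) r0) (at r0)" if "continuous_on UNIV g" for g M
  proof -
    have "continuous_on UNIV (F (\<lambda>r. g r * tent M r))"
      using P_C0[OF t C0_mult_tent[OF that, of M]] unfolding C0_def F_def by blast
    then have "isCont (F (\<lambda>r. g r * tent M r)) r0"
      by (simp only: continuous_on_eq_continuous_at[OF open_UNIV] UNIV_I ball_UNIV)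
    then show ?thesis by (simp only: isCont_def)
  qed
  have tent_lim: "(\<lambda>m. F (tent (real m)) r0) \<longlonglongrightarrow> 1"
  proof -
    interpret prob_space "P t r0" by (rule P_prob)
    have "(\<lambda>m. \<integral>u. tent (real m) u \<partial>P t r0) \<longlonglongrightarrow> (\<integral>u. 1 \<partial>P t r0)"
    proof (rule integral_dominated_convergence[where w="\<lambda>_. 1"])
      show "AE u in P t r0. (\<lambda>m. tent (real m) u) \<longlonglongrightarrow> 1"
      proof (rule AE_I2)
        fix u
        obtain m where "\<bar>u\<bar> \<le> real m" using real_arch_simple by blast
        then have "\<forall>k\<ge>m. tent (real k) u = 1" by (intro allI impI tent_bounds) (auto intro: order_trans)
        then show "(\<lambda>m. tent (real m) u) \<longlonglongrightarrow> 1"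
          by (intro tendsto_eventually) (auto simp: eventually_sequentially)
      qed
    qed (use tent_bounds in \<open>auto simp: measurable_cong_sets[OF P_sets refl]\<close>)
    then show ?thesis by (simp add: F_def prob_space)
  qed
  have "(F f \<longlongrightarrow> F f r0) (at r0)"
  proof (rule tendstoI)
    fix e :: real assume e: "0 < e"
    \<comment> \<open>Two cut-off errors of at most \<open>B * d \<le> e / 4\<close> each join an
      error below \<open>e / 2\<close>; \<open>B + 1\<close> avoids division by zero.\<close>
    define d where "d = e / (4 * (B + 1))"
    have d: "0 < d" using e B by (simp add: d_def)
    obtain m where m: "1 - d < F (tent (real m)) r0"
      using order_tendstoD(1)[OF tent_lim, of "1 - d"] d by (auto simp: eventually_sequentially)
    define h where "h = tent (real m)"
    have h: "0 \<le> h u" "h u \<le> 1" for u by (auto simp: h_def tent_bounds)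
    have [measurable]: "h \<in> borel_measurable borel" by (simp add: h_def)
    have tail: "\<bar>F f r - F (\<lambda>u. f u * h u) r\<bar> \<le> B * (1 - F h r)" for r
    proof -
      interpret prob_space "P t r" by (rule P_prob)
      have i1: "integrable (P t r) f" by (rule P_integrable[of _ B]) (auto simp: f)
      have i2: "integrable (P t r) (\<lambda>u. f u * h u)"
      proof (rule P_integrable[of _ "B * 1"])
        show "\<bar>f u * h u\<bar> \<le> B * 1" for u
          unfolding abs_mult by (rule mult_mono) (use f(2) h B in auto)
      qed measurable
      have i3: "integrable (P t r) h" using h by (intro P_integrable[of _ 1]) auto
      have "\<bar>F f r - F (\<lambda>u. f u * h u) r\<bar> = \<bar>\<integral>u. f u - f u * h u \<partial>P t r\<bar>" by (simp add: F_def i1 i2)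
      also have "\<dots> \<le> (\<integral>u. \<bar>f u - f u * h u\<bar> \<partial>P t r)" by (rule integral_abs_bound)
      also have "\<dots> \<le> (\<integral>u. B * (1 - h u) \<partial>P t r)"
      proof (rule integral_mono)
        fix u
        have "\<bar>f u - f u * h u\<bar> = \<bar>f u\<bar> * (1 - h u)"
          using h[of u] by (metis abs_mult abs_of_nonneg diff_ge_0_iff_ge mult.right_neutral right_diff_distrib)
        also have "\<dots> \<le> B * (1 - h u)" using f(2) h by (intro mult_right_mono) auto
        finally show "\<bar>f u - f u * h u\<bar> \<le> B * (1 - h u)" .
      qed (use i1 i2 i3 in auto)
      also have "\<dots> = B * (1 - F h r)" by (simp add: F_def i3 prob_space)
      finally show ?thesis .
    qed
    have "(F (\<lambda>r. 1 * tent (real m) r) \<longlongrightarrow> F (\<lambda>r. 1 * tent (real m) r) r0) (at r0)"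
      by (rule F_cont) (rule continuous_on_const)
    then have "(F h \<longlongrightarrow> F h r0) (at r0)" by (simp add: h_def)
    then have "\<forall>\<^sub>F r in at r0. 1 - d < F h r" using m by (intro order_tendstoD) (auto simp: h_def)
    moreover have "\<forall>\<^sub>F r in at r0. dist (F (\<lambda>u. f u * h u) r) (F (\<lambda>u. f u * h u) r0) < e / 2"
      using F_cont[OF f(1), of "real m"] e by (intro tendstoD) (auto simp: h_def)
    ultimately show "\<forall>\<^sub>F r in at r0. dist (F f r) (F f r0) < e"
    proof eventually_elim
      case (elim r)
      have "B * (1 - F h r) \<le> B * d" "B * (1 - F h r0) \<le> B * d"
        using elim(1) m B by (auto intro!: mult_left_mono simp: h_def)
      moreover have "B * d \<le> e / 4" using e B by (simp add: d_def field_simps)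
      ultimately show ?case using tail[of r] tail[of r0] elim(2) unfolding dist_real_def by linarith
    qed
  qed
  then show "isCont (\<lambda>r. \<integral>u. f u \<partial>P t r) r0" unfolding isCont_def F_def[abs_def] .
qed

text \<open>Expanding the square leaves only the means of \<open>f\<close> and of its square, both
  uniformly close to their starting values; this is why the squares must vanish at infinity as
  well.\<close>

lemma P_small_time:
  assumes f: "C0 UNIV f" "C0 UNIV (\<lambda>r. (f r)\<^sup>2)" "\<And>r. \<bar>f r\<bar> \<le> 1" and e: "0 < e"
  shows "\<exists>d>0. \<forall>t. 0 < t \<and> t < d \<longrightarrow> (\<forall>r. (\<integral>u. (f u - f r)\<^sup>2 \<partial>P t r) \<le> e)"
proof -
  have ex: "\<exists>d>0. \<forall>t. 0 < t \<and> t < d \<longrightarrow> (\<forall>r. \<bar>(\<integral>u. g u \<partial>P t r) - g r\<bar> \<le> a)"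
    if "C0 UNIV g" "0 < a" for g a
    using feller that unfolding feller_semigroup_def kernel_apply_def by (simp add: space_borel)
  obtain d1 where d1: "0 < d1" "\<And>t r. 0 < t \<Longrightarrow> t < d1 \<Longrightarrow> \<bar>(\<integral>u. f u \<partial>P t r) - f r\<bar> \<le> e / 3"
    using ex[OF f(1), of "e / 3"] e by auto
  obtain d2 where d2: "0 < d2" "\<And>t r. 0 < t \<Longrightarrow> t < d2 \<Longrightarrow> \<bar>(\<integral>u. (f u)\<^sup>2 \<partial>P t r) - (f r)\<^sup>2\<bar> \<le> e / 3"
    using ex[OF f(2), of "e / 3"] e by auto
  have [measurable]: "f \<in> borel_measurable borel"
    using f(1) by (auto simp: C0_def intro: borel_measurable_continuous_onI)
  have "(\<integral>u. (f u - f r)\<^sup>2 \<partial>P t r) \<le> e" if t: "0 < t" "t < min d1 d2" for t r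
  proof -
    interpret prob_space "P t r" by (rule P_prob)
    have i1: "integrable (P t r) f" by (rule P_integrable[of _ 1]) (auto simp: f)
    have i2: "integrable (P t r) (\<lambda>u. (f u)\<^sup>2)"
      using f(3) by (intro P_integrable[of _ 1]) (auto simp: abs_square_le_1)
    have "(\<integral>u. (f u - f r)\<^sup>2 \<partial>P t r) = (\<integral>u. (f u)\<^sup>2 - 2 * f r * f u + (f r)\<^sup>2 \<partial>P t r)"
      by (intro Bochner_Integration.integral_cong) (auto simp: power2_eq_square algebra_simps)
    also have "\<dots> = (\<integral>u. (f u)\<^sup>2 \<partial>P t r) - 2 * f r * (\<integral>u. f u \<partial>P t r) + (f r)\<^sup>2"
      by (simp add: i1 i2 prob_space)
    also have "\<dots> = ((\<integral>u. (f u)\<^sup>2 \<partial>P t r) - (f r)\<^sup>2) - 2 * f r * ((\<integral>u. f u \<partial>P t r) - f r)"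
      by (simp add: power2_eq_square algebra_simps)
    also have "\<dots> \<le> e / 3 + 2 * (e / 3)"
    proof -
      have "\<bar>f r * ((\<integral>u. f u \<partial>P t r) - f r)\<bar> \<le> 1 * (e / 3)"
        unfolding abs_mult using d1(2)[of t r] t f(3)[of r] by (intro mult_mono) auto
      moreover have "\<bar>(\<integral>u. (f u)\<^sup>2 \<partial>P t r) - (f r)\<^sup>2\<bar> \<le> e / 3" using d2(2)[of t r] t by simp
      ultimately show ?thesis unfolding mult.assoc by linarith
    qed
    finally show ?thesis by simp
  qed
  then show ?thesis using d1(1) d2(1) by (intro exI[of _ "min d1 d2"]) auto
qed

end

section \<open>Functions vanishing at infinity on \<open>Rn n\<close>\<close>

lemma space_Rn: "space (Rn n) = PiE {..<n} (\<lambda>_. UNIV)"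
  by (simp add: space_PiM)

lemma restrict_in_Rn [simp]: "restrict y {..<n} \<in> space (Rn n)"
  by (simp add: space_Rn)

lemma restrict_Rn: "x \<in> space (Rn n) \<Longrightarrow> restrict x {..<n} = x"
  by (simp add: space_Rn PiE_restrict)

text \<open>Outside the first \<open>n\<close> indices an extensional function is fixed at
  \<open>undefined\<close>, so the cube is a product of compact sets over all indices and
  Tychonoff's theorem applies.\<close>

lemma compact_cube: "compact (PiE {..<n::nat} (\<lambda>_. {-M..M::real}))"
proof -
  define S :: "nat \<Rightarrow> real set" where "S i = (if i < n then {-M..M} else {undefined})" for i
  have "y \<in> PiE {..<n} (\<lambda>_. {-M..M}) \<longleftrightarrow> y \<in> PiE UNIV S" for y
  proof -
    have "y \<in> PiE {..<n} (\<lambda>_. {-M..M}) \<longleftrightarrow> (\<forall>i. if i < n then y i \<in> {-M..M} else y i = undefined)"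
      unfolding PiE_iff extensional_def by auto
    also have "\<dots> \<longleftrightarrow> y \<in> PiE UNIV S"
      unfolding PiE_iff extensional_def S_def by (simp del: atLeastAtMost_iff)
    finally show ?thesis .
  qed
  then have eq: "PiE {..<n} (\<lambda>_. {-M..M}) = PiE UNIV S" by blast
  have "compact (S i)" for i by (simp add: S_def)
  then have "compactin (product_topology (\<lambda>_. euclidean) UNIV) (PiE UNIV S)"
    unfolding compactin_PiE compactin_euclidean_iff by blast
  then show ?thesis
    unfolding eq by (simp only: euclidean_product_topology compactin_euclidean_iff)
qed

lemma in_cubeI:
  assumes "x \<in> space (Rn n)" "\<And>i. i < n \<Longrightarrow> \<bar>x i\<bar> \<le> M"
  shows "x \<in> PiE {..<n} (\<lambda>_. {-M..M})"
proof -
  have "x i \<in> {-M..M}" if "i < n" for i using assms(2)[OF that] by (simp add: abs_le_iff)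
  then show ?thesis using assms(1) by (simp add: space_Rn PiE_iff)
qed

lemma continuous_restrict: "continuous_on UNIV (\<lambda>y::nat \<Rightarrow> real. restrict y {..<n})" for n :: nat
proof (rule continuous_on_coordinatewise_then_product)
  fix i
  show "continuous_on UNIV (\<lambda>y::nat \<Rightarrow> real. restrict y {..<n} i)"
    by (cases "i < n") (simp_all add: continuous_on_product_coordinates)
qed

text \<open>The metric is that of the full sequence space. It is at most twice a maximum over
  finitely many coordinate distances plus a tail \<open>(1/2) ^ N\<close>, whence
  \<open>e / 4\<close> and \<open>e / 2\<close>; coordinates from \<open>n\<close> on
  coincide.\<close>

lemma dist_Rn_small:
  fixes e :: real assumes e: "0 < e"
  shows "\<exists>d>0. \<forall>x y. x \<in> space (Rn n) \<and> y \<in> space (Rn n) \<and> (\<forall>i<n. \<bar>x i - y i\<bar> < d) \<longrightarrow> dist x y < e"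
proof -
  obtain N where N: "(1/2::real) ^ N < e / 2"
    using real_arch_pow_inv[of "e/2" "1/2"] e by auto
  have "dist x y < e" if xy: "x \<in> space (Rn n)" "y \<in> space (Rn n)" "\<forall>i<n. \<bar>x i - y i\<bar> < e / 4" for x y
  proof -
    have "dist (x i) (y i) \<le> e / 4" for i
      using xy e by (cases "i < n") (auto simp: space_Rn PiE_iff extensional_def dist_real_def intro: less_imp_le)
    then have "Max {dist (x (from_nat n)) (y (from_nat n)) |n. n \<le> N} \<le> e / 4"
      by (subst Max_le_iff) auto
    then show ?thesis
      using dist_fun_le_dist_first_terms[of x y N] N by linarith
  qed
  then show ?thesis using e by (intro exI[of _ "e / 4"]) auto
qed

context
  fixes n :: nat and f :: "(nat \<Rightarrow> real) \<Rightarrow> real"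
  assumes f: "C0 (space (Rn n)) f"
begin

lemma C0_Rn_decay:
  assumes e: "0 < e"
  shows "\<exists>M\<ge>0. \<forall>x\<in>space (Rn n). (\<exists>i<n. M < \<bar>x i\<bar>) \<longrightarrow> \<bar>f x\<bar> < e"
proof -
  obtain K where K: "compact K" "K \<subseteq> space (Rn n)" "\<forall>x\<in>space (Rn n) - K. \<bar>f x\<bar> < e"
    using f e unfolding C0_def by blast
  have "continuous_on K (\<lambda>x. \<Sum>i<n. \<bar>x i\<bar>)"
    by (intro continuous_intros continuous_on_subset[OF continuous_on_product_coordinates]) auto
  then have "compact ((\<lambda>x. \<Sum>i<n. \<bar>x i\<bar>) ` K)" using K(1) by (rule compact_continuous_image)
  then have "\<exists>M. \<forall>x\<in>K. \<bar>\<Sum>i<n. \<bar>x i\<bar>\<bar> \<le> M"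
    by (auto dest!: compact_imp_bounded simp: bounded_real)
  then obtain M where M: "\<And>x. x \<in> K \<Longrightarrow> \<bar>\<Sum>i<n. \<bar>x i\<bar>\<bar> \<le> M" by blast
  have "\<bar>f x\<bar> < e" if x: "x \<in> space (Rn n)" "i < n" "max 0 M < \<bar>x i\<bar>" for x i
  proof -
    have "\<bar>x i\<bar> \<le> (\<Sum>i<n. \<bar>x i\<bar>)" using x(2) by (intro member_le_sum) auto
    then have "x \<notin> K" using M[of x] x(3) by linarith
    then show ?thesis using K(3) x(1) by blast
  qed
  then show ?thesis by (intro exI[of _ "max 0 M"]) auto
qed

lemma C0_Rn_bounded: "\<exists>B\<ge>0. \<forall>x\<in>space (Rn n). \<bar>f x\<bar> \<le> B"
proof -
  obtain M where M: "\<forall>x\<in>space (Rn n). (\<exists>i<n. M < \<bar>x i\<bar>) \<longrightarrow> \<bar>f x\<bar> < 1"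
    using C0_Rn_decay[of 1] by auto
  have "continuous_on (PiE {..<n} (\<lambda>_. {-M..M})) f"
    using f unfolding C0_def by (auto simp: space_Rn intro: continuous_on_subset)
  then have "compact (f ` PiE {..<n} (\<lambda>_. {-M..M}))" using compact_cube by (rule compact_continuous_image)
  then have "\<exists>B. \<forall>x\<in>PiE {..<n} (\<lambda>_. {-M..M}). \<bar>f x\<bar> \<le> B"
    by (auto dest!: compact_imp_bounded simp: bounded_real)
  then obtain B where B: "\<And>x. x \<in> PiE {..<n} (\<lambda>_. {-M..M}) \<Longrightarrow> \<bar>f x\<bar> \<le> B" by blast
  have "\<bar>f x\<bar> \<le> max 1 B" if x: "x \<in> space (Rn n)" for x
  proof (cases "\<exists>i<n. M < \<bar>x i\<bar>")
    case True then show ?thesis using M x by (meson less_imp_le max.coboundedI1)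
  next
    case False
    then have "x \<in> PiE {..<n} (\<lambda>_. {-M..M})" using x in_cubeI[of x n M] by (meson not_le)
    then show ?thesis using B[of x] by linarith
  qed
  then show ?thesis by (intro exI[of _ "max 1 B"]) auto
qed

text \<open>If one point lies in the cube of radius \<open>M\<close>, closeness in circle
  coordinates puts the other within radius \<open>M + 1\<close>, where uniform continuity applies.
  If neither does, both values are already below \<open>e / 2\<close>.\<close>

lemma C0_Rn_uniform:
  assumes e: "0 < e"
  shows "\<exists>d>0. \<forall>x\<in>space (Rn n). \<forall>y\<in>space (Rn n).
    (\<forall>i<n. \<bar>psi1 (x i) - psi1 (y i)\<bar> < d \<and> \<bar>psi2 (x i) - psi2 (y i)\<bar> < d) \<longrightarrow> \<bar>f x - f y\<bar> \<le> e"
proof -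
  obtain M where M: "0 \<le> M" "\<forall>x\<in>space (Rn n). (\<exists>i<n. M < \<bar>x i\<bar>) \<longrightarrow> \<bar>f x\<bar> < e / 2"
    using C0_Rn_decay[of "e / 2"] e by auto
  let ?C = "PiE {..<n} (\<lambda>_. {-(M+1)..M+1})"
  have "continuous_on ?C f"
    using f unfolding C0_def by (auto simp: space_Rn intro: continuous_on_subset)
  then have "uniformly_continuous_on ?C f" using compact_cube by (rule compact_uniformly_continuous)
  then obtain a where a: "0 < a" "\<And>x y. x \<in> ?C \<Longrightarrow> y \<in> ?C \<Longrightarrow> dist y x < a \<Longrightarrow> dist (f y) (f x) < e"
    using e by (rule uniformly_continuous_onE) blast
  obtain b where b: "0 < b"
      "\<And>x y. x \<in> space (Rn n) \<Longrightarrow> y \<in> space (Rn n) \<Longrightarrow> (\<And>i. i < n \<Longrightarrow> \<bar>x i - y i\<bar> < b) \<Longrightarrow> dist x y < a"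
    using dist_Rn_small[OF a(1)] by blast
  obtain d where d: "0 < d"
      "\<And>r s. \<bar>r\<bar> \<le> M \<Longrightarrow> \<bar>psi1 r - psi1 s\<bar> < d \<Longrightarrow> \<bar>psi2 r - psi2 s\<bar> < d \<Longrightarrow> \<bar>r - s\<bar> < min b 1"
    using psi_separate[OF M(1), of "min b 1"] b(1) by auto
  have small: "\<bar>f x - f y\<bar> \<le> e"
    if x: "x \<in> space (Rn n)" and y: "y \<in> space (Rn n)" and le: "\<forall>i<n. \<bar>x i\<bar> \<le> M"
      and xy: "\<forall>i<n. \<bar>psi1 (x i) - psi1 (y i)\<bar> < d \<and> \<bar>psi2 (x i) - psi2 (y i)\<bar> < d" for x y
  proof -
    have *: "\<bar>x i - y i\<bar> < min b 1" if "i < n" for i using that le xy by (intro d(2)) auto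
    have "\<bar>x i\<bar> \<le> M + 1 \<and> \<bar>y i\<bar> \<le> M + 1" if "i < n" for i
      using *[OF that] le[rule_format, OF that] unfolding min_less_iff_conj by linarith
    then have "x \<in> ?C" "y \<in> ?C" using in_cubeI[OF x, of "M + 1"] in_cubeI[OF y, of "M + 1"] by auto
    moreover have "dist y x < a" using b(2)[OF x y] * by (simp add: dist_commute)
    ultimately show ?thesis using a(2)[of x y] by (simp add: dist_real_def)
  qed
  have "\<bar>f x - f y\<bar> \<le> e"
    if x: "x \<in> space (Rn n)" and y: "y \<in> space (Rn n)"
      and xy: "\<forall>i<n. \<bar>psi1 (x i) - psi1 (y i)\<bar> < d \<and> \<bar>psi2 (x i) - psi2 (y i)\<bar> < d" for x y
  proof (cases "(\<forall>i<n. \<bar>x i\<bar> \<le> M) \<or> (\<forall>i<n. \<bar>y i\<bar> \<le> M)")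
    case True
    then show ?thesis
      using small[OF x y] small[OF y x] xy by (auto simp: abs_minus_commute)
  next
    case False
    then have "\<bar>f x\<bar> < e / 2" "\<bar>f y\<bar> < e / 2" using M(2) x y by (meson not_le)+
    then show ?thesis by linarith
  qed
  then show ?thesis using d(1) by blast
qed

text \<open>A modulus of continuity becomes a sum over single coordinates, whose expectation can be
  estimated from one- and two-point motions.\<close>

lemma C0_Rn_quadratic_bound:
  assumes e: "0 < e"
  shows "\<exists>c\<ge>0. \<forall>x\<in>space (Rn n). \<forall>y\<in>space (Rn n). \<bar>f x - f y\<bar> \<le>
     e + c * (\<Sum>i<n. (psi1 (x i) - psi1 (y i))\<^sup>2 + (psi2 (x i) - psi2 (y i))\<^sup>2)"
proof -
  obtain B where B: "0 \<le> B" "\<And>x. x \<in> space (Rn n) \<Longrightarrow> \<bar>f x\<bar> \<le> B" using C0_Rn_bounded by blast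
  obtain d where d: "0 < d" "\<And>x y. x \<in> space (Rn n) \<Longrightarrow> y \<in> space (Rn n) \<Longrightarrow>
    (\<forall>i<n. \<bar>psi1 (x i) - psi1 (y i)\<bar> < d \<and> \<bar>psi2 (x i) - psi2 (y i)\<bar> < d) \<Longrightarrow> \<bar>f x - f y\<bar> \<le> e"
    using C0_Rn_uniform[OF e] by blast
  \<comment> \<open>Chosen so that one increment of size \<open>d\<close> already pays for the
    largest possible oscillation \<open>2 * B\<close>.\<close>
  define c where "c = 2 * B / d\<^sup>2"
  have c: "0 \<le> c" using B d by (simp add: c_def)
  have "\<bar>f x - f y\<bar> \<le> e + c * (\<Sum>i<n. (psi1 (x i) - psi1 (y i))\<^sup>2 + (psi2 (x i) - psi2 (y i))\<^sup>2)"
    if xy: "x \<in> space (Rn n)" "y \<in> space (Rn n)" for x y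
  proof (cases "\<forall>i<n. \<bar>psi1 (x i) - psi1 (y i)\<bar> < d \<and> \<bar>psi2 (x i) - psi2 (y i)\<bar> < d")
    case True
    moreover have "0 \<le> c * (\<Sum>i<n. (psi1 (x i) - psi1 (y i))\<^sup>2 + (psi2 (x i) - psi2 (y i))\<^sup>2)"
      using c by (intro mult_nonneg_nonneg sum_nonneg) auto
    ultimately show ?thesis using d(2)[OF xy True] by linarith
  next
    case False
    then obtain i where i: "i < n" "d \<le> \<bar>psi1 (x i) - psi1 (y i)\<bar> \<or> d \<le> \<bar>psi2 (x i) - psi2 (y i)\<bar>"
      by (auto simp: not_less)
    have sq: "d\<^sup>2 \<le> u\<^sup>2" if "d \<le> \<bar>u\<bar>" for u
      using power_mono[OF that, of 2] d(1) by simp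
    have "d\<^sup>2 \<le> (psi1 (x i) - psi1 (y i))\<^sup>2 + (psi2 (x i) - psi2 (y i))\<^sup>2"
      using i(2) sq[of "psi1 (x i) - psi1 (y i)"] sq[of "psi2 (x i) - psi2 (y i)"]
        zero_le_power2[of "psi1 (x i) - psi1 (y i)"] zero_le_power2[of "psi2 (x i) - psi2 (y i)"] by linarith
    also have "\<dots> \<le> (\<Sum>i<n. (psi1 (x i) - psi1 (y i))\<^sup>2 + (psi2 (x i) - psi2 (y i))\<^sup>2)"
      using i(1) by (intro member_le_sum) auto
    finally have "c * d\<^sup>2 \<le> c * (\<Sum>i<n. (psi1 (x i) - psi1 (y i))\<^sup>2 + (psi2 (x i) - psi2 (y i))\<^sup>2)"
      using c by (rule mult_left_mono)
    moreover have "c * d\<^sup>2 = 2 * B" using d(1) by (simp add: c_def)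
    ultimately show ?thesis using B(2)[OF xy(1)] B(2)[OF xy(2)] e by linarith
  qed
  then show ?thesis using c by blast
qed

lemma C0_Rn_measurable: "(\<lambda>y. f (restrict y {..<n})) \<in> borel_measurable Rinf"
proof -
  have "continuous_on UNIV (\<lambda>y. f (restrict y {..<n}))"
    using f unfolding C0_def
    by (intro continuous_on_compose2[OF _ continuous_restrict]) auto
  then show ?thesis
    using borel_measurable_continuous_onI by (simp cong: measurable_cong_sets add: sets_PiM_equal_borel)
qed

end

lemma id_measurable_Rn_Rinf: "(\<lambda>x. x) \<in> Rn n \<rightarrow>\<^sub>M Rinf"
proof (rule measurable_PiM_single')
  fix i
  show "(\<lambda>x. x i) \<in> Rn n \<rightarrow>\<^sub>M borel"
  proof (cases "i < n")
    case False
    have "(\<lambda>x. x i) \<in> Rn n \<rightarrow>\<^sub>M borel \<longleftrightarrow> (\<lambda>x. undefined :: real) \<in> Rn n \<rightarrow>\<^sub>M borel"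
      using False by (intro measurable_cong) (auto simp: space_Rn PiE_iff extensional_def)
    then show ?thesis by simp
  qed auto
qed auto

lemma restrict_measurable_Rn: "(\<lambda>y. restrict y {..<n}) \<in> Rinf \<rightarrow>\<^sub>M Rn n"
  by (rule measurable_restrict_subset) simp

section \<open>The n-point motions\<close>

context feller_mono_semigroup
begin

text \<open>The starting point is passed to the flow as a whole sequence, with
  \<open>undefined\<close> from index \<open>n\<close> on; \<open>npoint_cong\<close> shows that
  this tail has no influence when \<open>n\<close> is positive.\<close>

definition npoint :: "nat \<Rightarrow> real \<Rightarrow> (nat \<Rightarrow> real) \<Rightarrow> (nat \<Rightarrow> real) measure" where
  "npoint n t x = distr (flow t x) (Rn n) (\<lambda>y. restrict y {..<n})"

lemma restrict_measurable_flow: "0 \<le> t \<Longrightarrow> (\<lambda>y. restrict y {..<n}) \<in> flow t x \<rightarrow>\<^sub>M Rn n"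
  using restrict_measurable_Rn by (simp add: measurable_cong_sets[OF sets_flow refl])

lemma flow_integral_coordinate:
  assumes t: "0 \<le> t" and \<phi>: "\<phi> \<in> borel_measurable borel"
  shows "(\<integral>y. \<phi> (y i) \<partial>flow t x) = (\<integral>u. \<phi> u \<partial>P t (x i) :: real)"
proof -
  have "(\<lambda>y. y i) \<in> flow t x \<rightarrow>\<^sub>M borel" by (simp add: measurable_cong_sets[OF sets_flow[OF t] refl])
  then have "(\<integral>u. \<phi> u \<partial>distr (flow t x) borel (\<lambda>y. y i)) = (\<integral>y. \<phi> (y i) \<partial>flow t x)"
    using \<phi> by (rule integral_distr)
  then show ?thesis by (simp add: flow_marginal[OF t])
qed

lemma flow_integrable:
  assumes t: "0 \<le> t" and "g \<in> borel_measurable Rinf" "\<And>y. \<bar>g y\<bar> \<le> (B::real)"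
  shows "integrable (flow t x) g"
  using assms(2,3) by (intro integrable_bounded[OF prob_flow[OF t] sets_flow[OF t]]) auto

lemma npoint_integral:
  assumes t: "0 \<le> t" and f: "C0 (space (Rn n)) f"
  shows "kernel_apply (npoint n t) f x = (\<integral>y. f (restrict y {..<n}) \<partial>flow t x)"
proof -
  have "f \<in> borel_measurable (Rn n)"
  proof -
    have "(\<lambda>x. f (restrict x {..<n})) \<in> borel_measurable (Rn n)"
      by (rule measurable_compose[OF id_measurable_Rn_Rinf C0_Rn_measurable[OF f]])
    moreover have "f \<in> borel_measurable (Rn n) \<longleftrightarrow> (\<lambda>x. f (restrict x {..<n})) \<in> borel_measurable (Rn n)"
      by (rule measurable_cong) (simp only: restrict_Rn)
    ultimately show ?thesis by simp
  qed
  then show ?thesis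
    unfolding kernel_apply_def npoint_def by (rule integral_distr[OF restrict_measurable_flow[OF t]])
qed

text \<open>Order preservation gives \<open>w i\<close> and \<open>w j\<close> the same order as
  \<open>v i\<close> and \<open>v j\<close> almost surely. The absolute value then has a constant
  sign and can be moved outside the integral, which leaves one-point means.\<close>

lemma flow_arctan_coupling:
  assumes t: "0 \<le> t"
  shows "(\<integral>w. \<bar>arctan (w i) - arctan (w j)\<bar> \<partial>flow t v) =
    \<bar>(\<integral>u. arctan u \<partial>P t (v i)) - (\<integral>u. arctan u \<partial>P t (v j))\<bar>"
proof -
  have m: "(\<lambda>w. arctan (w k)) \<in> borel_measurable Rinf" for k :: nat
    by measurable
  have at: "\<bar>arctan r\<bar> \<le> pi / 2" for r
    using arctan_bounded[of r] by (auto simp: abs_le_iff)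
  have int: "integrable (flow t v) (\<lambda>w. arctan (w k))" for k
    by (rule flow_integrable[OF t m at])
  have wlog: "(\<integral>w. \<bar>arctan (w i) - arctan (w j)\<bar> \<partial>flow t v) =
      \<bar>(\<integral>u. arctan u \<partial>P t (v i)) - (\<integral>u. arctan u \<partial>P t (v j))\<bar>" if "v j \<le> v i" for i j
  proof -
    have ae: "AE w in flow t v. \<bar>arctan (w i) - arctan (w j)\<bar> = arctan (w i) - arctan (w j)"
      using flow_order[OF t that] by eventually_elim (simp add: arctan_le_iff)
    have "(\<integral>w. \<bar>arctan (w i) - arctan (w j)\<bar> \<partial>flow t v) = (\<integral>w. arctan (w i) - arctan (w j) \<partial>flow t v)"
      using int ae by (intro integral_cong_AE) auto
    also have "\<dots> = (\<integral>u. arctan u \<partial>P t (v i)) - (\<integral>u. arctan u \<partial>P t (v j))"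
      by (simp add: int flow_integral_coordinate[OF t])
    finally have eq: "(\<integral>w. \<bar>arctan (w i) - arctan (w j)\<bar> \<partial>flow t v) =
      (\<integral>u. arctan u \<partial>P t (v i)) - (\<integral>u. arctan u \<partial>P t (v j))" .
    moreover have "0 \<le> (\<integral>w. \<bar>arctan (w i) - arctan (w j)\<bar> \<partial>flow t v)" by simp
    ultimately show ?thesis by simp
  qed
  show ?thesis
  proof (cases "v j \<le> v i")
    case False
    then show ?thesis using wlog[of i j] by (simp add: abs_minus_commute)
  qed (rule wlog)
qed

end

context feller_mono_semigroup
begin

lemma flow_integral_diff:
  assumes t: "0 \<le> t" and f: "C0 (space (Rn n)) f" and c: "0 \<le> c"
    and bound: "\<And>x y. x \<in> space (Rn n) \<Longrightarrow> y \<in> space (Rn n) \<Longrightarrow> \<bar>f x - f y\<bar> \<le>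
       e + c * (\<Sum>i<n. (psi1 (x i) - psi1 (y i))\<^sup>2 + (psi2 (x i) - psi2 (y i))\<^sup>2)"
  shows "\<bar>(\<integral>y. f (restrict y {..<n}) \<partial>flow t x) - (\<integral>z. f (restrict z {..<n}) \<partial>flow t y)\<bar> \<le>
     e + c * (\<Sum>i<n. 4 * \<bar>(\<integral>u. arctan u \<partial>P t (x i)) - (\<integral>u. arctan u \<partial>P t (y i))\<bar>)"
proof -
  define v where "v k = (if even k then x (k div 2) else y (k div 2))" for k
  define \<sigma> \<tau> :: "nat \<Rightarrow> nat" where "\<sigma> i = 2 * i" and "\<tau> i = 2 * i + 1" for i
  have v: "v \<circ> \<sigma> = x" "v \<circ> \<tau> = y" by (auto simp: v_def \<sigma>_def \<tau>_def)
  have v': "v (\<sigma> i) = x i" "v (\<tau> i) = y i" for i by (auto simp: v_def \<sigma>_def \<tau>_def)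
  interpret prob_space "flow t v" by (rule prob_flow[OF t])
  define g where "g y = f (restrict y {..<n})" for y
  have g_meas: "g \<in> borel_measurable Rinf" unfolding g_def[abs_def] by (rule C0_Rn_measurable[OF f])
  obtain B where B: "\<And>y. \<bar>g y\<bar> \<le> B" using C0_Rn_bounded[OF f] restrict_in_Rn unfolding g_def by blast
  have relabel: "(\<integral>y. g y \<partial>flow t (v \<circ> \<rho>)) = (\<integral>w. g (w \<circ> \<rho>) \<partial>flow t v)" for \<rho>
    unfolding flow_relabel[OF t, symmetric]
    by (rule integral_distr[OF _ g_meas]) (simp add: measurable_cong_sets[OF sets_flow[OF t] refl])
  have int_g: "integrable (flow t v) (\<lambda>w. g (w \<circ> \<rho>))" for \<rho>
    by (rule flow_integrable[OF t measurable_compose[OF comp_measurable_Rinf g_meas] B])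
  have at: "\<bar>arctan r\<bar> \<le> pi / 2" for r
    using arctan_bounded[of r] by (auto simp: abs_le_iff)
  have int_at: "integrable (flow t v) (\<lambda>w. arctan (w k))" for k
    by (rule flow_integrable[OF t _ at]) measurable
  \<comment> \<open>Each difference is at most 2 in absolute value, so its square is at most twice
    its absolute value; two such terms give the factor 4.\<close>
  have pt: "(psi1 a - psi1 b)\<^sup>2 + (psi2 a - psi2 b)\<^sup>2 \<le> 4 * \<bar>arctan a - arctan b\<bar>" for a b
  proof -
    have sq: "d\<^sup>2 \<le> 2 * \<bar>d\<bar>" if "\<bar>d\<bar> \<le> 2" for d :: real
      using mult_right_mono[OF that, of "\<bar>d\<bar>"] by (simp add: power2_eq_square)
    have "\<bar>psi1 a - psi1 b\<bar> \<le> 2" "\<bar>psi2 a - psi2 b\<bar> \<le> 2"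
      using psi_le_1[of a] psi_le_1[of b] by linarith+
    then show ?thesis using sq psi_arctan[of a b] by (smt (verit, best))
  qed
  have "\<bar>(\<integral>y. g y \<partial>flow t x) - (\<integral>y. g y \<partial>flow t y)\<bar> = \<bar>\<integral>w. g (w \<circ> \<sigma>) - g (w \<circ> \<tau>) \<partial>flow t v\<bar>"
    using relabel[of \<sigma>] relabel[of \<tau>] int_g by (simp only: v Bochner_Integration.integral_diff)
  also have "\<dots> \<le> (\<integral>w. \<bar>g (w \<circ> \<sigma>) - g (w \<circ> \<tau>)\<bar> \<partial>flow t v)" by (rule integral_abs_bound)
  also have "\<dots> \<le> (\<integral>w. e + c * (\<Sum>i<n. 4 * \<bar>arctan (w (\<sigma> i)) - arctan (w (\<tau> i))\<bar>) \<partial>flow t v)"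
  proof (rule integral_mono)
    show "integrable (flow t v) (\<lambda>w. \<bar>g (w \<circ> \<sigma>) - g (w \<circ> \<tau>)\<bar>)"
      by (intro integrable_abs Bochner_Integration.integrable_diff int_g)
    show "integrable (flow t v) (\<lambda>w. e + c * (\<Sum>i<n. 4 * \<bar>arctan (w (\<sigma> i)) - arctan (w (\<tau> i))\<bar>))"
      by (intro Bochner_Integration.integrable_add integrable_const integrable_mult_right
          Bochner_Integration.integrable_sum integrable_abs Bochner_Integration.integrable_diff int_at)
    fix w :: "nat \<Rightarrow> real"
    let ?a = "restrict (w \<circ> \<sigma>) {..<n}" and ?b = "restrict (w \<circ> \<tau>) {..<n}"
    have "\<bar>g (w \<circ> \<sigma>) - g (w \<circ> \<tau>)\<bar> \<le>
      e + c * (\<Sum>i<n. (psi1 (?a i) - psi1 (?b i))\<^sup>2 + (psi2 (?a i) - psi2 (?b i))\<^sup>2)"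
      unfolding g_def by (rule bound) auto
    also have "\<dots> \<le> e + c * (\<Sum>i<n. 4 * \<bar>arctan (w (\<sigma> i)) - arctan (w (\<tau> i))\<bar>)"
      using c pt by (intro add_left_mono mult_left_mono sum_mono) auto
    finally show "\<bar>g (w \<circ> \<sigma>) - g (w \<circ> \<tau>)\<bar> \<le> e + c * (\<Sum>i<n. 4 * \<bar>arctan (w (\<sigma> i)) - arctan (w (\<tau> i))\<bar>)" .
  qed
  also have "\<dots> = e + c * (\<Sum>i<n. 4 * (\<integral>w. \<bar>arctan (w (\<sigma> i)) - arctan (w (\<tau> i))\<bar> \<partial>flow t v))"
    by (simp add: int_at prob_space)
  finally show ?thesis
    by (simp add: flow_arctan_coupling[OF t] v' g_def)
qed

text \<open>The bound of \<open>flow_integral_diff\<close> is continuous in \<open>x\<close>, since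
  the one-point means of \<open>arctan\<close> are, and it equals \<open>e / 2\<close> at
  \<open>x0\<close>.\<close>

lemma npoint_continuous:
  assumes t: "0 \<le> t" and f: "C0 (space (Rn n)) f"
  shows "continuous_on UNIV (\<lambda>x. \<integral>y. f (restrict y {..<n}) \<partial>flow t x)" (is "continuous_on _ ?h")
proof (rule continuous_at_imp_continuous_on, rule ballI)
  fix x0 :: "nat \<Rightarrow> real"
  define A where "A r = (\<integral>u. arctan u \<partial>P t r)" for r
  have at: "\<bar>arctan r\<bar> \<le> pi / 2" for r
    using arctan_bounded[of r] by (auto simp: abs_le_iff)
  have "continuous_on UNIV A"
    unfolding A_def[abs_def] by (rule P_continuous[OF t _ at]) (intro continuous_intros)
  then have A: "continuous_on UNIV (\<lambda>x::nat \<Rightarrow> real. A (x i))" for i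
    by (rule continuous_on_compose2[OF _ continuous_on_product_coordinates]) auto
  have "(?h \<longlongrightarrow> ?h x0) (at x0)"
  proof (rule tendstoI)
    fix e :: real assume e: "0 < e"
    obtain c where c: "0 \<le> c" and bound: "\<And>x y. x \<in> space (Rn n) \<Longrightarrow> y \<in> space (Rn n) \<Longrightarrow> \<bar>f x - f y\<bar> \<le>
       e / 2 + c * (\<Sum>i<n. (psi1 (x i) - psi1 (y i))\<^sup>2 + (psi2 (x i) - psi2 (y i))\<^sup>2)"
      using C0_Rn_quadratic_bound[OF f, of "e / 2"] e by auto
    have "continuous_on UNIV (\<lambda>x. e / 2 + c * (\<Sum>i<n. 4 * \<bar>A (x i) - A (x0 i)\<bar>))"
      by (intro continuous_intros A)
    then have "isCont (\<lambda>x. e / 2 + c * (\<Sum>i<n. 4 * \<bar>A (x i) - A (x0 i)\<bar>)) x0"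
      by (simp only: continuous_on_eq_continuous_at[OF open_UNIV] UNIV_I ball_UNIV)
    then have "((\<lambda>x. e / 2 + c * (\<Sum>i<n. 4 * \<bar>A (x i) - A (x0 i)\<bar>)) \<longlongrightarrow> e / 2) (at x0)"
      by (simp add: isCont_def)
    then have "\<forall>\<^sub>F x in at x0. e / 2 + c * (\<Sum>i<n. 4 * \<bar>A (x i) - A (x0 i)\<bar>) < e"
      by (rule order_tendstoD(2)) (use e in simp)
    then show "\<forall>\<^sub>F x in at x0. dist (?h x) (?h x0) < e"
    proof eventually_elim
      case (elim x)
      then show ?case
        using flow_integral_diff[OF t f c bound, of x x0] unfolding A_def dist_real_def by linarith
    qed
  qed
  then show "isCont ?h x0" unfolding isCont_def .
qed

text \<open>If one coordinate of the start is far out, the one-point Feller property applied to a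
  tent makes it unlikely that this coordinate ends within radius \<open>M\<close>; outside that
  radius \<open>f\<close> is below \<open>e / 2\<close> whatever the other coordinates do.\<close>

lemma npoint_C0:
  assumes t: "0 \<le> t" and f: "C0 (space (Rn n)) f"
  shows "C0 (space (Rn n)) (kernel_apply (npoint n t) f)"
  unfolding C0_def
proof (intro conjI allI impI)
  have ka: "kernel_apply (npoint n t) f = (\<lambda>x. \<integral>y. f (restrict y {..<n}) \<partial>flow t x)"
    by (rule ext) (rule npoint_integral[OF t f])
  show "continuous_on (space (Rn n)) (kernel_apply (npoint n t) f)"
    unfolding ka by (rule continuous_on_subset[OF npoint_continuous[OF t f]]) simp
  fix e :: real assume e: "0 < e"
  obtain B where B: "0 \<le> B" "\<And>y. \<bar>f (restrict y {..<n})\<bar> \<le> B" using C0_Rn_bounded[OF f] restrict_in_Rn by blast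
  obtain M where M: "\<And>x. x \<in> space (Rn n) \<Longrightarrow> (\<exists>i<n. M < \<bar>x i\<bar>) \<Longrightarrow> \<bar>f x\<bar> < e / 2"
    using C0_Rn_decay[OF f, of "e / 2"] e by auto
  have tb: "\<bar>tent M r\<bar> \<le> 1" for r using tent_bounds[of M r] by simp
  have tm [measurable]: "tent M \<in> borel_measurable borel"
    by (rule borel_measurable_continuous_onI[OF tent_continuous])
  have "C0 UNIV (\<lambda>r. 1 * tent M r)" by (rule C0_mult_tent) (rule continuous_on_const)
  then have C0_tent: "C0 UNIV (\<lambda>r. \<integral>u. tent M u \<partial>P t r)" by (intro P_C0[OF t]) simp
  have "0 < e / (2 * (B + 1))" using e B by simp
  from C0_tent[unfolded C0_def, THEN conjunct2, rule_format, OF this]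
  obtain K where K: "compact K" "\<forall>r\<in>UNIV - K. \<bar>\<integral>u. tent M u \<partial>P t r\<bar> < e / (2 * (B + 1))"
    by (elim exE conjE)
  obtain L where L: "\<forall>r\<in>K. \<bar>r\<bar> \<le> L"
    using compact_imp_bounded[OF K(1)] unfolding bounded_real by (elim exE)
  have "\<bar>kernel_apply (npoint n t) f x\<bar> < e" if x: "x \<in> space (Rn n) - PiE {..<n} (\<lambda>_. {-L..L})" for x
  proof -
    obtain i where i: "i < n" "L < \<bar>x i\<bar>" using x in_cubeI[of x n L] by (meson DiffD1 DiffD2 not_le)
    interpret prob_space "flow t x" by (rule prob_flow[OF t])
    have int_f: "integrable (flow t x) (\<lambda>y. f (restrict y {..<n}))"
      by (rule flow_integrable[OF t C0_Rn_measurable[OF f] B(2)])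
    have int_t: "integrable (flow t x) (\<lambda>y. tent M (y i))"
      by (rule flow_integrable[OF t _ tb]) measurable
    have pt: "\<bar>f (restrict y {..<n})\<bar> \<le> e / 2 + B * tent M (y i)" for y
    proof (cases "M < \<bar>y i\<bar>")
      case True
      then have "\<bar>f (restrict y {..<n})\<bar> < e / 2" using i by (intro M) auto
      moreover have "0 \<le> B * tent M (y i)" using B tent_bounds by simp
      ultimately show ?thesis by linarith
    next
      case False
      then show ?thesis using B(2)[of y] tent_bounds(3)[of "y i" M] e by simp
    qed
    have "\<bar>kernel_apply (npoint n t) f x\<bar> \<le> (\<integral>y. \<bar>f (restrict y {..<n})\<bar> \<partial>flow t x)"
      unfolding ka by (rule integral_abs_bound)
    also have "\<dots> \<le> (\<integral>y. e / 2 + B * tent M (y i) \<partial>flow t x)"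
      by (rule integral_mono) (use int_f int_t pt in auto)
    also have "\<dots> = e / 2 + B * (\<integral>u. tent M u \<partial>P t (x i))"
      using flow_integral_coordinate[OF t tm, where i=i and x=x] by (simp add: int_t prob_space)
    also have "\<dots> < e"
    proof -
      have "x i \<notin> K" using L i by force
      then have "\<bar>\<integral>u. tent M u \<partial>P t (x i)\<bar> < e / (2 * (B + 1))" using K(2) by simp
      then have "B * (\<integral>u. tent M u \<partial>P t (x i)) \<le> B * (e / (2 * (B + 1)))"
        using B by (intro mult_left_mono) auto
      also have "\<dots> < e / 2" using B e by (simp add: field_simps)
      finally show ?thesis by simp
    qed
    finally show ?thesis .
  qed
  moreover have "PiE {..<n} (\<lambda>_. {-L..L}) \<subseteq> space (Rn n)" by (auto simp: space_Rn PiE_iff)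
  ultimately show "\<exists>K. compact K \<and> K \<subseteq> space (Rn n) \<and> (\<forall>x\<in>space (Rn n) - K. \<bar>kernel_apply (npoint n t) f x\<bar> < e)"
    using compact_cube[of n L] by blast
qed

text \<open>The displacement is bounded by sums of one-point second moments in circle coordinates,
  which are small uniformly in the start; no information on the coupling enters.\<close>

lemma npoint_small_time:
  assumes f: "C0 (space (Rn n)) f" and e: "0 < e"
  shows "\<exists>d>0. \<forall>t. 0 < t \<and> t < d \<longrightarrow> (\<forall>x\<in>space (Rn n). \<bar>kernel_apply (npoint n t) f x - f x\<bar> \<le> e)"
proof -
  obtain c where c: "0 \<le> c" and bound: "\<And>x y. x \<in> space (Rn n) \<Longrightarrow> y \<in> space (Rn n) \<Longrightarrow> \<bar>f x - f y\<bar> \<le>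
     e / 2 + c * (\<Sum>i<n. (psi1 (x i) - psi1 (y i))\<^sup>2 + (psi2 (x i) - psi2 (y i))\<^sup>2)"
    using C0_Rn_quadratic_bound[OF f, of "e / 2"] e by auto
  \<comment> \<open>There are \<open>n\<close> coordinates with two moments of size at most
    \<open>a\<close>, so the error is at most \<open>2 * a * k = e / 2\<close>; the added ones keep
    \<open>k\<close> positive.\<close>
  define k where "k = (c + 1) * (real n + 1)"
  have k: "0 < k" using c by (simp add: k_def)
  define a where "a = e / (4 * k)"
  have a: "0 < a" using e k by (simp add: a_def)
  obtain d1 where d1: "0 < d1" "\<And>t r. 0 < t \<Longrightarrow> t < d1 \<Longrightarrow> (\<integral>u. (psi1 u - psi1 r)\<^sup>2 \<partial>P t r) \<le> a"
    using P_small_time[OF C0_psi(1) C0_psi(3) psi_le_1(1) a] by blast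
  obtain d2 where d2: "0 < d2" "\<And>t r. 0 < t \<Longrightarrow> t < d2 \<Longrightarrow> (\<integral>u. (psi2 u - psi2 r)\<^sup>2 \<partial>P t r) \<le> a"
    using P_small_time[OF C0_psi(2) C0_psi(4) psi_le_1(2) a] by blast
  have "\<bar>kernel_apply (npoint n t) f x - f x\<bar> \<le> e"
    if t: "0 < t" "t < min d1 d2" and x: "x \<in> space (Rn n)" for t x
  proof -
    have t0: "0 \<le> t" using t by simp
    interpret prob_space "flow t x" by (rule prob_flow[OF t0])
    define g where "g y = f (restrict y {..<n})" for y
    have g_meas: "g \<in> borel_measurable Rinf" unfolding g_def[abs_def] by (rule C0_Rn_measurable[OF f])
    obtain B where B: "\<And>y. \<bar>g y\<bar> \<le> B" using C0_Rn_bounded[OF f] restrict_in_Rn unfolding g_def by blast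
    have int_g: "integrable (flow t x) g" by (rule flow_integrable[OF t0 g_meas B])
    have sq: "\<bar>(p - q)\<^sup>2\<bar> \<le> 2\<^sup>2" if "\<bar>p\<bar> \<le> 1" "\<bar>q\<bar> \<le> 1" for p q :: real
    proof -
      have "\<bar>p - q\<bar> \<le> 2" using that by linarith
      then have "\<bar>p - q\<bar>\<^sup>2 \<le> 2\<^sup>2" by (intro power_mono) auto
      then show ?thesis by simp
    qed
    have int1: "integrable (flow t x) (\<lambda>y. (psi1 (y i) - psi1 (x i))\<^sup>2)"
      and int2: "integrable (flow t x) (\<lambda>y. (psi2 (y i) - psi2 (x i))\<^sup>2)" for i
      by (rule flow_integrable[OF t0 _ sq[OF psi_le_1(1) psi_le_1(1)]], measurable)
         (rule flow_integrable[OF t0 _ sq[OF psi_le_1(2) psi_le_1(2)]], measurable)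
    have "(\<integral>y. g y - f x \<partial>flow t x) = (\<integral>y. g y \<partial>flow t x) - f x"
      using int_g by (simp add: prob_space)
    then have "\<bar>kernel_apply (npoint n t) f x - f x\<bar> = \<bar>\<integral>y. g y - f x \<partial>flow t x\<bar>"
      by (simp only: npoint_integral[OF t0 f] g_def)
    also have "\<dots> \<le> (\<integral>y. \<bar>g y - f x\<bar> \<partial>flow t x)" by (rule integral_abs_bound)
    also have "\<dots> \<le> (\<integral>y. e / 2 + c * (\<Sum>i<n. (psi1 (y i) - psi1 (x i))\<^sup>2 + (psi2 (y i) - psi2 (x i))\<^sup>2) \<partial>flow t x)"
    proof (rule integral_mono)
      show "\<bar>g y - f x\<bar> \<le> e / 2 + c * (\<Sum>i<n. (psi1 (y i) - psi1 (x i))\<^sup>2 + (psi2 (y i) - psi2 (x i))\<^sup>2)" for y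
        using bound[OF restrict_in_Rn x, of y] by (simp add: g_def)
    qed (use int_g int1 int2 in auto)
    also have "\<dots> = e / 2 + c * (\<Sum>i<n. (\<integral>u. (psi1 u - psi1 (x i))\<^sup>2 \<partial>P t (x i)) + (\<integral>u. (psi2 u - psi2 (x i))\<^sup>2 \<partial>P t (x i)))"
      using flow_integral_coordinate[OF t0, of "\<lambda>u. (psi1 u - psi1 (x _))\<^sup>2"]
        flow_integral_coordinate[OF t0, of "\<lambda>u. (psi2 u - psi2 (x _))\<^sup>2"]
      by (simp add: int1 int2 prob_space)
    also have "\<dots> \<le> e / 2 + c * (\<Sum>i<n. a + a)"
      using d1(2)[of t] d2(2)[of t] t c by (intro add_left_mono mult_left_mono sum_mono add_mono) auto
    also have "\<dots> \<le> e"
    proof -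
      have "c * (\<Sum>i<n. a + a) = 2 * a * (c * real n)" by simp
      also have "\<dots> \<le> 2 * a * k"
        unfolding k_def using a c by (intro mult_left_mono mult_mono) auto
      also have "\<dots> = e / 2" using k by (simp add: a_def)
      finally show ?thesis by simp
    qed
    finally show ?thesis .
  qed
  then show ?thesis using d1(1) d2(1) by (intro exI[of _ "min d1 d2"]) auto
qed

lemma npoint_relabel:
  assumes t: "0 \<le> t"
  shows "npoint k t (x \<circ> \<sigma>) = distr (flow t x) (Rn k) (\<lambda>y. restrict (y \<circ> \<sigma>) {..<k})"
  unfolding npoint_def flow_relabel[OF t, symmetric]
  by (subst distr_distr[OF restrict_measurable_Rn])
     (auto simp: measurable_cong_sets[OF sets_flow[OF t] refl] comp_def intro!: comp_measurable_Rinf[unfolded comp_def])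

text \<open>Relabelling by a map that fixes the indices below \<open>n\<close> and sends all others
  to 0 leaves the projected law unchanged and erases the tail of the start; \<open>1 \<le> n\<close>
  makes index 0 one of those where \<open>x\<close> and \<open>y\<close> agree.\<close>

lemma npoint_cong:
  assumes t: "0 \<le> t" and n: "1 \<le> n" and eq: "\<And>i. i < n \<Longrightarrow> x i = y i"
  shows "npoint n t x = npoint n t y"
proof -
  define \<rho> where "\<rho> j = (if j < n then j else 0)" for j
  have "npoint n t z = npoint n t (z \<circ> \<rho>)" for z
    unfolding npoint_relabel[OF t] unfolding npoint_def
    by (intro arg_cong[where f="distr _ _"] ext) (simp add: \<rho>_def restrict_def)
  moreover have "x \<circ> \<rho> = y \<circ> \<rho>" using n eq by (auto simp: \<rho>_def)
  ultimately show ?thesis by metis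
qed

lemma npoint_kernel:
  assumes t: "0 \<le> t" shows "npoint n t \<in> Rn n \<rightarrow>\<^sub>M prob_algebra (Rn n)"
proof -
  have "(\<lambda>x. flow t x) \<in> Rn n \<rightarrow>\<^sub>M prob_algebra Rinf"
    by (rule measurable_compose[OF id_measurable_Rn_Rinf flow_kernel[OF t]])
  then show ?thesis
    unfolding npoint_def[abs_def]
    by (rule measurable_compose[OF _ measurable_distr_prob_space[OF restrict_measurable_Rn]])
qed

lemma npoint_zero:
  assumes x: "x \<in> space (Rn n)" shows "npoint n 0 x = return (Rn n) x"
  unfolding npoint_def flow_zero using restrict_Rn[OF x] by (simp add: distr_return[OF restrict_measurable_Rn])

text \<open>Projecting at the intermediate time replaces the tail of the sequence by
  \<open>undefined\<close>; by \<open>npoint_cong\<close> this does not affect the second stage, so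
  the semigroup property of the flow descends.\<close>

lemma npoint_add:
  assumes s: "0 \<le> s" and t: "0 \<le> t" and n: "1 \<le> n"
  shows "npoint n (s + t) x = npoint n s x \<bind> npoint n t"
proof -
  have "npoint n s x \<bind> npoint n t = flow s x \<bind> (\<lambda>y. npoint n t (restrict y {..<n}))"
    unfolding npoint_def[of n s]
    by (rule bind_distr[OF restrict_measurable_flow[OF s] measurable_prob_algebraD[OF npoint_kernel[OF t]]])
       (rule prob_space.not_empty[OF prob_flow[OF s]])
  also have "(\<lambda>y. npoint n t (restrict y {..<n})) = (\<lambda>y. distr (flow t y) (Rn n) (\<lambda>y. restrict y {..<n}))"
  proof
    fix y
    have "npoint n t (restrict y {..<n}) = npoint n t y" by (rule npoint_cong[OF t n]) simp
    then show "npoint n t (restrict y {..<n}) = distr (flow t y) (Rn n) (\<lambda>y. restrict y {..<n})"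
      by (simp only: npoint_def)
  qed
  also have "flow s x \<bind> \<dots> = distr (flow s x \<bind> flow t) (Rn n) (\<lambda>y. restrict y {..<n})"
  proof (rule distr_bind[OF _ _ restrict_measurable_Rn, symmetric])
    show "flow t \<in> flow s x \<rightarrow>\<^sub>M subprob_algebra Rinf"
      using measurable_prob_algebraD[OF flow_kernel[OF t]] by (simp add: measurable_cong_sets[OF sets_flow[OF s] refl])
  qed (rule prob_space.not_empty[OF prob_flow[OF s]])
  finally show ?thesis unfolding npoint_def[of n "s + t"] flow_add[OF s t] by (rule sym)
qed

lemma feller_npoint:
  assumes n: "1 \<le> n" shows "feller_semigroup (Rn n) (npoint n)"
  unfolding feller_semigroup_def markov_semigroup_def markov_kernel_def
  by (intro conjI allI impI ballI npoint_kernel npoint_zero npoint_add[OF _ _ n] npoint_C0 npoint_small_time; assumption)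

lemma npoint_measure:
  assumes t: "0 \<le> t" and B: "B \<in> sets (Rn n)"
  shows "measure (npoint n t x) B = measure (flow t x) {y. restrict y {..<n} \<in> B}"
  unfolding npoint_def measure_distr[OF restrict_measurable_flow[OF t] B]
  using sets_eq_imp_space_eq[OF sets_flow[OF t]] by (simp add: vimage_def)

lemma npoint_order_preserving:
  assumes t: "0 \<le> t" shows "order_preserving n (npoint n t)"
  unfolding order_preserving_def
proof
  fix x assume "x \<in> space (Rn n)"
  interpret prob_space "flow t x" by (rule prob_flow[OF t])
  have "{y \<in> space (Rn n). x i \<le> x j \<longrightarrow> y i \<le> y j} \<in> sets (Rn n)"
    if "i \<in> {..<n}" "j \<in> {..<n}" for i j
  proof (cases "x i \<le> x j")
    case True
    have "{y \<in> space (Rn n). y i \<le> y j} \<in> sets (Rn n)"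
      using that by (intro borel_measurable_le measurable_component_singleton)
    then show ?thesis using True by simp
  qed simp
  then have "{y \<in> space (Rn n). \<forall>i\<in>{..<n}. \<forall>j\<in>{..<n}. x i \<le> x j \<longrightarrow> y i \<le> y j} \<in> sets (Rn n)"
    by (intro sets.sets_Collect_finite_All finite_lessThan)
  then have cone: "ord_cone n x \<in> sets (Rn n)" 
    unfolding ord_cone_def Ball_def lessThan_iff .
  have "AE y in flow t x. \<forall>i j. x i \<le> x j \<longrightarrow> y i \<le> y j"
    unfolding AE_all_countable by (intro allI AE_impI flow_order[OF t])
  then have "AE y in flow t x. restrict y {..<n} \<in> ord_cone n x"
    by eventually_elim (simp add: ord_cone_def)
  then have "AE y in npoint n t x. y \<in> ord_cone n x"
    unfolding npoint_def using cone by (subst AE_distr_iff[OF restrict_measurable_flow[OF t]]) auto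
  then show "measure (npoint n t x) (ord_cone n x) = 1"
    using cone prob_space.prob_eq_1[OF kernel_prob[OF npoint_kernel[OF t] \<open>x \<in> space (Rn n)\<close>]]
      kernel_sets[OF npoint_kernel[OF t] \<open>x \<in> space (Rn n)\<close>] by simp
qed

lemma proj_measurable:
  assumes "set js \<subseteq> {..<n}" shows "proj js \<in> Rn n \<rightarrow>\<^sub>M Rn (length js)"
  unfolding proj_def[abs_def]
  using assms by (intro measurable_restrict measurable_component_singleton) (auto dest: nth_mem)

lemma npoint_consistent:
  assumes t: "0 \<le> t" shows "consistent (\<lambda>n. npoint n t)"
  unfolding consistent_def markov_kernel_def
proof (intro conjI allI impI ballI)
  fix n k :: nat and js x B
  assume kn: "1 \<le> k \<and> k \<le> n" and jsk: "length js = k \<and> set js \<subseteq> {..<n}"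
    and x: "x \<in> space (Rn n)" and B: "B \<in> sets (Rn k)"
  \<comment> \<open>The list is extended to a map on all indices. The default 0 is immaterial, as
    only the first \<open>k\<close> coordinates are read afterwards.\<close>
  define \<sigma> where "\<sigma> j = (if j < k then js ! j else 0)" for j
  have \<sigma>: "\<sigma> j < n" if "j < k" for j 
  proof -
    have "js ! j \<in> {..<n}" using that jsk nth_mem[of j js] by blast
    then show ?thesis using that by (simp add: \<sigma>_def)
  qed
  have pr: "proj js (restrict y {..<n}) = restrict (y \<circ> \<sigma>) {..<k}" for y
    using jsk \<sigma> by (auto simp: proj_def restrict_def \<sigma>_def fun_eq_iff)
  have A: "proj js -` B \<inter> space (Rn n) \<in> sets (Rn n)"
    using proj_measurable[of js n] jsk B by (auto intro: measurable_sets)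
  have "npoint k t (proj js x) = npoint k t (x \<circ> \<sigma>)"
    by (rule npoint_cong[OF t]) (use kn jsk in \<open>auto simp: proj_def \<sigma>_def\<close>)
  then have "measure (npoint k t (proj js x)) B = measure (npoint k t (x \<circ> \<sigma>)) B" by simp
  also have "\<dots> = measure (flow t (x \<circ> \<sigma>)) {y. restrict y {..<k} \<in> B}" by (rule npoint_measure[OF t B])
  also have "\<dots> = measure (flow t x) {y. y \<circ> \<sigma> \<in> {y. restrict y {..<k} \<in> B}}"
  proof -
    have "{y. restrict y {..<k} \<in> B} \<in> sets Rinf"
      using measurable_sets[OF restrict_measurable_Rn B] by (simp add: vimage_def)
    from measure_relabel[OF sets_flow[OF t] this] show ?thesis by (simp add: flow_relabel[OF t])
  qed
  also have "\<dots> = measure (npoint n t x) (proj js -` B \<inter> space (Rn n))"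
    unfolding npoint_measure[OF t A] by (simp add: pr)
  finally show "measure (npoint n t x) (proj js -` B \<inter> space (Rn n)) = measure (npoint k t (proj js x)) B" ..
qed (rule npoint_kernel[OF t])

lemma npoint_one:
  assumes t: "0 \<le> t" shows "npoint 1 t x = distr (P t (x 0)) (Rn 1) embed1"
proof -
  have e: "embed1 \<in> borel \<rightarrow>\<^sub>M Rn 1"
    unfolding embed1_def[abs_def] by (intro measurable_restrict) auto
  have "distr (P t (x 0)) (Rn 1) embed1 = distr (distr (flow t x) borel (\<lambda>y. y 0)) (Rn 1) embed1"
    by (simp add: flow_marginal[OF t])
  also have "\<dots> = distr (flow t x) (Rn 1) (embed1 \<circ> (\<lambda>y. y 0))"
    by (rule distr_distr[OF e]) (simp add: measurable_cong_sets[OF sets_flow[OF t] refl])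
  also have "embed1 \<circ> (\<lambda>y. y 0) = (\<lambda>y. restrict y {..<1})"
    by (auto simp: embed1_def restrict_def fun_eq_iff)
  finally show ?thesis unfolding npoint_def by (rule sym)
qed

end

text \<open>Negative times are irrelevant; reading \<open>P t\<close> as \<open>P \<bar>t\<bar>\<close> makes every \<open>P t\<close> a kernel.\<close>
lemma feller_mono_semigroup_abs:
  fixes P :: "real \<Rightarrow> real \<Rightarrow> real measure"
  assumes feller: "feller_semigroup borel P" and mono: "stoch_monotone P"
  shows "feller_mono_semigroup (\<lambda>t. P \<bar>t\<bar>)"
proof (intro feller_mono_semigroup.intro mono_semigroup.intro feller_mono_semigroup_axioms.intro)
  have kernel: "P t \<in> borel \<rightarrow>\<^sub>M prob_algebra borel" if "0 \<le> t" for t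
    using feller that unfolding feller_semigroup_def markov_semigroup_def markov_kernel_def by blast
  show "mono_kernel (P \<bar>t\<bar>)" for t
  proof
    show "P \<bar>t\<bar> \<in> borel \<rightarrow>\<^sub>M prob_algebra borel" by (rule kernel) simp
    fix D and r s :: real assume D: "is_down D" and rs: "r \<le> s"
    have Dm: "D \<in> sets borel" by (rule is_down_borel[OF D])
    \<comment> \<open>The complement is used because its indicator is the non-decreasing one;
      monotonicity of its mean reverses for \<open>D\<close>.\<close>
    have compl: "kernel_apply (P \<bar>t\<bar>) (indicator (- D)) u = 1 - measure (P \<bar>t\<bar> u) D" for u
    proof -
      interpret prob_space "P \<bar>t\<bar> u" by (rule kernel_prob[OF kernel]) auto
      have s: "sets (P \<bar>t\<bar> u) = sets borel" by (rule kernel_sets[OF kernel]) auto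
      have sp: "space (P \<bar>t\<bar> u) = UNIV" using sets_eq_imp_space_eq[OF s] by simp
      have "kernel_apply (P \<bar>t\<bar>) (indicator (- D)) u = prob (- D)"
        unfolding kernel_apply_def by (simp add: sp)
      also have "\<dots> = 1 - prob D"
        using prob_compl[of D] Dm by (simp add: s sp Compl_eq_Diff_UNIV)
      finally show ?thesis .
    qed
    have "mono (indicator (- D) :: real \<Rightarrow> real)"
      using D by (auto simp: mono_def is_down_def indicator_def)
    moreover have "bounded (range (indicator (- D) :: real \<Rightarrow> real))"
      unfolding bounded_real by (intro exI[of _ 1]) (auto simp: indicator_def)
    moreover have "(indicator (- D) :: real \<Rightarrow> real) \<in> borel_measurable borel"
      using Dm by (intro borel_measurable_indicator) (simp add: Compl_eq_Diff_UNIV)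
    ultimately have "mono (kernel_apply (P \<bar>t\<bar>) (indicator (- D)))"
      using mono abs_ge_zero[of t] unfolding stoch_monotone_def by blast
    from monoD[OF this rs] show "measure (P \<bar>t\<bar> s) D \<le> measure (P \<bar>t\<bar> r) D"
      unfolding compl by simp
  qed
  show "P \<bar>0\<bar> = return borel"
    using feller unfolding feller_semigroup_def markov_semigroup_def by (simp add: fun_eq_iff)
  show "P \<bar>s + t\<bar> = (\<lambda>r. P \<bar>s\<bar> r \<bind> P \<bar>t\<bar>)" if "0 \<le> s" "0 \<le> t" for s t
    using feller that unfolding feller_semigroup_def markov_semigroup_def by (simp add: fun_eq_iff)
  show "feller_semigroup borel (\<lambda>t. P \<bar>t\<bar>)"
    using feller unfolding feller_semigroup_def markov_semigroup_def by simp
qed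

theorem theorem1:
  fixes P :: "real \<Rightarrow> real \<Rightarrow> real measure"
  assumes "feller_semigroup borel P"
    and "stoch_monotone P"
  shows "\<exists>Q :: nat \<Rightarrow> real \<Rightarrow> (nat \<Rightarrow> real) \<Rightarrow> (nat \<Rightarrow> real) measure.
     (\<forall>t\<ge>0. \<forall>x\<in>space (Rn 1). Q 1 t x = distr (P t (x 0)) (Rn 1) embed1) \<and>
     (\<forall>n\<ge>2. feller_semigroup (Rn n) (Q n) \<and> (\<forall>t\<ge>0. order_preserving n (Q n t))) \<and>
     (\<forall>t\<ge>0. consistent (\<lambda>n. Q n t))"
proof -
  interpret feller_mono_semigroup "\<lambda>t. P \<bar>t\<bar>"
    by (rule feller_mono_semigroup_abs[OF assms])
  show ?thesis
  proof (intro exI[of _ npoint] conjI allI impI ballI)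
    show "npoint 1 t x = distr (P t (x 0)) (Rn 1) embed1" if "0 \<le> t" for t x
      using npoint_one[OF that] that by simp
    show "feller_semigroup (Rn n) (npoint n)" if "2 \<le> n" for n
      using that by (intro feller_npoint) simp
  qed (rule npoint_order_preserving npoint_consistent; assumption)+
qed

end
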